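(* When the dimension $d$ and the number of factors $n$ are fixed, the value of \[ \int_{P}\frac{(\langle\ell_1,x\rangle+r_1)^{m_1}\cdots(\langle\ell_n,x\rangle+r_n)^{m_n}}{m_1!\cdots m_n!}\,\mathrm{d}x \] can be computed in polynomial time in $M:=\sum_{i=1}^n m_i$ and the binary encoding size of $P$, $\ell_i$ and $r_i$ for $1\le i\le n$.
   Context: $P\subset\mathbb{R}^d$ is a $d$-dimensional rational polytope given by an inequality description $P=\{x\in\mathbb{R}^d : Ax\le b\}$ with $A$ and $b$ rational; $\ell_1,\dots,\ell_n\in\mathbb{Q}^d$, $r_1,\dots,r_n\in\mathbb{Q}$, and $m_1,\dots,m_n$ are nonnegative integers. $\langle\cdot,\cdot\rangle$ is the standard dot product on $\mathbb{R}^d$. The value is computed exactly, as a rational number. *)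

theory Defs
  imports "HOL-Analysis.Analysis" "HOL-Library.Log_Nat" "HOL-Computational_Algebra.Polynomial"
begin

section \<open>Polynomial time: random access machines with logarithmic cost\<close>

text \<open>
  Computations are carried out by a random access machine with unbounded integer
  cells and indirect addressing, under the logarithmic cost criterion of Aho, Hopcroft and Ullman:
  an operation is charged the binary lengths of all integers it handles, addresses included.
  Since no integer can be produced without paying for its length (up to a constant factor),
  polynomial time on this machine is the same as polynomial time on a Turing machine.
  Control flow is structured (conditionals and loops) instead of by jumps.
\<close>

text \<open>Binary digits of the absolute value, and one sign bit. In particular \<open>int_size 0 = 1\<close>.\<close>

definition int_size :: "int \<Rightarrow> nat"
  where "int_size z = 1 + floorlog 2 (nat \<bar>z\<bar>)"

type_synonym mem = "int \<Rightarrow> int"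

datatype binop = Add | Sub | Mul | Div

datatype exp = Const int | Load exp | Op binop exp exp

datatype com =
    Skip
  | Store exp exp
  | Seq com com
  | IfPos exp com com
  | WhilePos exp com

text \<open>\<open>Div\<close> is rounded towards minus infinity, and division by zero yields zero.\<close>

fun binop_val :: "binop \<Rightarrow> int \<Rightarrow> int \<Rightarrow> int" where
  "binop_val Add x y = x + y"
| "binop_val Sub x y = x - y"
| "binop_val Mul x y = x * y"
| "binop_val Div x y = x div y"

fun exp_val :: "exp \<Rightarrow> mem \<Rightarrow> int" where
  "exp_val (Const z) s = z"
| "exp_val (Load e) s = s (exp_val e s)"
| "exp_val (Op f e1 e2) s = binop_val f (exp_val e1 s) (exp_val e2 s)"

fun exp_cost :: "exp \<Rightarrow> mem \<Rightarrow> nat" where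
  "exp_cost (Const z) s = int_size z"
| "exp_cost (Load e) s =
     exp_cost e s + int_size (exp_val e s) + int_size (s (exp_val e s))"
| "exp_cost (Op f e1 e2) s =
     exp_cost e1 s + exp_cost e2 s + int_size (exp_val e1 s) + int_size (exp_val e2 s)"

text \<open>
  \<open>exec c s t s'\<close>: started in memory \<open>s\<close>, the program \<open>c\<close> halts in memory \<open>s'\<close> after time \<open>t\<close>.
\<close>

inductive exec :: "com \<Rightarrow> mem \<Rightarrow> nat \<Rightarrow> mem \<Rightarrow> bool" where
  Skip: "exec Skip s 1 s"
| Store: "exec (Store e1 e2) s
            (exp_cost e1 s + exp_cost e2 s + int_size (exp_val e1 s) + int_size (exp_val e2 s))
            (s(exp_val e1 s := exp_val e2 s))"
| Seq: "exec c1 s1 t1 s2 \<Longrightarrow> exec c2 s2 t2 s3 \<Longrightarrow> exec (Seq c1 c2) s1 (t1 + t2) s3"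
| IfTrue: "exp_val e s > 0 \<Longrightarrow> exec c1 s t s' \<Longrightarrow>
     exec (IfPos e c1 c2) s (exp_cost e s + int_size (exp_val e s) + t) s'"
| IfFalse: "exp_val e s \<le> 0 \<Longrightarrow> exec c2 s t s' \<Longrightarrow>
     exec (IfPos e c1 c2) s (exp_cost e s + int_size (exp_val e s) + t) s'"
| WhileFalse: "exp_val e s \<le> 0 \<Longrightarrow>
     exec (WhilePos e c) s (exp_cost e s + int_size (exp_val e s)) s"
| WhileTrue: "exp_val e s1 > 0 \<Longrightarrow> exec c s1 t1 s2 \<Longrightarrow> exec (WhilePos e c) s2 t2 s3 \<Longrightarrow>
     exec (WhilePos e c) s1 (exp_cost e s1 + int_size (exp_val e s1) + t1 + t2) s3"

inductive_cases SkipE: "exec Skip s t s'"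
  and StoreE: "exec (Store e1 e2) s t s'"
  and SeqE: "exec (Seq c1 c2) s t s'"
  and IfE: "exec (IfPos e c1 c2) s t s'"
  and WhileE: "exec (WhilePos e c) s t s'"

lemma exec_deterministic:
  "exec c s t s' \<Longrightarrow> exec c s u s'' \<Longrightarrow> u = t \<and> s'' = s'"
proof (induction arbitrary: u s'' rule: exec.induct)
  case (Skip s)
  then show ?case by (auto elim: SkipE)
next
  case (Store e1 s e2)
  then show ?case by (auto elim: StoreE)
next
  case (Seq c1 s1 t1 s2 c2 t2 s3)
  from Seq.prems show ?case by (rule SeqE) (use Seq.IH in blast)
next
  case (IfTrue e s c1 t s' c2)
  from IfTrue.prems show ?case
    by (rule IfE) (use IfTrue.IH IfTrue.hyps(1) in \<open>auto dest: IfTrue.IH\<close>)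
next
  case (IfFalse e s c2 t s' c1)
  from IfFalse.prems show ?case
    by (rule IfE) (use IfFalse.IH IfFalse.hyps(1) in \<open>auto dest: IfFalse.IH\<close>)
next
  case (WhileFalse e s c)
  from WhileFalse.prems show ?case by (rule WhileE) (use WhileFalse.hyps in auto)
next
  case (WhileTrue e s1 c t1 s2 t2 s3)
  from WhileTrue.prems show ?case
  proof (rule WhileE)
    assume "exp_val e s1 \<le> 0"
    then show ?thesis using WhileTrue.hyps(1) by simp
  next
    fix v1 r v2
    assume u: "u = exp_cost e s1 + int_size (exp_val e s1) + v1 + v2"
      and "exec c s1 v1 r" and w: "exec (WhilePos e c) r v2 s''"
    then have "v1 = t1 \<and> r = s2" using WhileTrue.IH(1) by blast
    with u w WhileTrue.IH(2) show ?thesis by blast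
  qed
qed

text \<open>The input occupies the cells \<open>0, 1, \<dots>\<close>; every other cell initially holds \<open>0\<close>.\<close>

definition initial_mem :: "int list \<Rightarrow> mem"
  where "initial_mem xs a = (if 0 \<le> a \<and> a < int (length xs) then xs ! nat a else 0)"

text \<open>On input \<open>xs\<close>, the program halts within time \<open>T\<close> with \<open>ys\<close> in the cells \<open>0, 1, \<dots>\<close>.\<close>

definition computes_within :: "com \<Rightarrow> int list \<Rightarrow> int list \<Rightarrow> nat \<Rightarrow> bool"
  where "computes_within c xs ys T \<longleftrightarrow>
    (\<exists>t s. exec c (initial_mem xs) t s \<and> t \<le> T \<and> (\<forall>i<length ys. s (int i) = ys ! i))"


section \<open>Rational data and their binary encodings\<close>

definition real_vec :: "rat ^ 'd \<Rightarrow> real ^ 'd"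
  where "real_vec v = (\<chi> j. real_of_rat (v $ j))"

text \<open>The solution set of \<open>A x \<le> b\<close>, where \<open>A\<close> has the \<open>k\<close> rows \<open>A 0, \<dots>, A (k - 1)\<close>.\<close>

definition rational_polyhedron :: "nat \<Rightarrow> (nat \<Rightarrow> rat ^ 'd) \<Rightarrow> (nat \<Rightarrow> rat) \<Rightarrow> (real ^ 'd) set"
  where "rational_polyhedron k A b = {x. \<forall>i<k. real_vec (A i) \<bullet> x \<le> real_of_rat (b i)}"

text \<open>Numerator and denominator in lowest terms, with positive denominator.\<close>

definition enc_rat :: "rat \<Rightarrow> int list"
  where "enc_rat q = [fst (quotient_of q), snd (quotient_of q)]"

text \<open>The list \<open>js\<close> fixes the order in which the coordinates are written down.\<close>

definition enc_vec :: "'d list \<Rightarrow> rat ^ 'd \<Rightarrow> int list"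
  where "enc_vec js v = concat (map (\<lambda>j. enc_rat (v $ j)) js)"

definition enc_affine_list ::
    "'d list \<Rightarrow> nat \<Rightarrow> (nat \<Rightarrow> rat ^ 'd) \<Rightarrow> (nat \<Rightarrow> rat) \<Rightarrow> int list"
  where "enc_affine_list js k v c = concat (map (\<lambda>i. enc_vec js (v i) @ enc_rat (c i)) [0..<k])"

definition enc_polyhedron ::
    "'d list \<Rightarrow> nat \<Rightarrow> (nat \<Rightarrow> rat ^ 'd) \<Rightarrow> (nat \<Rightarrow> rat) \<Rightarrow> int list"
  where "enc_polyhedron js k A b = int k # enc_affine_list js k A b"

definition enc_exponents :: "nat \<Rightarrow> (nat \<Rightarrow> nat) \<Rightarrow> int list"
  where "enc_exponents n m = map (\<lambda>i. int (m i)) [0..<n]"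

definition enc_size :: "int list \<Rightarrow> nat"
  where "enc_size xs = sum_list (map int_size xs)"

end

theory Submission
  imports Defs
begin

text \<open>
  Scale the forms to integer coefficients and merge them by Kronecker substitution: with \<open>f\<^sub>i\<close> the
  \<open>i\<close>-th scaled form, \<open>M = \<Sum> m\<^sub>i\<close> and \<open>K > M\<close>, the wanted integral is, up to the scaling, the coefficient of
  \<open>Z\<close> to the power \<open>\<Sum> m\<^sub>i K\<^sup>i\<close> in \<open>I(Z) = \<integral>\<^sub>P L\<^sup>M / M!\<close>, where \<open>L = \<Sum> Z\<^bsup>K^i\<^esup> f\<^sub>i\<close>.
  Adding the coordinates to the \<open>f\<^sub>i\<close> with exponent \<open>0\<close> makes \<open>L\<close> generic.

  The power of a generic affine form has a power of the same form as antiderivative in the last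
  coordinate. So Fubini and the fundamental theorem of calculus express \<open>I(Z)\<close> as a signed sum over the
  facets, and substituting the equation of a facet eliminates the last coordinate while keeping the
  integrand a power of an affine form. After \<open>d\<close> steps \<open>I(Z)\<close> is a sum, over the at most \<open>K\<^sup>d\<close>
  sequences of facets, of explicit fractions, whose denominators vanish for no large integer \<open>Z\<close>.

  Put over the common denominator \<open>S(Z)\<close>, this is an equation \<open>(M + d)! I S = T\<close> of polynomials with \<open>S\<close> and
  \<open>T\<close> integral, so by Gauss's lemma the leading coefficient of \<open>S\<close> (a product of pivots) is a common
  denominator of the coefficients of \<open>(M + d)! I\<close>. Since these are bounded explicitly, they can be read off as
  base-\<open>Z\<close> digits of the value at a single large integer \<open>Z\<close>. Only integer arithmetic
  with sums and products of polynomially many terms is needed, which the machine does in polynomial time.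
\<close>

section \<open>A loop language and its compilation\<close>

text \<open>Computing with polynomials in \<open>Z\<close>, or expanding the product into monomials,
  would need tables; with one large integer in place of \<open>Z\<close> every intermediate result
  is a single number. The price is that the value of a quotient \<open>T/S\<close> at one point says
  nothing about its coefficients unless a multiple with integral and bounded coefficients is known.
  This is why Gauss's lemma and an a priori bound for the coordinates on \<open>P\<close> are
  needed. Genericity matters because the denominators contain the coefficients of the eliminated
  forms; the powers of \<open>Z\<close> attached to the coordinates dominate these coefficients and
  survive every elimination. Several facets can yield the same endpoint of a fiber, even on a whole
  open set when an inequality is repeated or two inequalities become proportional after an
  elimination. A signed sum over facets then counts correctly only with a tie-breaking rule, and
  this rule is carried along in the form of strict inequalities. Pivots enter as squares, which
  keeps the direction of inequalities and makes the leading coefficient of \<open>S\<close>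
  positive.\<close>

lemma int_size_le_iff: "int_size z \<le> Suc b \<longleftrightarrow> \<bar>z\<bar> < 2 ^ b"
proof -
  have "int_size z \<le> Suc b \<longleftrightarrow> nat \<bar>z\<bar> < 2 ^ b"
    by (auto simp: int_size_def floorlog_le_iff)
  also have "\<dots> \<longleftrightarrow> \<bar>z\<bar> < 2 ^ b"
    by (simp add: nat_less_iff)
  finally show ?thesis .
qed

lemma int_size_pos: "0 < int_size z"
  by (simp add: int_size_def)

lemma int_size_abs_less: "\<bar>z\<bar> < 2 ^ (int_size z - 1)"
  using int_size_le_iff[of z "int_size z - 1"] int_size_pos[of z] by simp

lemma int_size_mono: "\<bar>x\<bar> \<le> \<bar>y\<bar> \<Longrightarrow> int_size x \<le> int_size y"
  by (simp add: int_size_def floorlog_mono nat_mono)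

lemma int_size_int_le: "int_size (int i) \<le> Suc i"
  unfolding int_size_le_iff by (simp add: of_nat_less_two_power)

lemma abs_div_le_abs: "\<bar>x div y\<bar> \<le> \<bar>x :: int\<bar>"
proof (cases "y = 0")
  case False
  have *: "\<bar>x div y\<bar> \<le> \<bar>x\<bar>" if "0 < y" for x y :: int
  proof (cases "0 \<le> x")
    case True
    then show ?thesis
      using that by (metis abs_of_nonneg div_le_dividend nat_0_le nat_div_distrib of_nat_le_iff
          order_less_imp_le pos_imp_zdiv_nonneg_iff)
  next
    case False
    \<comment> \<open>For negative \<open>x\<close> the quotient is rounded away from zero, so it is
      compared with \<open>x = x * y div y\<close>, where \<open>x * y \<le> x\<close>.\<close>
    have "x * y \<le> x * 1" using that False by (intro mult_left_mono_neg) auto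
    then have "x * y div y \<le> x div y" using that by (intro zdiv_mono1) auto
    then have "x \<le> x div y" using that by simp
    moreover have "x div y \<le> 0" using False that by (simp add: div_nonpos_pos_le0)
    ultimately show ?thesis by linarith
  qed
  show ?thesis
  proof (cases "0 < y")
    case True
    then show ?thesis by (rule *)
  next
    case F: False
    then have "x div y = (- x) div (- y)" by simp
    then show ?thesis using *[of "-y" "-x"] F False by linarith
  qed
qed simp

text \<open>Lengths at most add up under each of the four operations. An iteration therefore
  lengthens its result only by the total length of the operands, never by repeated doubling.\<close>

lemma int_size_binop: "int_size (binop_val f x y) \<le> int_size x + int_size y"
proof -
  define a b where "a = int_size x - 1" and "b = int_size y - 1"
  have x: "\<bar>x\<bar> < 2 ^ a" and y: "\<bar>y\<bar> < 2 ^ b"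
    using int_size_abs_less by (auto simp: a_def b_def)
  have ab: "Suc (a + b) \<le> int_size x + int_size y"
    using int_size_pos[of x] int_size_pos[of y] by (simp add: a_def b_def)
  \<comment> \<open>Expanding the product bounds \<open>2 ^ a + 2 ^ b\<close>. The operands of a sum
    or difference are at most \<open>2 ^ a - 1\<close> and \<open>2 ^ b - 1\<close> in absolute
    value, so the result stays below \<open>2 ^ (a + b)\<close>.\<close>
  have "0 \<le> ((2::int) ^ a - 1) * (2 ^ b - 1)" by simp
  then have s: "(2::int) ^ a + 2 ^ b \<le> 2 ^ (a + b) + 1"
    by (simp add: algebra_simps power_add)
  have "\<bar>binop_val f x y\<bar> < 2 ^ (a + b)"
  proof (cases f)
    case Mul
    have "\<bar>x\<bar> * \<bar>y\<bar> < 2 ^ a * 2 ^ b"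
      by (rule mult_strict_mono) (use x y in auto)
    then show ?thesis using Mul by (simp add: abs_mult power_add)
  next
    case Div
    have "(2::int) ^ a * 1 \<le> 2 ^ a * 2 ^ b" by (intro mult_left_mono) auto
    then show ?thesis
      using x abs_div_le_abs[of x y] unfolding power_add Div binop_val.simps by linarith
  qed (use x y s in auto)
  then have "int_size (binop_val f x y) \<le> Suc (a + b)" by (simp add: int_size_le_iff)
  then show ?thesis using ab by linarith
qed

text \<open>All loops run \<open>K\<close> times, where \<open>K\<close> (written \<open>Bound\<close>) is fixed before the evaluation and
  polynomial in the input size; this is why every term can be evaluated in polynomial time.\<close>

datatype tm =
    Lit int
  | Var nat
  | Bound
  | Input tm
  | Bin binop tm tm
  | Cond tm tm tm
  | Loop binop int nat tm

text \<open>The operands \<open>g i\<close> depend on the index alone and not on the accumulator.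
  Repeated squaring is thereby impossible, which keeps all values of polynomial length.\<close>

fun iter_val :: "binop \<Rightarrow> int \<Rightarrow> (nat \<Rightarrow> int) \<Rightarrow> nat \<Rightarrow> int" where
  "iter_val f z g 0 = z"
| "iter_val f z g (Suc i) = binop_val f (iter_val f z g i) (g i)"

text \<open>Negative addresses read as \<open>0\<close> because the negative cells of the machine
  will hold the registers of the compiled program.\<close>

fun tval :: "mem \<Rightarrow> nat \<Rightarrow> tm \<Rightarrow> (nat \<Rightarrow> int) \<Rightarrow> int" where
  "tval inp K (Lit z) env = z"
| "tval inp K (Var x) env = env x"
| "tval inp K Bound env = int K"
| "tval inp K (Input t) env = (let a = tval inp K t env in if a < 0 then 0 else inp a)"
| "tval inp K (Bin f t u) env = binop_val f (tval inp K t env) (tval inp K u env)"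
| "tval inp K (Cond c t u) env =
     (if tval inp K c env > 0 then tval inp K t env else tval inp K u env)"
| "tval inp K (Loop f z x t) env = iter_val f z (\<lambda>i. tval inp K t (env(x := int i))) K"

lemma iter_val_Add: "iter_val Add z g K = z + (\<Sum>i<K. g i)"
  by (induction K) auto

lemma iter_val_Mul: "iter_val Mul z g K = z * (\<Prod>i<K. g i)"
  by (induction K) auto

text \<open>\<open>N\<close> bounds the number of iterations as well as the length of every input
  cell and variable. For a fixed term the result is polynomial in \<open>N\<close>, since each loop
  contributes a factor \<open>N\<close> and the nesting depth is fixed.\<close>

fun tm_size :: "tm \<Rightarrow> nat \<Rightarrow> nat" where
  "tm_size (Lit z) N = int_size z"
| "tm_size (Var x) N = N"
| "tm_size Bound N = Suc N"
| "tm_size (Input t) N = Suc N"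
| "tm_size (Bin f t u) N = tm_size t N + tm_size u N"
| "tm_size (Cond c t u) N = tm_size t N + tm_size u N"
| "tm_size (Loop f z x t) N = int_size z + N * tm_size t N"

lemma int_size_iter_val:
  assumes "\<And>i. i < n \<Longrightarrow> int_size (g i) \<le> B"
  shows "int_size (iter_val f z g n) \<le> int_size z + n * B"
  using assms
proof (induction n)
  case (Suc n)
  have "int_size (iter_val f z g (Suc n)) \<le> int_size (iter_val f z g n) + int_size (g n)"
    by (simp add: int_size_binop)
  also have "\<dots> \<le> (int_size z + n * B) + B"
    using Suc by (intro add_mono) auto
  finally show ?case by simp
qed simp

lemma int_size_tval:
  assumes "K \<le> N" "\<And>a. 0 \<le> a \<Longrightarrow> int_size (inp a) \<le> N" "\<And>x. int_size (env x) \<le> N"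
  shows "int_size (tval inp K t env) \<le> tm_size t N"
  using assms(3)
proof (induction t arbitrary: env)
  case Bound
  then show ?case using int_size_int_le[of K] assms(1) by simp
next
  case (Input t)
  have "int_size 0 \<le> Suc N" using int_size_le_iff[of 0 N] by simp
  then show ?case using assms(2) by (auto simp: Let_def le_SucI)
next
  case (Bin f t u)
  have "int_size (tval inp K (Bin f t u) env)
      \<le> int_size (tval inp K t env) + int_size (tval inp K u env)"
    by (simp add: int_size_binop)
  also have "\<dots> \<le> tm_size t N + tm_size u N" using Bin by (intro add_mono) auto
  finally show ?case by simp
next
  case (Cond c t u)
  have "int_size (tval inp K t env) \<le> tm_size t N" "int_size (tval inp K u env) \<le> tm_size u N"
    using Cond by auto
  then show ?case by auto
next
  case (Loop f z x t)
  have "int_size (iter_val f z (\<lambda>i. tval inp K t (env(x := int i))) K)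
      \<le> int_size z + K * tm_size t N"
  proof (rule int_size_iter_val)
    fix i assume "i < K"
    \<comment> \<open>A loop index is smaller than \<open>K\<close>, so even the crude bound
      \<open>i + 1\<close> for its length stays within \<open>N\<close>, and the assumption on the
      variables is maintained.\<close>
    then have "int_size (int i) \<le> N"
      using int_size_int_le[of i] assms(1) by linarith
    then show "int_size (tval inp K t (env(x := int i))) \<le> tm_size t N"
      using Loop by auto
  qed
  also have "\<dots> \<le> int_size z + N * tm_size t N" using assms(1) by simp
  finally show ?case by simp
qed auto

section \<open>Polynomially bounded functions\<close>

definition poly_bdd :: "(nat \<Rightarrow> nat) \<Rightarrow> bool"
  where "poly_bdd f \<longleftrightarrow> (\<exists>p :: nat poly. \<forall>N. f N \<le> poly p N)"

lemma poly_bdd_const: "poly_bdd (\<lambda>N. c)"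
  unfolding poly_bdd_def by (rule exI[of _ "[:c:]"]) simp

lemma poly_bdd_id: "poly_bdd (\<lambda>N. N)"
  unfolding poly_bdd_def by (rule exI[of _ "[:0, 1:]"]) simp

lemma poly_bdd_add:
  assumes "poly_bdd f" "poly_bdd g"
  shows "poly_bdd (\<lambda>N. f N + g N)"
proof -
  from assms obtain p q where "\<forall>N. f N \<le> poly p N" "\<forall>N. g N \<le> poly q N"
    unfolding poly_bdd_def by blast
  then show ?thesis unfolding poly_bdd_def
    by (intro exI[of _ "p + q"]) (auto intro: add_mono)
qed

lemma poly_bdd_mult:
  assumes "poly_bdd f" "poly_bdd g"
  shows "poly_bdd (\<lambda>N. f N * g N)"
proof -
  from assms obtain p q where "\<forall>N. f N \<le> poly p N" "\<forall>N. g N \<le> poly q N"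
    unfolding poly_bdd_def by blast
  then show ?thesis unfolding poly_bdd_def
    by (intro exI[of _ "p * q"]) (auto intro: mult_mono)
qed

lemma poly_bdd_Suc: "poly_bdd f \<Longrightarrow> poly_bdd (\<lambda>N. Suc (f N))"
  using poly_bdd_add[of f "\<lambda>_. 1", OF _ poly_bdd_const] by simp

lemma poly_bdd_tm_size: "poly_bdd (\<lambda>N. tm_size t N)"
  by (induction t)
    (simp_all, (intro poly_bdd_add poly_bdd_mult poly_bdd_Suc poly_bdd_id poly_bdd_const; assumption?)+)

lemmas poly_bdd_intros =
  poly_bdd_add poly_bdd_mult poly_bdd_Suc poly_bdd_tm_size poly_bdd_id poly_bdd_const

section \<open>Registers, compilation and running time\<close>

text \<open>The nonnegative cells keep the input. Below them, \<open>-1\<close> holds the iteration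
  bound, the even addresses hold the variables and the remaining odd ones the temporaries, so
  neither supply is limited and they never collide.\<close>

definition reg_bound :: exp where "reg_bound = Const (-1)"
definition reg_var :: "nat \<Rightarrow> exp" where "reg_var x = Const (- 2 - 2 * int x)"
definition reg_tmp :: "nat \<Rightarrow> exp" where "reg_tmp r = Const (- 3 - 2 * int r)"

text \<open>\<open>r\<close> is a stack height: the result goes to temporary \<open>r\<close>, and
  only temporaries from \<open>r\<close> upwards are overwritten. A loop saves the old value of its
  variable in temporary \<open>r\<close> and accumulates in the next one, so a nested loop may reuse
  the variable. The \<open>+ 1\<close> in the case of \<open>Input\<close> turns the test for
  positivity into one for nonnegativity.\<close>

fun compile :: "tm \<Rightarrow> nat \<Rightarrow> com" where
  "compile (Lit z) r = Store (reg_tmp r) (Const z)"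
| "compile (Var x) r = Store (reg_tmp r) (Load (reg_var x))"
| "compile Bound r = Store (reg_tmp r) (Load reg_bound)"
| "compile (Input t) r = Seq (compile t r)
     (IfPos (Op Add (Load (reg_tmp r)) (Const 1))
       (Store (reg_tmp r) (Load (Load (reg_tmp r))))
       (Store (reg_tmp r) (Const 0)))"
| "compile (Bin f t u) r = Seq (compile t r) (Seq (compile u (Suc r))
     (Store (reg_tmp r) (Op f (Load (reg_tmp r)) (Load (reg_tmp (Suc r))))))"
| "compile (Cond c t u) r =
     Seq (compile c r) (IfPos (Load (reg_tmp r)) (compile t r) (compile u r))"
| "compile (Loop f z x t) r =
     Seq (Store (reg_tmp r) (Load (reg_var x)))
    (Seq (Store (reg_tmp (Suc r)) (Const z))
    (Seq (Store (reg_var x) (Const 0))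
    (Seq (WhilePos (Op Sub (Load reg_bound) (Load (reg_var x)))
       (Seq (compile t (Suc (Suc r)))
       (Seq (Store (reg_tmp (Suc r)) (Op f (Load (reg_tmp (Suc r))) (Load (reg_tmp (Suc (Suc r))))))
            (Store (reg_var x) (Op Add (Load (reg_var x)) (Const 1))))))
    (Seq (Store (reg_var x) (Load (reg_tmp r)))
         (Store (reg_tmp r) (Load (reg_tmp (Suc r))))))))"

definition represents :: "mem \<Rightarrow> nat \<Rightarrow> (nat \<Rightarrow> int) \<Rightarrow> mem \<Rightarrow> bool" where
  "represents inp K env s \<longleftrightarrow>
     (\<forall>a\<ge>0. s a = inp a) \<and> s (-1) = int K \<and> (\<forall>x. s (- 2 - 2 * int x) = env x)"

definition preserves :: "nat \<Rightarrow> mem \<Rightarrow> mem \<Rightarrow> bool" where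
  "preserves r s s' \<longleftrightarrow> (\<forall>a. (\<forall>q\<ge>r. a \<noteq> - 3 - 2 * int q) \<longrightarrow> s' a = s a)"

definition small :: "nat \<Rightarrow> mem \<Rightarrow> nat \<Rightarrow> (nat \<Rightarrow> int) \<Rightarrow> bool" where
  "small N inp K env \<longleftrightarrow> K \<le> N \<and> (\<forall>a\<ge>0. int_size (inp a) \<le> N) \<and> (\<forall>x. int_size (env x) \<le> N)"

definition runs :: "com \<Rightarrow> mem \<Rightarrow> nat \<Rightarrow> mem \<Rightarrow> bool" where
  "runs c s T s' \<longleftrightarrow> (\<exists>t\<le>T. exec c s t s')"

definition compiles :: "tm \<Rightarrow> nat \<Rightarrow> (nat \<Rightarrow> nat) \<Rightarrow> bool" where
  "compiles t r T \<longleftrightarrow> (\<forall>N inp K env s. small N inp K env \<longrightarrow> represents inp K env s \<longrightarrow>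
     (\<exists>s'. runs (compile t r) s (T N) s' \<and> preserves r s s' \<and>
           s' (- 3 - 2 * int r) = tval inp K t env))"

lemma runs_Store:
  assumes "exp_cost e1 s + exp_cost e2 s + int_size (exp_val e1 s) + int_size (exp_val e2 s) \<le> T"
  shows "runs (Store e1 e2) s T (s(exp_val e1 s := exp_val e2 s))"
  using assms exec.Store unfolding runs_def by blast

lemma runs_Seq: "runs c1 s T1 s' \<Longrightarrow> runs c2 s' T2 s'' \<Longrightarrow> T1 + T2 \<le> T \<Longrightarrow> runs (Seq c1 c2) s T s''"
  unfolding runs_def by (meson add_mono exec.Seq order_trans)

lemma runs_IfPos:
  assumes "exp_val e s > 0 \<Longrightarrow> runs c1 s T' s'" "exp_val e s \<le> 0 \<Longrightarrow> runs c2 s T' s'"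
    and "exp_cost e s + int_size (exp_val e s) + T' \<le> T"
  shows "runs (IfPos e c1 c2) s T s'"
proof (cases "exp_val e s > 0")
  case True
  then show ?thesis
    using assms(1,3) exec.IfTrue[of e s c1 _ s' c2] unfolding runs_def
    by (meson add_left_mono order_trans)
next
  case False
  then show ?thesis
    using assms(2,3) exec.IfFalse[of e s c2 _ s' c1] unfolding runs_def
    by (meson add_left_mono order_trans not_less)
qed

lemma runs_WhilePos:
  assumes "exp_val e s > 0" "runs c s T1 s2" "runs (WhilePos e c) s2 T2 s3"
    and "exp_cost e s + int_size (exp_val e s) + T1 + T2 \<le> T"
  shows "runs (WhilePos e c) s T s3"
proof -
  obtain t1 t2 where t: "t1 \<le> T1" "exec c s t1 s2" "t2 \<le> T2" "exec (WhilePos e c) s2 t2 s3"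
    using assms(2,3) unfolding runs_def by blast
  then have "exec (WhilePos e c) s (exp_cost e s + int_size (exp_val e s) + t1 + t2) s3"
    using exec.WhileTrue assms(1) by blast
  moreover have "exp_cost e s + int_size (exp_val e s) + t1 + t2 \<le> T"
    using t(1,3) assms(4) by linarith
  ultimately show ?thesis unfolding runs_def by blast
qed

lemma preserves_represents:
  assumes "represents inp K env s" "preserves r s s'"
  shows "represents inp K env s'"
proof -
  have "s' a = s a" if "a \<ge> -1" for a
    using assms(2) that unfolding preserves_def by fastforce
  moreover have "s' (- 2 - 2 * int x) = s (- 2 - 2 * int x)" for x
  proof -
    have "- 2 - 2 * int x \<noteq> - 3 - 2 * int q" for q by presburger
    then show ?thesis using assms(2) unfolding preserves_def by blast
  qed
  ultimately show ?thesis using assms(1) unfolding represents_def by auto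
qed

lemma preserves_trans:
  assumes "preserves r s s'" "preserves q s' s''" "p \<le> r" "p \<le> q"
  shows "preserves p s s''"
  using assms unfolding preserves_def by (metis order_trans)

lemma preserves_upd: "p \<le> r \<Longrightarrow> preserves p s (s(- 3 - 2 * int r := v))"
  unfolding preserves_def by auto

lemma preserves_tmp: "preserves r s s' \<Longrightarrow> q < r \<Longrightarrow> s' (- 3 - 2 * int q) = s (- 3 - 2 * int q)"
  unfolding preserves_def by auto

lemma compiles_Lit: "\<exists>T. poly_bdd T \<and> compiles (Lit z) r T"
proof (intro exI conjI)
  show "poly_bdd (\<lambda>N. 2 * int_size (- 3 - 2 * int r) + 2 * int_size z)" by (intro poly_bdd_intros)
  show "compiles (Lit z) r (\<lambda>N. 2 * int_size (- 3 - 2 * int r) + 2 * int_size z)"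
    unfolding compiles_def
  proof (intro allI impI, goal_cases)
    case (1 N inp K env s)
    have "runs (compile (Lit z) r) s (2 * int_size (- 3 - 2 * int r) + 2 * int_size z)
        (s(- 3 - 2 * int r := z))"
      using runs_Store[of "reg_tmp r" s "Const z"] by (simp add: reg_tmp_def)
    then show ?case by (auto intro!: preserves_upd exI)
  qed
qed

lemma compiles_Var: "\<exists>T. poly_bdd T \<and> compiles (Var x) r T"
proof (intro exI conjI)
  let ?T = "\<lambda>N. 2 * int_size (- 3 - 2 * int r) + 2 * int_size (- 2 - 2 * int x) + 2 * N"
  show "poly_bdd ?T" by (intro poly_bdd_intros)
  show "compiles (Var x) r ?T"
    unfolding compiles_def
  proof (intro allI impI, goal_cases)
    case (1 N inp K env s)
    have e: "s (- 2 - 2 * int x) = env x" using 1 by (simp add: represents_def)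
    moreover have "int_size (env x) \<le> N" using 1 by (simp add: small_def)
    ultimately have "runs (compile (Var x) r) s (?T N) (s(- 3 - 2 * int r := env x))"
      using runs_Store[of "reg_tmp r" s "Load (reg_var x)" "?T N"]
      by (simp add: reg_tmp_def reg_var_def)
    then show ?case by (auto intro!: preserves_upd exI)
  qed
qed

lemma compiles_Bound: "\<exists>T. poly_bdd T \<and> compiles Bound r T"
proof (intro exI conjI)
  let ?T = "\<lambda>N. 2 * int_size (- 3 - 2 * int r) + 2 * int_size (- 1) + 2 * (Suc N)"
  show "poly_bdd ?T" by (intro poly_bdd_intros)
  show "compiles Bound r ?T"
    unfolding compiles_def
  proof (intro allI impI, goal_cases)
    case (1 N inp K env s)
    have e: "s (- 1) = int K" using 1 by (simp add: represents_def)
    moreover have "int_size (int K) \<le> Suc N"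
      using 1 int_size_int_le[of K] by (simp add: small_def)
    ultimately have "runs (compile Bound r) s (?T N) (s(- 3 - 2 * int r := int K))"
      using runs_Store[of "reg_tmp r" s "Load reg_bound" "?T N"]
      by (simp add: reg_tmp_def reg_bound_def)
    then show ?case by (auto intro!: preserves_upd exI)
  qed
qed

lemma small_tval: "small N inp K env \<Longrightarrow> int_size (tval inp K t env) \<le> tm_size t N"
  unfolding small_def by (intro int_size_tval) auto

lemma compiles_Input:
  assumes "poly_bdd T" "compiles t r T"
  shows "\<exists>T. poly_bdd T \<and> compiles (Input t) r T"
proof (intro exI conjI)
  let ?A = "int_size (- 3 - 2 * int r)"
  let ?S = "\<lambda>N. 4 * ?A + 4 * tm_size t N + 4 * N + 20"
  let ?T = "\<lambda>N. T N + (?S N + ?S N)"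
  show "poly_bdd ?T" by (intro poly_bdd_intros assms)
  show "compiles (Input t) r ?T"
    unfolding compiles_def
  proof (intro allI impI, goal_cases)
    case (1 N inp K env s)
    let ?v = "tval inp K t env"
    obtain s1 where s1: "runs (compile t r) s (T N) s1" "preserves r s s1"
      "s1 (- 3 - 2 * int r) = ?v"
      using assms(2) 1 unfolding compiles_def by blast
    have rep: "represents inp K env s1" using preserves_represents 1 s1 by blast
    have v: "int_size ?v \<le> tm_size t N" by (rule small_tval) fact
    have "int_size (binop_val Add ?v 1) \<le> int_size ?v + int_size 1" by (rule int_size_binop)
    moreover have one: "int_size 1 \<le> 2" "int_size 0 \<le> 2"
      using int_size_int_le[of 1] int_size_int_le[of 0] by auto
    ultimately have v1: "int_size (?v + 1) \<le> tm_size t N + 2" using v by simp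
    have "runs (IfPos (Op Add (Load (reg_tmp r)) (Const 1))
       (Store (reg_tmp r) (Load (Load (reg_tmp r)))) (Store (reg_tmp r) (Const 0))) s1 (?S N + ?S N)
       (s1(- 3 - 2 * int r := tval inp K (Input t) env))"
    proof (rule runs_IfPos[where T' = "?S N"])
      assume "0 < exp_val (Op Add (Load (reg_tmp r)) (Const 1)) s1"
      then have "0 \<le> ?v" using s1 by (simp add: reg_tmp_def)
      then have "s1 ?v = inp ?v" "int_size (inp ?v) \<le> N" 
        using rep 1 by (auto simp: represents_def small_def)
      then show "runs (Store (reg_tmp r) (Load (Load (reg_tmp r)))) s1 (?S N)
          (s1(- 3 - 2 * int r := tval inp K (Input t) env))"
        using runs_Store[of "reg_tmp r" s1 "Load (Load (reg_tmp r))" "?S N"] s1 v \<open>0 \<le> ?v\<close>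
        by (simp add: reg_tmp_def)
    next
      assume "exp_val (Op Add (Load (reg_tmp r)) (Const 1)) s1 \<le> 0"
      then have "?v < 0" using s1 by (simp add: reg_tmp_def)
      then show "runs (Store (reg_tmp r) (Const 0)) s1 (?S N)
          (s1(- 3 - 2 * int r := tval inp K (Input t) env))"
        using runs_Store[of "reg_tmp r" s1 "Const 0" "?S N"] one
        by (simp add: reg_tmp_def)
    next
      show "exp_cost (Op Add (Load (reg_tmp r)) (Const 1)) s1
          + int_size (exp_val (Op Add (Load (reg_tmp r)) (Const 1)) s1) + ?S N \<le> ?S N + ?S N"
        using s1 v v1 one by (simp add: reg_tmp_def)
    qed
    then have "runs (compile (Input t) r) s (?T N) (s1(- 3 - 2 * int r := tval inp K (Input t) env))"
      using runs_Seq[OF s1(1)] by simp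
    moreover have "preserves r s (s1(- 3 - 2 * int r := tval inp K (Input t) env))"
      using preserves_trans[OF s1(2) preserves_upd] by blast
    ultimately show ?case by (metis fun_upd_same)
  qed
qed

lemma compiles_Bin:
  assumes "poly_bdd T1" "compiles t r T1" "poly_bdd T2" "compiles u (Suc r) T2"
  shows "\<exists>T. poly_bdd T \<and> compiles (Bin f t u) r T"
proof (intro exI conjI)
  let ?A = "int_size (- 3 - 2 * int r)" and ?B = "int_size (- 3 - 2 * int (Suc r))"
  let ?S = "\<lambda>N. 4 * ?A + 4 * ?B + 4 * tm_size t N + 4 * tm_size u N"
  let ?T = "\<lambda>N. T1 N + (T2 N + ?S N)"
  show "poly_bdd ?T" by (intro poly_bdd_intros assms)
  show "compiles (Bin f t u) r ?T"
    unfolding compiles_def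
  proof (intro allI impI, goal_cases)
    case (1 N inp K env s)
    let ?v = "tval inp K t env" and ?w = "tval inp K u env"
    obtain s1 where s1: "runs (compile t r) s (T1 N) s1" "preserves r s s1"
      "s1 (- 3 - 2 * int r) = ?v"
      using assms(2) 1 unfolding compiles_def by blast
    have rep: "represents inp K env s1" using preserves_represents 1 s1 by blast
    obtain s2 where s2: "runs (compile u (Suc r)) s1 (T2 N) s2" "preserves (Suc r) s1 s2"
      "s2 (- 3 - 2 * int (Suc r)) = ?w"
      using assms(4) 1 rep unfolding compiles_def by blast
    have s2v: "s2 (- 3 - 2 * int r) = ?v" using preserves_tmp[OF s2(2)] s1(3) by simp
    have v: "int_size ?v \<le> tm_size t N" "int_size ?w \<le> tm_size u N" 
      using 1 by (auto intro: small_tval)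
    have vw: "int_size (binop_val f ?v ?w) \<le> tm_size t N + tm_size u N" 
      using int_size_binop[of f ?v ?w] v by linarith
    have "runs (Store (reg_tmp r) (Op f (Load (reg_tmp r)) (Load (reg_tmp (Suc r))))) s2 (?S N)
       (s2(- 3 - 2 * int r := tval inp K (Bin f t u) env))"
      using runs_Store[of "reg_tmp r" s2 "Op f (Load (reg_tmp r)) (Load (reg_tmp (Suc r)))" "?S N"]
        s2(3) s2v v vw by (simp add: reg_tmp_def)
    then have "runs (compile (Bin f t u) r) s (?T N) (s2(- 3 - 2 * int r := tval inp K (Bin f t u) env))"
      by (auto intro!: runs_Seq[OF s1(1)] runs_Seq[OF s2(1)])
    moreover have "preserves r s (s2(- 3 - 2 * int r := tval inp K (Bin f t u) env))"
      by (meson preserves_trans[OF s1(2)] preserves_trans[OF s2(2)] preserves_upd order_refl le_SucI)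
    ultimately show ?case by (metis fun_upd_same)
  qed
qed

lemma compiles_Cond:
  assumes "poly_bdd T1" "compiles c r T1" "poly_bdd T2" "compiles t r T2" "poly_bdd T3" "compiles u r T3"
  shows "\<exists>T. poly_bdd T \<and> compiles (Cond c t u) r T"
proof (intro exI conjI)
  let ?A = "int_size (- 3 - 2 * int r)"
  let ?S = "\<lambda>N. 4 * ?A + 4 * tm_size c N"
  let ?T = "\<lambda>N. T1 N + (?S N + (T2 N + T3 N))"
  show "poly_bdd ?T" by (intro poly_bdd_intros assms)
  show "compiles (Cond c t u) r ?T"
    unfolding compiles_def
  proof (intro allI impI, goal_cases)
    case (1 N inp K env s)
    obtain s1 where s1: "runs (compile c r) s (T1 N) s1" "preserves r s s1"
      "s1 (- 3 - 2 * int r) = tval inp K c env"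
      using assms(2) 1 unfolding compiles_def by blast
    have rep: "represents inp K env s1" using preserves_represents 1 s1 by blast
    have v: "int_size (tval inp K c env) \<le> tm_size c N"
      using 1 by (auto intro: small_tval)
    obtain s2 where s2: "runs (compile t r) s1 (T2 N) s2" "preserves r s1 s2"
      "s2 (- 3 - 2 * int r) = tval inp K t env"
      using assms(4) 1 rep unfolding compiles_def by blast
    obtain s3 where s3: "runs (compile u r) s1 (T3 N) s3" "preserves r s1 s3"
      "s3 (- 3 - 2 * int r) = tval inp K u env"
      using assms(6) 1 rep unfolding compiles_def by blast
    let ?s = "if tval inp K c env > 0 then s2 else s3"
    have "runs (IfPos (Load (reg_tmp r)) (compile t r) (compile u r)) s1 (?S N + (T2 N + T3 N)) ?s"
    proof (rule runs_IfPos[where T' = "T2 N + T3 N"])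
      show "exp_cost (Load (reg_tmp r)) s1 + int_size (exp_val (Load (reg_tmp r)) s1) + (T2 N + T3 N)
          \<le> ?S N + (T2 N + T3 N)" using v s1(3) by (simp add: reg_tmp_def)
    qed (use s1(3) s2(1) s3(1) in \<open>auto simp: reg_tmp_def runs_def intro: trans_le_add1 trans_le_add2\<close>)
    then have "runs (compile (Cond c t u) r) s (?T N) ?s"
      by (auto intro!: runs_Seq[OF s1(1)])
    moreover have "preserves r s ?s"
      using preserves_trans[OF s1(2) s2(2)] preserves_trans[OF s1(2) s3(2)] by auto
    moreover have "?s (- 3 - 2 * int r) = tval inp K (Cond c t u) env" using s2 s3 by auto
    ultimately show ?case by blast
  qed
qed


lemma compiles_Loop:
  assumes "poly_bdd T1" "compiles t (Suc (Suc r)) T1"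
  shows "\<exists>T. poly_bdd T \<and> compiles (Loop f z x t) r T"
proof (intro exI conjI)
  let ?A = "int_size (- 3 - 2 * int r)" and ?B = "int_size (- 3 - 2 * int (Suc r))"
  let ?D = "int_size (- 3 - 2 * int (Suc (Suc r)))" and ?E = "int_size (- 2 - 2 * int x)"
  let ?Z = "\<lambda>N. int_size z + N * tm_size t N"
  let ?S = "\<lambda>N. 10 * (?A + ?B + ?D + ?E + int_size (-1) + int_size 0 + int_size 1 + ?Z N + tm_size t N + N + 3)"
  let ?C = "\<lambda>N. ?S N + (T1 N + (?S N + ?S N))"
  let ?T = "\<lambda>N. ?S N + (?S N + (?S N + ((N * ?C N + ?S N) + (?S N + ?S N))))"
  show "poly_bdd ?T" by (intro poly_bdd_intros assms)
  show "compiles (Loop f z x t) r ?T"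
    unfolding compiles_def
  proof (intro allI impI, goal_cases)
    case (1 N inp K env s)
    have KN: "K \<le> N" and sm: "small N inp K env" and rp: "represents inp K env s"
      using 1 by (auto simp: small_def)
    define g where "g i = tval inp K t (env(x := int i))" for i
    let ?w = "WhilePos (Op Sub (Load reg_bound) (Load (reg_var x)))
       (Seq (compile t (Suc (Suc r)))
       (Seq (Store (reg_tmp (Suc r)) (Op f (Load (reg_tmp (Suc r))) (Load (reg_tmp (Suc (Suc r))))))
            (Store (reg_var x) (Op Add (Load (reg_var x)) (Const 1)))))"
    have sml: "small N inp K (env(x := int i))" if "i < K" for i
      using sm that int_size_int_le[of i] unfolding small_def by auto
    have gsz: "int_size (g i) \<le> tm_size t N" if "i < K" for i
      unfolding g_def using sml[OF that] by (rule small_tval)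
    have isz: "int_size (iter_val f z g i) \<le> ?Z N" if "i \<le> K" for i
    proof -
      have "int_size (iter_val f z g i) \<le> int_size z + i * tm_size t N"
        by (rule int_size_iter_val) (use gsz that in auto)
      also have "\<dots> \<le> ?Z N" using that KN by simp
      finally show ?thesis .
    qed
    have nsz: "int_size (int i) \<le> Suc N" if "i \<le> K" for i
      using int_size_int_le[of i] that KN by linarith
    have ne1: "- 2 - 2 * int x \<noteq> - 3 - 2 * int q" "- 3 - 2 * int q \<noteq> - 2 - 2 * int x" for x q
      by presburger+
    have ne2: "- 2 - 2 * int x \<noteq> -1" "- 3 - 2 * int x \<noteq> -1" "\<not> 0 \<le> - 2 - 2 * int x"
      "\<not> 0 \<le> - 3 - 2 * int x" for x
      by presburger+
    \<comment> \<open>Invariant before round \<open>i\<close>: the variable \<open>x\<close> holds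
      \<open>i\<close>, the accumulator holds the partial iteration, and temporary \<open>r\<close>
      the saved value of \<open>x\<close>. Each remaining round is charged \<open>?C N\<close> and
      the final failing test \<open>?S N\<close>. The cell of \<open>x\<close> is exempt from the
      frame condition because it is restored only after the loop.\<close>
    have loop: "\<exists>s'. runs ?w si ((K - i) * ?C N + ?S N) s' \<and>
        s' (- 3 - 2 * int (Suc r)) = iter_val f z g K \<and> s' (- 3 - 2 * int r) = env x \<and>
        (\<forall>a. a \<noteq> - 2 - 2 * int x \<longrightarrow> (\<forall>q\<ge>r. a \<noteq> - 3 - 2 * int q) \<longrightarrow> s' a = si a)"
      if "i \<le> K" "represents inp K (env(x := int i)) si"
        "si (- 3 - 2 * int (Suc r)) = iter_val f z g i" "si (- 3 - 2 * int r) = env x" for i si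
      using that
    proof (induction "K - i" arbitrary: i si)
      case 0
      then have i: "i = K" by simp
      have v: "si (-1) = int K" "si (- 2 - 2 * int x) = int K"
        using 0(3) i by (auto simp: represents_def)
      have "exp_cost (Op Sub (Load reg_bound) (Load (reg_var x))) si
         + int_size (exp_val (Op Sub (Load reg_bound) (Load (reg_var x))) si) \<le> ?S N"
        using v nsz[of K] by (simp add: reg_bound_def reg_var_def)
      moreover have "exp_val (Op Sub (Load reg_bound) (Load (reg_var x))) si \<le> 0"
        using v by (simp add: reg_bound_def reg_var_def)
      ultimately have "runs ?w si ((K - i) * ?C N + ?S N) si"
        unfolding runs_def using exec.WhileFalse by (meson trans_le_add2)
      then show ?case using 0 i by blast
    next
      case (Suc n)
      then have iK: "i < K" by simp
      have v: "si (-1) = int K" "si (- 2 - 2 * int x) = int i"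
        using Suc.prems by (auto simp: represents_def)
      have guard: "exp_cost (Op Sub (Load reg_bound) (Load (reg_var x))) si
         + int_size (exp_val (Op Sub (Load reg_bound) (Load (reg_var x))) si) \<le> ?S N"
        using v nsz[of K] nsz[of i] nsz[of "K - i"] iK
        by (simp add: reg_bound_def reg_var_def of_nat_diff)
      obtain s1 where s1: "runs (compile t (Suc (Suc r))) si (T1 N) s1" "preserves (Suc (Suc r)) si s1"
        "s1 (- 3 - 2 * int (Suc (Suc r))) = g i"
        using assms(2) sml[OF iK] Suc.prems(2) unfolding compiles_def g_def by blast
      have rp1: "represents inp K (env(x := int i)) s1"
        using preserves_represents Suc.prems(2) s1(2) by blast
      have a1: "s1 (- 3 - 2 * int (Suc r)) = iter_val f z g i" "s1 (- 3 - 2 * int r) = env x"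
        using preserves_tmp[OF s1(2), of "Suc r"] preserves_tmp[OF s1(2), of r] Suc.prems(3,4)
        by auto
      let ?s2 = "s1(- 3 - 2 * int (Suc r) := iter_val f z g (Suc i))"
      have "runs (Store (reg_tmp (Suc r)) (Op f (Load (reg_tmp (Suc r))) (Load (reg_tmp (Suc (Suc r))))))
          s1 (?S N) ?s2"
        using runs_Store[of "reg_tmp (Suc r)" s1
            "Op f (Load (reg_tmp (Suc r))) (Load (reg_tmp (Suc (Suc r))))" "?S N"]
          a1(1) s1(3) isz[of i] isz[of "Suc i"] gsz[OF iK] iK
        by (simp add: reg_tmp_def)
      moreover
      let ?s3 = "?s2(- 2 - 2 * int x := int (Suc i))"
      have "?s2 (- 2 - 2 * int x) = s1 (- 2 - 2 * int x)"
        by (rule fun_upd_other) (rule ne1)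
      then have x2: "?s2 (- 2 - 2 * int x) = int i"
        using rp1 unfolding represents_def by (metis fun_upd_same)
      have "runs (Store (reg_var x) (Op Add (Load (reg_var x)) (Const 1))) ?s2 (?S N) ?s3"
        using runs_Store[of "reg_var x" ?s2 "Op Add (Load (reg_var x)) (Const 1)" "?S N"]
          x2 nsz[of i] nsz[of "Suc i"] iK
        by (simp add: reg_var_def add.commute)
      ultimately have body: "runs (Seq (compile t (Suc (Suc r)))
       (Seq (Store (reg_tmp (Suc r)) (Op f (Load (reg_tmp (Suc r))) (Load (reg_tmp (Suc (Suc r))))))
            (Store (reg_var x) (Op Add (Load (reg_var x)) (Const 1))))) si (T1 N + (?S N + ?S N)) ?s3"
        by (meson order_refl runs_Seq s1(1))
      have rp3: "represents inp K (env(x := int (Suc i))) ?s3"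
        using rp1 ne1(1)[where q = "Suc r"] ne2 unfolding represents_def by simp
      have c1: "n = K - Suc i" "Suc i \<le> K" using Suc.hyps(2) iK by auto
      have c3: "?s3 (- 3 - 2 * int (Suc r)) = iter_val f z g (Suc i)" "?s3 (- 3 - 2 * int r) = env x"
        using a1(2) ne1 ne1(2)[where q = "Suc r"] by auto
      obtain s' where s': "runs ?w ?s3 ((K - Suc i) * ?C N + ?S N) s'"
        "s' (- 3 - 2 * int (Suc r)) = iter_val f z g K" "s' (- 3 - 2 * int r) = env x"
        "\<forall>a. a \<noteq> - 2 - 2 * int x \<longrightarrow> (\<forall>q\<ge>r. a \<noteq> - 3 - 2 * int q) \<longrightarrow> s' a = ?s3 a"
        using Suc.hyps(1)[OF c1 rp3 c3] by blast
      have "exp_val (Op Sub (Load reg_bound) (Load (reg_var x))) si > 0"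
        using v iK by (simp add: reg_bound_def reg_var_def)
      moreover have "(K - i) * ?C N = ?C N + (K - Suc i) * ?C N"
        using c1 Suc.hyps(2) by (metis mult_Suc)
      ultimately have "runs ?w si ((K - i) * ?C N + ?S N) s'"
        using guard by (intro runs_WhilePos[OF _ body s'(1)]) linarith+
      moreover have "s' a = si a" if "a \<noteq> - 2 - 2 * int x" "\<forall>q\<ge>r. a \<noteq> - 3 - 2 * int q" for a
      proof -
        have "?s3 a = s1 a" using that(1) spec[OF that(2), of "Suc r"] by auto
        moreover have "s1 a = si a" using s1(2) that unfolding preserves_def by auto
        ultimately show ?thesis using s'(4) that by metis
      qed
      ultimately show ?case using s' by blast
    qed
    let ?s1 = "s(- 3 - 2 * int r := env x)"
    let ?s2 = "?s1(- 3 - 2 * int (Suc r) := z)"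
    let ?s3 = "?s2(- 2 - 2 * int x := 0)"
    have ex: "s (- 2 - 2 * int x) = env x" "int_size (env x) \<le> N"
      using rp sm by (auto simp: represents_def small_def)
    have r1: "runs (Store (reg_tmp r) (Load (reg_var x))) s (?S N) ?s1"
      using runs_Store[of "reg_tmp r" s "Load (reg_var x)" "?S N"] ex
      by (simp add: reg_tmp_def reg_var_def)
    have r2: "runs (Store (reg_tmp (Suc r)) (Const z)) ?s1 (?S N) ?s2"
      using runs_Store[of "reg_tmp (Suc r)" ?s1 "Const z" "?S N"]
      by (simp add: reg_tmp_def)
    have r3: "runs (Store (reg_var x) (Const 0)) ?s2 (?S N) ?s3"
      using runs_Store[of "reg_var x" ?s2 "Const 0" "?S N"]
      by (simp add: reg_var_def)
    have "represents inp K (env(x := int 0)) ?s3"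
      using rp ne1 ne1(1)[where q = "Suc r"] ne2 unfolding represents_def by simp
    moreover have "?s3 (- 3 - 2 * int (Suc r)) = iter_val f z g 0" "?s3 (- 3 - 2 * int r) = env x"
      using ne1 ne1(2)[where q = "Suc r"] by auto
    ultimately obtain s4 where s4: "runs ?w ?s3 (K * ?C N + ?S N) s4"
        "s4 (- 3 - 2 * int (Suc r)) = iter_val f z g K" "s4 (- 3 - 2 * int r) = env x"
        "\<forall>a. a \<noteq> - 2 - 2 * int x \<longrightarrow> (\<forall>q\<ge>r. a \<noteq> - 3 - 2 * int q) \<longrightarrow> s4 a = ?s3 a"
      using loop[of 0 ?s3] by auto
    \<comment> \<open>The time bound may depend on \<open>N\<close> only, so the \<open>K\<close>
      rounds are charged as \<open>N\<close> rounds.\<close>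
    have r4: "runs ?w ?s3 (N * ?C N + ?S N) s4"
      using s4(1) KN unfolding runs_def by (meson add_le_mono1 mult_le_mono1 order_trans)
    let ?s5 = "s4(- 2 - 2 * int x := env x)"
    let ?s6 = "?s5(- 3 - 2 * int r := iter_val f z g K)"
    have r5: "runs (Store (reg_var x) (Load (reg_tmp r))) s4 (?S N) ?s5"
      using runs_Store[of "reg_var x" s4 "Load (reg_tmp r)" "?S N"] ex s4(3)
      by (simp add: reg_tmp_def reg_var_def)
    have "?s5 (- 3 - 2 * int (Suc r)) = iter_val f z g K" using s4(2) ne1 ne1(2)[where q = "Suc r"] by auto
    then have r6: "runs (Store (reg_tmp r) (Load (reg_tmp (Suc r)))) ?s5 (?S N) ?s6"
      using runs_Store[of "reg_tmp r" ?s5 "Load (reg_tmp (Suc r))" "?S N"] isz[of K]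
      by (simp add: reg_tmp_def)
    have "runs (compile (Loop f z x t) r) s (?T N) ?s6"
      unfolding compile.simps
      by (rule runs_Seq[OF r1 _ order_refl], rule runs_Seq[OF r2 _ order_refl],
          rule runs_Seq[OF r3 _ order_refl], rule runs_Seq[OF r4 _ order_refl],
          rule runs_Seq[OF r5 r6 order_refl])
    moreover have "preserves r s ?s6"
      unfolding preserves_def
    proof (intro allI impI)
      fix a assume a: "\<forall>q\<ge>r. a \<noteq> - 3 - 2 * int q"
      show "?s6 a = s a"
      proof (cases "a = - 2 - 2 * int x")
        case True
        then show ?thesis using ex(1) ne1 by simp
      next
        case False
        then have "?s6 a = s4 a" using a by auto
        also have "\<dots> = ?s3 a" using s4(4) False a by blast
        also have "\<dots> = s a" using False a spec[OF a, of "Suc r"] by auto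
        finally show ?thesis .
      qed
    qed
    moreover have "?s6 (- 3 - 2 * int r) = tval inp K (Loop f z x t) env"
      by (simp add: g_def[abs_def])
    ultimately show ?case by blast
  qed
qed

theorem compile_poly_time: "\<exists>T. poly_bdd T \<and> compiles t r T"
proof (induction t arbitrary: r)
  case (Lit z)
  show ?case by (rule compiles_Lit)
next
  case (Var x)
  show ?case by (rule compiles_Var)
next
  case Bound
  show ?case by (rule compiles_Bound)
next
  case (Input t)
  then show ?case using compiles_Input by blast
next
  case (Bin f t u)
  then show ?case using compiles_Bin by metis
next
  case (Cond c t u)
  obtain T1 where "poly_bdd T1 \<and> compiles c r T1" using Cond(1) by blast
  moreover obtain T2 where "poly_bdd T2 \<and> compiles t r T2" using Cond(2) by blast
  moreover obtain T3 where "poly_bdd T3 \<and> compiles u r T3" using Cond(3) by blast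
  ultimately show ?case using compiles_Cond by blast
next
  case (Loop f z x t)
  then show ?case using compiles_Loop by blast
qed


section \<open>Fractions in lowest terms\<close>

definition gcd_loop :: com where
  "gcd_loop = WhilePos (Load (reg_tmp 3))
     (Seq (Store (reg_tmp 4) (Op Sub (Load (reg_tmp 2))
        (Op Mul (Op Div (Load (reg_tmp 2)) (Load (reg_tmp 3))) (Load (reg_tmp 3)))))
     (Seq (Store (reg_tmp 2) (Load (reg_tmp 3)))
          (Store (reg_tmp 3) (Load (reg_tmp 4)))))"

text \<open>Since \<open>a mod b \<le> a / 2\<close> whenever \<open>b \<le> a\<close>, the product of the two numbers is at least halved
  in every round of Euclid's algorithm.\<close>

lemma runs_gcd_loop:
  assumes "s (-7) = a" "s (-9) = b" "0 < a" "0 \<le> b" "b \<le> a" "a * b < 2 ^ L" "int_size a \<le> Y"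
  shows "\<exists>s'. runs gcd_loop s (L * (100 * (Y + 10)) + 100 * (Y + 10)) s' \<and> s' (-7) = gcd a b \<and>
      s' (-3) = s (-3) \<and> s' (-5) = s (-5)"
  using assms
proof (induction L arbitrary: s a b)
  have adr: "int_size (-3) \<le> 5" "int_size (-5) \<le> 5" "int_size (-7) \<le> 5" "int_size (-9) \<le> 5" 
    "int_size (-11) \<le> 5"
    using int_size_le_iff[of _ 4] by (auto simp del: One_nat_def)
  {
    fix s :: mem and a b :: int and L
    assume *: "s (-7) = a" "s (-9) = b" "b = 0" "0 < a" "int_size a \<le> Y"
    have "int_size 0 \<le> Suc 0" by (simp add: int_size_def floorlog_def)
    then have "exp_cost (Load (reg_tmp 3)) s + int_size (exp_val (Load (reg_tmp 3)) s)
        \<le> L * (100 * (Y + 10)) + 100 * (Y + 10)"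
      using * adr by (simp add: reg_tmp_def)
    moreover have "exp_val (Load (reg_tmp 3)) s \<le> 0" using * by (simp add: reg_tmp_def)
    ultimately have "runs gcd_loop s (L * (100 * (Y + 10)) + 100 * (Y + 10)) s"
      unfolding gcd_loop_def runs_def using exec.WhileFalse by blast
    then have "\<exists>s'. runs gcd_loop s (L * (100 * (Y + 10)) + 100 * (Y + 10)) s' \<and> s' (-7) = gcd a b \<and>
      s' (-3) = s (-3) \<and> s' (-5) = s (-5)"
      using * by (intro exI[of _ s]) simp
  } note base = this
  {
    case 0
    have "b = 0"
    proof (rule ccontr)
      assume "b \<noteq> 0"
      then have "1 * 1 \<le> a * b" using 0 by (intro mult_mono) auto
      then show False using 0 by simp
    qed
    then show ?case using base 0 by blast
  next
    case (Suc L)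
    show ?case
    proof (cases "b = 0")
      case True
      then show ?thesis using base Suc.prems by blast
    next
      case False
      then have b: "0 < b" using Suc.prems by simp
      let ?r = "a mod b"
      have r: "0 \<le> ?r" "?r < b" using b by auto
      have "a = a div b * b + ?r" by simp
      moreover have "1 * b \<le> a div b * b"
        using b Suc.prems(5) by (intro mult_right_mono) (auto simp: pos_imp_zdiv_pos_iff int_one_le_iff_zero_less)
      ultimately have "b + ?r \<le> a" by linarith
      then have "2 * ?r \<le> a" using r by linarith
      then have "b * (2 * ?r) \<le> b * a" using b by (intro mult_left_mono) auto
      then have half: "b * ?r < 2 ^ L" using Suc.prems(6) by (simp add: mult.commute)
      have mr: "a - a div b * b = ?r" by (simp add: minus_div_mult_eq_mod)
      have sz: "int_size a \<le> Y" "int_size b \<le> Y" "int_size ?r \<le> Y"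
        using Suc.prems int_size_mono[of b a] int_size_mono[of ?r a] r b by auto
      have sq: "int_size (a div b) \<le> 2 * Y" using int_size_binop[of Div a b] sz by simp
      have sm: "int_size (a div b * b) \<le> 3 * Y" using int_size_binop[of Mul "a div b" b] sz sq by simp
      let ?s1 = "s(-11 := ?r)"
      have r1: "runs (Store (reg_tmp 4) (Op Sub (Load (reg_tmp 2))
        (Op Mul (Op Div (Load (reg_tmp 2)) (Load (reg_tmp 3))) (Load (reg_tmp 3))))) s (30 * (Y + 10)) ?s1"
        using runs_Store[of "reg_tmp 4" s "Op Sub (Load (reg_tmp 2))
        (Op Mul (Op Div (Load (reg_tmp 2)) (Load (reg_tmp 3))) (Load (reg_tmp 3)))" "30 * (Y + 10)"]
        Suc.prems(1,2) sz sq sm adr mr by (simp add: reg_tmp_def)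
      let ?s2 = "?s1(-7 := b)"
      have r2: "runs (Store (reg_tmp 2) (Load (reg_tmp 3))) ?s1 (30 * (Y + 10)) ?s2"
        using runs_Store[of "reg_tmp 2" ?s1 "Load (reg_tmp 3)" "30 * (Y + 10)"]
        Suc.prems(1,2) sz adr by (simp add: reg_tmp_def)
      let ?s3 = "?s2(-9 := ?r)"
      have r3: "runs (Store (reg_tmp 3) (Load (reg_tmp 4))) ?s2 (30 * (Y + 10)) ?s3"
        using runs_Store[of "reg_tmp 3" ?s2 "Load (reg_tmp 4)" "30 * (Y + 10)"]
        Suc.prems(1,2) sz adr by (simp add: reg_tmp_def)
      have body: "runs (Seq (Store (reg_tmp 4) (Op Sub (Load (reg_tmp 2))
          (Op Mul (Op Div (Load (reg_tmp 2)) (Load (reg_tmp 3))) (Load (reg_tmp 3)))))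
       (Seq (Store (reg_tmp 2) (Load (reg_tmp 3)))
          (Store (reg_tmp 3) (Load (reg_tmp 4))))) s (90 * (Y + 10)) ?s3"
        by (rule runs_Seq[OF r1 runs_Seq[OF r2 r3 order_refl]]) simp
      have "\<exists>s'. runs gcd_loop ?s3 (L * (100 * (Y + 10)) + 100 * (Y + 10)) s' \<and>
         s' (-7) = gcd b ?r \<and> s' (-3) = ?s3 (-3) \<and> s' (-5) = ?s3 (-5)"
        by (rule Suc.IH) (use half r(1) less_imp_le[OF r(2)] b sz in auto)
      then obtain s' where s': "runs gcd_loop ?s3 (L * (100 * (Y + 10)) + 100 * (Y + 10)) s'"
         "s' (-7) = gcd b ?r" "s' (-3) = ?s3 (-3)" "s' (-5) = ?s3 (-5)"
        by blast
      have "exp_val (Load (reg_tmp 3)) s > 0" using Suc.prems b by (simp add: reg_tmp_def)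
      moreover have "exp_cost (Load (reg_tmp 3)) s + int_size (exp_val (Load (reg_tmp 3)) s)
          \<le> 10 * (Y + 10)"
        using Suc.prems(2) sz adr by (simp add: reg_tmp_def)
      then have "exp_cost (Load (reg_tmp 3)) s + int_size (exp_val (Load (reg_tmp 3)) s)
          + 90 * (Y + 10) + (L * (100 * (Y + 10)) + 100 * (Y + 10))
          \<le> Suc L * (100 * (Y + 10)) + 100 * (Y + 10)"
        unfolding mult_Suc by simp
      ultimately have "runs gcd_loop s (Suc L * (100 * (Y + 10)) + 100 * (Y + 10)) s'"
        using s'(1) body unfolding gcd_loop_def by (intro runs_WhilePos[OF _ body])
      moreover have "gcd b ?r = gcd a b" by (metis gcd.commute gcd_red_int)
      ultimately show ?thesis using s' by auto
    qed
  }
qed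

definition fraction_program :: "tm \<Rightarrow> tm \<Rightarrow> tm \<Rightarrow> com" where
  "fraction_program tK tN tD =
     Seq (compile tK 0) (Seq (Store reg_bound (Load (reg_tmp 0)))
    (Seq (compile tN 0) (Seq (compile tD 1)
    (Seq (Store (reg_tmp 2) (Load (reg_tmp 1)))
    (Seq (Store (reg_tmp 3) (Op Sub (Load (reg_tmp 0))
       (Op Mul (Op Div (Load (reg_tmp 0)) (Load (reg_tmp 1))) (Load (reg_tmp 1)))))
    (Seq gcd_loop
    (Seq (Store (Const 0) (Op Div (Load (reg_tmp 0)) (Load (reg_tmp 2))))
         (Store (Const 1) (Op Div (Load (reg_tmp 1)) (Load (reg_tmp 2)))))))))))"

theorem fraction_program_poly_time:
  "\<exists>p :: nat poly. \<forall>xs N K num den.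
     (\<forall>a. int_size (initial_mem xs a) \<le> N) \<longrightarrow> K \<le> N \<longrightarrow>
     tval (initial_mem xs) 0 tK (\<lambda>_. 0) = int K \<longrightarrow>
     tval (initial_mem xs) K tN (\<lambda>_. 0) = num \<longrightarrow>
     tval (initial_mem xs) K tD (\<lambda>_. 0) = den \<longrightarrow> den > 0 \<longrightarrow>
     computes_within (fraction_program tK tN tD) xs [num div gcd num den, den div gcd num den] (poly p N)"
proof -
  obtain T1 where T1: "poly_bdd T1" "compiles tK 0 T1" using compile_poly_time by blast
  obtain T2 where T2: "poly_bdd T2" "compiles tN 0 T2" using compile_poly_time by blast
  obtain T3 where T3: "poly_bdd T3" "compiles tD 1 T3" using compile_poly_time by blast
  let ?Y = "\<lambda>N. tm_size tN N + tm_size tD N"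
  let ?S = "\<lambda>N. 30 * (N + ?Y N + 10)"
  let ?G = "\<lambda>N. (2 * ?Y N) * (100 * (?Y N + 10)) + 100 * (?Y N + 10)"
  let ?T = "\<lambda>N. T1 N + (?S N + (T2 N + (T3 N + (?S N + (?S N + (?G N + (?S N + ?S N)))))))"
  have "poly_bdd ?T" by (intro poly_bdd_intros T1(1) T2(1) T3(1))
  then obtain p where p: "\<And>N. ?T N \<le> poly p N" unfolding poly_bdd_def by blast
  have adr: "int_size (-3) \<le> 5" "int_size (-5) \<le> 5" "int_size (-7) \<le> 5" "int_size (-9) \<le> 5" 
    "int_size (-11) \<le> 5" "int_size (-1) \<le> 5" "int_size 0 \<le> 5" "int_size 1 \<le> 5"
    using int_size_le_iff[of _ 4] by (auto simp del: One_nat_def)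
  show ?thesis
  proof (intro exI[of _ p] allI impI)
    fix xs N K num den
    let ?inp = "initial_mem xs" and ?e = "\<lambda>_::nat. 0::int"
    assume xs: "\<forall>a. int_size (?inp a) \<le> N" and KN: "K \<le> N"
      and tK: "tval ?inp 0 tK ?e = int K" and tN: "tval ?inp K tN ?e = num"
      and tD: "tval ?inp K tD ?e = den" and den: "den > 0"
    have "int_size 0 \<le> N"
    proof -
      have "int_size 0 \<le> int_size (?inp 0)" by (rule int_size_mono) simp
      then show ?thesis using xs order_trans by blast
    qed
    then have sm0: "small N ?inp 0 ?e" and smK: "small N ?inp K ?e"
      using xs KN by (auto simp: small_def)
    have rep0: "represents ?inp 0 ?e ?inp" by (auto simp: represents_def initial_mem_def)
    obtain s1 where s1: "runs (compile tK 0) ?inp (T1 N) s1" "preserves 0 ?inp s1"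
        "s1 (-3) = int K"
      using T1(2)[unfolded compiles_def, rule_format, OF sm0 rep0] tK by auto
    have rep1: "represents ?inp 0 ?e s1" using preserves_represents[OF rep0 s1(2)] .
    let ?s2 = "s1(-1 := int K)"
    have r2: "runs (Store reg_bound (Load (reg_tmp 0))) s1 (?S N) ?s2"
      using runs_Store[of reg_bound s1 "Load (reg_tmp 0)" "?S N"] s1(3) adr int_size_int_le[of K] KN
      by (simp add: reg_tmp_def reg_bound_def)
    have rep2: "represents ?inp K ?e ?s2" 
    proof -
      have "- 2 - 2 * int x \<noteq> -1" for x by presburger
      then show ?thesis using rep1 by (simp add: represents_def)
    qed
    obtain s3 where s3: "runs (compile tN 0) ?s2 (T2 N) s3" "preserves 0 ?s2 s3"
        "s3 (-3) = num"
      using T2(2)[unfolded compiles_def, rule_format, OF smK rep2] tN by auto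
    have rep3: "represents ?inp K ?e s3" using preserves_represents[OF rep2 s3(2)] .
    obtain s4 where s4: "runs (compile tD 1) s3 (T3 N) s4" "preserves 1 s3 s4"
        "s4 (-5) = den"
      using T3(2)[unfolded compiles_def, rule_format, OF smK rep3] tD by auto
    have s4n: "s4 (-3) = num" using preserves_tmp[OF s4(2), of 0] s3(3) by simp
    have sn: "int_size num \<le> ?Y N" using small_tval[OF smK, of tN] tN by simp
    have sd: "int_size den \<le> ?Y N" using small_tval[OF smK, of tD] tD by simp
    let ?r = "num mod den"
    have r: "0 \<le> ?r" "?r < den" using den by auto
    have sr: "int_size ?r \<le> ?Y N" using int_size_mono[of ?r den] r sd by simp
    have mr: "num - num div den * den = ?r" by (simp add: minus_div_mult_eq_mod)
    have sq: "int_size (num div den) \<le> 2 * ?Y N" using int_size_binop[of Div num den] sn sd by simp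
    have sm: "int_size (num div den * den) \<le> 3 * ?Y N" 
      using int_size_binop[of Mul "num div den" den] sq sd by simp
    let ?s5 = "s4(-7 := den)"
    have r5: "runs (Store (reg_tmp 2) (Load (reg_tmp 1))) s4 (?S N) ?s5"
      using runs_Store[of "reg_tmp 2" s4 "Load (reg_tmp 1)" "?S N"] s4(3) adr sd
      by (simp add: reg_tmp_def)
    let ?s6 = "?s5(-9 := ?r)"
    have r6: "runs (Store (reg_tmp 3) (Op Sub (Load (reg_tmp 0))
       (Op Mul (Op Div (Load (reg_tmp 0)) (Load (reg_tmp 1))) (Load (reg_tmp 1))))) ?s5 (?S N) ?s6"
      using runs_Store[of "reg_tmp 3" ?s5 "Op Sub (Load (reg_tmp 0))
       (Op Mul (Op Div (Load (reg_tmp 0)) (Load (reg_tmp 1))) (Load (reg_tmp 1)))" "?S N"]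
        s4(3) s4n adr sd sn sr sq sm mr by (simp add: reg_tmp_def)
    \<comment> \<open>The number of rounds is bounded by the bit length of the product of the two
      arguments, hence linearly in their lengths.\<close>
    have "den * ?r < 2 ^ (2 * ?Y N)"
    proof -
      have "int_size den \<le> Suc (?Y N)" using sd by simp
      then have "den < 2 ^ ?Y N" using int_size_le_iff[of den "?Y N"] by linarith
      then have "den * ?r < 2 ^ ?Y N * 2 ^ ?Y N" using r by (intro mult_strict_mono) auto
      then show ?thesis by (metis mult_2 power_add)
    qed
    then obtain s7 where s7: "runs gcd_loop ?s6 (?G N) s7" "s7 (-7) = gcd den ?r"
       "s7 (-3) = num" "s7 (-5) = den"
      using runs_gcd_loop[of ?s6 den ?r "2 * ?Y N" "?Y N"] den r sd s4(3) s4n by auto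
    let ?g = "gcd num den"
    have g: "s7 (-7) = ?g" using s7(2) by (metis gcd.commute gcd_red_int)
    have "0 < ?g" using den by simp
    moreover have "?g \<le> den" using den by (intro zdvd_imp_le) auto
    ultimately have "\<bar>?g\<bar> \<le> \<bar>den\<bar>" by linarith
    then have sg: "int_size ?g \<le> ?Y N" using int_size_mono[of ?g den] sd by linarith
    have sng: "int_size (num div ?g) \<le> 2 * ?Y N" using int_size_binop[of Div num ?g] sn sg by simp
    have sdg: "int_size (den div ?g) \<le> 2 * ?Y N" using int_size_binop[of Div den ?g] sd sg by simp
    let ?s8 = "s7(0 := num div ?g)"
    have r8: "runs (Store (Const 0) (Op Div (Load (reg_tmp 0)) (Load (reg_tmp 2)))) s7 (?S N) ?s8"
      using runs_Store[of "Const 0" s7 "Op Div (Load (reg_tmp 0)) (Load (reg_tmp 2))" "?S N"]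
        s7(3) g adr sn sg sng by (simp add: reg_tmp_def)
    let ?s9 = "?s8(1 := den div ?g)"
    have r9: "runs (Store (Const 1) (Op Div (Load (reg_tmp 1)) (Load (reg_tmp 2)))) ?s8 (?S N) ?s9"
      using runs_Store[of "Const 1" ?s8 "Op Div (Load (reg_tmp 1)) (Load (reg_tmp 2))" "?S N"]
        s7(4) g adr sd sg sdg by (simp add: reg_tmp_def)
    have "runs (fraction_program tK tN tD) ?inp (?T N) ?s9"
      unfolding fraction_program_def
      by (rule runs_Seq[OF s1(1) _ order_refl], rule runs_Seq[OF r2 _ order_refl],
          rule runs_Seq[OF s3(1) _ order_refl], rule runs_Seq[OF s4(1) _ order_refl],
          rule runs_Seq[OF r5 _ order_refl], rule runs_Seq[OF r6 _ order_refl],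
          rule runs_Seq[OF s7(1) _ order_refl], rule runs_Seq[OF r8 r9 order_refl])
    then obtain t where "t \<le> ?T N" "exec (fraction_program tK tN tD) ?inp t ?s9"
      unfolding runs_def by blast
    moreover have "\<forall>i<length [num div ?g, den div ?g]. ?s9 (int i) = [num div ?g, den div ?g] ! i"
      by (auto simp: less_Suc_eq numeral_2_eq_2)
    ultimately show "computes_within (fraction_program tK tN tD) xs [num div ?g, den div ?g] (poly p N)"
      using p[of N] order_trans unfolding computes_within_def by blast
  qed
qed

section \<open>Integrating a power of an affine form over a polyhedron\<close>

text \<open>Strict comparison with smaller indices singles out the least index among the minimizers.
  The condition is a separate test for each \<open>k\<close>, so the choice of an endpoint can be
  written as a sum over all candidates in which one survives.\<close>

lemma least_argmin:
  fixes \<tau> :: "nat \<Rightarrow> real"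
  assumes "finite U" "U \<noteq> {}"
  shows "\<exists>j\<in>U. (\<forall>i\<in>U. \<tau> j \<le> \<tau> i) \<and>
    (\<forall>k\<in>U. (\<forall>i\<in>U. if i < k then \<tau> k < \<tau> i else \<tau> k \<le> \<tau> i) \<longleftrightarrow> k = j)"
proof -
  obtain j0 where j0: "j0 \<in> U" "\<forall>i\<in>U. \<tau> j0 \<le> \<tau> i"
    using arg_min_if_finite[OF assms, of \<tau>] by (meson not_le)
  define j where "j = (LEAST j. j \<in> U \<and> \<tau> j = \<tau> j0)"
  have j: "j \<in> U" "\<tau> j = \<tau> j0"
    using LeastI[of "\<lambda>j. j \<in> U \<and> \<tau> j = \<tau> j0" j0] j0 by (auto simp: j_def)
  have least: "j \<le> i" if "i \<in> U" "\<tau> i = \<tau> j0" for i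
    unfolding j_def using that by (intro Least_le) auto
  have "(\<forall>i\<in>U. if i < j then \<tau> j < \<tau> i else \<tau> j \<le> \<tau> i)"
    using j j0 least by (metis leD order_le_less)
  moreover have "k = j" if "k \<in> U" "\<forall>i\<in>U. if i < k then \<tau> k < \<tau> i else \<tau> k \<le> \<tau> i" for k
  proof -
    have "\<tau> k \<le> \<tau> j0" using that j0(1) by (metis less_imp_le)
    then have *: "\<tau> k = \<tau> j0" using j0(2) that(1) by fastforce
    then have "j \<le> k" using least that by blast
    moreover have "\<not> j < k" using that(2) j * by (metis less_irrefl)
    ultimately show ?thesis by simp
  qed
  ultimately have "(\<forall>i\<in>U. if i < k then \<tau> k < \<tau> i else \<tau> k \<le> \<tau> i) \<longleftrightarrow> k = j" if "k \<in> U" for k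
    using that by blast
  moreover have "\<forall>i\<in>U. \<tau> j \<le> \<tau> i" using j j0 by simp
  ultimately show ?thesis using j(1) by blast
qed

lemma integral_power_Icc:
  fixes u v lo hi :: real
  assumes "lo \<le> hi" "v \<noteq> 0"
  shows "(\<integral>t. indicator {lo..hi} t * (u + v * t) ^ M \<partial>lborel) =
    ((u + v * hi) ^ Suc M - (u + v * lo) ^ Suc M) / (real (Suc M) * v)"
proof -
  let ?F = "\<lambda>t. (u + v * t) ^ Suc M / (real (Suc M) * v)"
  have "(?F has_real_derivative (u + v * x) ^ M) (at x within {lo..hi})" for x
    using assms(2) by (auto intro!: derivative_eq_intros simp del: power_Suc)
  then have "(\<integral>t. indicator {lo..hi} t *\<^sub>R (u + v * t) ^ M \<partial>lborel) = ?F hi - ?F lo"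
    using assms
    by (intro integral_FTC_atLeastAtMost) (auto simp: has_real_derivative_iff_has_vector_derivative[symmetric]
        intro!: continuous_intros)
  then show ?thesis by (simp add: diff_divide_distrib)
qed

text \<open>The upper endpoint of the fiber is the least \<open>\<tau> i\<close> with \<open>p i > 0\<close>, and the lower endpoint the
  greatest one with \<open>p i < 0\<close>. The summand for \<open>j\<close> asks for \<open>\<tau> j\<close> to be such an endpoint and to
  lie in the fiber; ties are broken in favour of the smallest index.\<close>

lemma fiber_integral:
  fixes p g :: "nat \<Rightarrow> real" and u v :: real
  assumes bdd: "(\<And>i. i < K \<Longrightarrow> p i = 0 \<Longrightarrow> g i \<le> 0) \<Longrightarrow> (\<exists>i<K. p i > 0) \<and> (\<exists>i<K. p i < 0)"
    and v: "\<And>i. i < K \<Longrightarrow> p i \<noteq> 0 \<Longrightarrow> v \<noteq> 0"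
  shows "(\<integral>t. indicator {t. \<forall>i<K. if fl i then p i * t + g i < 0 else p i * t + g i \<le> 0} t
      * (u + v * t) ^ M \<partial>lborel) =
    (\<Sum>j<K. if p j = 0 then 0 else
      sgn (p j) * (if \<forall>i<K. if (if p i = 0 then fl i else p i * p j > 0 \<and> i < j)
          then p j * (p j * g i - p i * g j) < 0 else p j * (p j * g i - p i * g j) \<le> 0
        then (u - v * g j / p j) ^ Suc M else 0) / (real (Suc M) * v))"
    (is "(\<integral>t. indicator ?S t * _ \<partial>lborel) = _")
proof -
  define S where "S = ?S"
  define c where "c k i \<longleftrightarrow> (if (if p i = 0 then fl i else p i * p k > 0 \<and> i < k)
          then p k * (p k * g i - p i * g k) < 0 else p k * (p k * g i - p i * g k) \<le> 0)" for k i
  define R where "R j = (if p j = 0 then 0 else sgn (p j) *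
    (if \<forall>i<K. c j i then (u - v * g j / p j) ^ Suc M else 0) / (real (Suc M) * v))" for j
  have sq: "0 < p k * p k" if "p k \<noteq> 0" for k
    using not_real_square_gt_zero[of "p k"] that by blast
  have sq_iff: "(p k * p k) * y < 0 \<longleftrightarrow> y < 0" "(p k * p k) * y \<le> 0 \<longleftrightarrow> y \<le> 0"
    if "p k \<noteq> 0" for k y
    using mult_less_cancel_left_pos[OF sq[OF that], of y 0] mult_le_cancel_left_pos[OF sq[OF that], of y 0]
    unfolding mult_zero_right .
  have inS: "t \<in> S \<longleftrightarrow> (\<forall>i<K. if fl i then p i * t + g i < 0 else p i * t + g i \<le> 0)" for t
    unfolding S_def by (rule mem_Collect_eq)
  have "(\<integral>t. indicator S t * (u + v * t) ^ M \<partial>lborel) = (\<Sum>j<K. R j)"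
  \<comment> \<open>Rows with \<open>p i = 0\<close> do not involve the fiber variable. If one of
    them fails, the fiber is empty, and every summand with a nonzero pivot tests the same failing
    row.\<close>
  proof (cases "\<forall>i<K. p i = 0 \<longrightarrow> (if fl i then g i < 0 else g i \<le> 0)")
    case False
    then obtain i where i: "i < K" "p i = 0" "\<not> (if fl i then g i < 0 else g i \<le> 0)" by blast
    have "t \<notin> S" for t
    proof
      assume "t \<in> S"
      then have "if fl i then p i * t + g i < 0 else p i * t + g i \<le> 0" using i(1) inS by blast
      then show False using i(2,3) by (cases "fl i") simp_all
    qed
    then have "S = {}" by blast
    have "(\<integral>t. indicator S t * (u + v * t) ^ M \<partial>lborel) = 0"
      by (simp add: \<open>S = {}\<close>)
    moreover have "R j = 0" if "j < K" for j
    proof (cases "p j = 0")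
      case False
      have eq: "p j * (p j * g i - p i * g j) = (p j * p j) * g i" using i by (simp add: algebra_simps)
      have "\<not> c j i" using i unfolding c_def eq sq_iff[OF False] by simp
      then have "\<not> (\<forall>i<K. c j i)" using i(1) by blast
      then show ?thesis unfolding R_def by (simp only: if_False) simp
    qed (simp add: R_def)
    ultimately show ?thesis by simp
  next
    case True
    define \<tau> where "\<tau> i = - g i / p i" for i
    define U where "U = {i. i < K \<and> p i > 0}"
    define L where "L = {i. i < K \<and> p i < 0}"
    have g: "g i = - p i * \<tau> i" if "p i \<noteq> 0" for i using that by (simp add: \<tau>_def)
    have "g i \<le> 0" if "i < K" "p i = 0" for i using True that by (meson less_imp_le)
    then have ne: "U \<noteq> {}" "L \<noteq> {}" using bdd by (auto simp: U_def L_def)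
    have fin: "finite U" "finite L" by (auto simp: U_def L_def)
    from ne(1) obtain i0 where "i0 < K" "p i0 \<noteq> 0" unfolding U_def by fastforce
    then have v0: "v \<noteq> 0" by (rule v)
    obtain j where j: "j \<in> U" "\<forall>i\<in>U. \<tau> j \<le> \<tau> i"
      "\<forall>k\<in>U. (\<forall>i\<in>U. if i < k then \<tau> k < \<tau> i else \<tau> k \<le> \<tau> i) \<longleftrightarrow> k = j"
      using least_argmin[OF fin(1) ne(1), of \<tau>] by (elim bexE conjE) (rule that)
    obtain m where m: "m \<in> L" "\<forall>i\<in>L. \<tau> i \<le> \<tau> m"
      "\<forall>k\<in>L. (\<forall>i\<in>L. if i < k then \<tau> i < \<tau> k else \<tau> i \<le> \<tau> k) \<longleftrightarrow> k = m"
      using least_argmin[OF fin(2) ne(2), of "\<lambda>i. - \<tau> i"]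
      unfolding neg_le_iff_le neg_less_iff_less by (elim bexE conjE) (rule that)
    \<comment> \<open>The expression tested for row \<open>i\<close> is the value of that row at the
      candidate endpoint \<open>\<tau> k\<close>, times the positive square of the pivot.\<close>
    have cval: "p k * (p k * g i - p i * g k) = (p k * p k) * (g i + p i * \<tau> k)" if "p k \<noteq> 0" for k i
      using g[OF that] by (simp add: algebra_simps)
    have c0: "c k i" if "i < K" "p i = 0" "p k \<noteq> 0" for k i
      using True that unfolding c_def cval[OF that(3)] sq_iff[OF that(3)] by simp
    have c1: "c k i \<longleftrightarrow> (if p i * p k > 0 \<and> i < k then p i * (\<tau> k - \<tau> i) < 0 else p i * (\<tau> k - \<tau> i) \<le> 0)"
      if "p i \<noteq> 0" "p k \<noteq> 0" for k i
    proof -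
      have "g i + p i * \<tau> k = p i * (\<tau> k - \<tau> i)" using g[OF that(1)] by (simp add: algebra_simps)
      then show ?thesis using that unfolding c_def cval[OF that(2)] sq_iff[OF that(2)] by simp
    qed
    have all: "(\<forall>i<K. c k i) \<longleftrightarrow> (\<forall>i\<in>U. c k i) \<and> (\<forall>i\<in>L. c k i)" if "p k \<noteq> 0" for k
    proof (intro iffI conjI ballI allI impI)
      fix i assume "(\<forall>i\<in>U. c k i) \<and> (\<forall>i\<in>L. c k i)" "i < K"
      then show "c k i"
        using c0[OF \<open>i < K\<close> _ that] by (cases "p i" "0 :: real" rule: linorder_cases) (auto simp: U_def L_def)
    qed (auto simp: U_def L_def)
    have cU: "(\<forall>i<K. c k i) \<longleftrightarrow> k = j \<and> \<tau> m \<le> \<tau> j" if "k \<in> U" for k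
    proof -
      have pk: "p k > 0" using that by (simp add: U_def)
      have "(\<forall>i\<in>U. c k i) \<longleftrightarrow> (\<forall>i\<in>U. if i < k then \<tau> k < \<tau> i else \<tau> k \<le> \<tau> i)"
        by (rule ball_cong[OF refl], subst c1)
          (use pk in \<open>auto simp: U_def mult_less_0_iff mult_le_0_iff\<close>)
      moreover have "(\<forall>i\<in>L. c k i) \<longleftrightarrow> (\<forall>i\<in>L. \<tau> i \<le> \<tau> k)"
        by (rule ball_cong[OF refl], subst c1)
          (use pk in \<open>auto simp: L_def mult_less_0_iff mult_le_0_iff zero_less_mult_iff\<close>)
      moreover have "(\<forall>i\<in>L. \<tau> i \<le> \<tau> j) \<longleftrightarrow> \<tau> m \<le> \<tau> j" using m(1,2) by (meson order_trans)
      ultimately show ?thesis using all[of k] pk j(3) that by auto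
    qed
    have cL: "(\<forall>i<K. c k i) \<longleftrightarrow> k = m \<and> \<tau> m \<le> \<tau> j" if "k \<in> L" for k
    proof -
      have pk: "p k < 0" using that by (simp add: L_def)
      have "(\<forall>i\<in>L. c k i) \<longleftrightarrow> (\<forall>i\<in>L. if i < k then \<tau> i < \<tau> k else \<tau> i \<le> \<tau> k)"
        by (rule ball_cong[OF refl], subst c1)
          (use pk in \<open>auto simp: L_def mult_less_0_iff mult_le_0_iff zero_less_mult_iff\<close>)
      moreover have "(\<forall>i\<in>U. c k i) \<longleftrightarrow> (\<forall>i\<in>U. \<tau> k \<le> \<tau> i)"
        by (rule ball_cong[OF refl], subst c1)
          (use pk in \<open>auto simp: U_def mult_less_0_iff mult_le_0_iff zero_less_mult_iff\<close>)
      moreover have "(\<forall>i\<in>U. \<tau> m \<le> \<tau> i) \<longleftrightarrow> \<tau> m \<le> \<tau> j" using j(1,2) by (meson order_trans)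
      ultimately show ?thesis using all[of k] pk m(3) that by auto
    qed
    let ?F = "\<lambda>t. (u + v * t) ^ Suc M / (real (Suc M) * v)"
    \<comment> \<open>The two surviving candidates contribute the antiderivative with opposite
      signs. Both are guarded by \<open>\<tau> m \<le> \<tau> j\<close>, so an empty fiber gives
      zero instead of an integral in the reversed direction.\<close>
    have R: "R k = (if k = j then if \<tau> m \<le> \<tau> j then ?F (\<tau> j) else 0 else 0)
        - (if k = m then if \<tau> m \<le> \<tau> j then ?F (\<tau> m) else 0 else 0)" if "k < K" for k
    proof -
      have jm: "j \<noteq> m" "p j \<noteq> 0" "p m \<noteq> 0" using j(1) m(1) by (auto simp: U_def L_def)
      have val: "u - v * g k / p k = u + v * \<tau> k" by (simp add: \<tau>_def)
      consider "p k = 0" | "k \<in> U" | "k \<in> L" using \<open>k < K\<close> by (fastforce simp: U_def L_def)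
      then show ?thesis
      proof cases
        case 1
        then show ?thesis using jm by (auto simp: R_def)
      next
        case 2
        then have "k \<noteq> m" "p k \<noteq> 0" "sgn (p k) = 1" using m(1) by (auto simp: U_def L_def)
        then show ?thesis unfolding R_def cU[OF 2] val by auto
      next
        case 3
        then have "k \<noteq> j" "p k \<noteq> 0" "sgn (p k) = -1" using j(1) by (auto simp: U_def L_def)
        then show ?thesis unfolding R_def cL[OF 3] val by auto
      qed
    qed
    have "(\<Sum>k<K. R k) = (if \<tau> m \<le> \<tau> j then ?F (\<tau> j) - ?F (\<tau> m) else 0)"
    proof -
      have "(\<Sum>k<K. R k) = (\<Sum>k<K. (if k = j then if \<tau> m \<le> \<tau> j then ?F (\<tau> j) else 0 else 0)
        - (if k = m then if \<tau> m \<le> \<tau> j then ?F (\<tau> m) else 0 else 0))"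
        using R by (intro sum.cong) auto
      also have "\<dots> = (if \<tau> m \<le> \<tau> j then ?F (\<tau> j) - ?F (\<tau> m) else 0)"
        using j(1) m(1) by (simp add: sum_subtractf U_def L_def)
      finally show ?thesis .
    qed
    moreover have "(\<integral>t. indicator S t * (u + v * t) ^ M \<partial>lborel) =
        (if \<tau> m \<le> \<tau> j then ?F (\<tau> j) - ?F (\<tau> m) else 0)"
    proof -
      have sub: "S \<subseteq> {\<tau> m..\<tau> j}"
      proof
        fix t assume "t \<in> S"
        then have t: "p i * t + g i \<le> 0" if "i < K" for i using that inS[of t] by (meson less_imp_le)
        have "p j * (t - \<tau> j) \<le> 0" "p m * (t - \<tau> m) \<le> 0"
          using t[of j] t[of m] g[of j] g[of m] j(1) m(1) by (auto simp: U_def L_def algebra_simps)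
        then show "t \<in> {\<tau> m..\<tau> j}" using j(1) m(1) by (auto simp: U_def L_def mult_le_0_iff)
      qed
      have sup: "{\<tau> m<..<\<tau> j} \<subseteq> S"
      proof
        fix t assume t: "t \<in> {\<tau> m<..<\<tau> j}"
        have "if fl i then p i * t + g i < 0 else p i * t + g i \<le> 0" if iK: "i < K" for i
        proof -
          consider "p i = 0" | "i \<in> U" | "i \<in> L" using iK by (fastforce simp: U_def L_def)
          then show ?thesis
          proof cases
            case 1
            then show ?thesis using True iK by simp
          next
            case 2
            then have "t < \<tau> i" "p i > 0" using t j(2) by (fastforce simp: U_def)+
            then have "p i * (t - \<tau> i) < 0" by (simp add: mult_less_0_iff)
            moreover have "p i * t + g i = p i * (t - \<tau> i)" using g[of i] \<open>p i > 0\<close> by (simp add: algebra_simps)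
            ultimately show ?thesis by simp
          next
            case 3
            then have "t > \<tau> i" "p i < 0" using t m(2) by (fastforce simp: L_def)+
            then have "p i * (t - \<tau> i) < 0" by (simp add: mult_less_0_iff)
            moreover have "p i * t + g i = p i * (t - \<tau> i)" using g[of i] \<open>p i < 0\<close> by (simp add: algebra_simps)
            ultimately show ?thesis by simp
          qed
        qed
        then show "t \<in> S" using inS by blast
      qed
      \<comment> \<open>Strict rows can remove only endpoints from the closed interval, which is a
        null set.\<close>
      have "(\<integral>t. indicator S t * (u + v * t) ^ M \<partial>lborel) =
         (\<integral>t. indicator {\<tau> m..\<tau> j} t * (u + v * t) ^ M \<partial>lborel)"
      proof (rule integral_cong_AE)
        show "(\<lambda>t. indicator S t * (u + v * t) ^ M) \<in> borel_measurable lborel"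
          unfolding S_def by measurable
        show "AE t in lborel. indicator S t * (u + v * t) ^ M = indicator {\<tau> m..\<tau> j} t * (u + v * t) ^ M"
          using AE_lborel_singleton[of "\<tau> m"] AE_lborel_singleton[of "\<tau> j"]
        proof eventually_elim
          case (elim t)
          then have "t \<in> {\<tau> m..\<tau> j} \<Longrightarrow> t \<in> {\<tau> m<..<\<tau> j}" by auto
          then have "t \<in> S \<longleftrightarrow> t \<in> {\<tau> m..\<tau> j}" using sub sup by blast
          then have "(indicator S t :: real) = indicator {\<tau> m..\<tau> j} t" by (simp only: indicator_def)
          then show ?case by simp
        qed
      qed simp
      also have "\<dots> = (if \<tau> m \<le> \<tau> j then ?F (\<tau> j) - ?F (\<tau> m) else 0)"
        using integral_power_Icc[OF _ v0] by (auto simp: diff_divide_distrib)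
      finally show ?thesis .
    qed
    ultimately show ?thesis by simp
  qed
  then show ?thesis unfolding S_def R_def c_def .
qed

text \<open>The form \<open>g\<close> after solving row \<open>j\<close> for coordinate \<open>e\<close>, scaled by the square of the pivot so that
  inequalities keep their direction. Column \<open>0\<close> holds the constant terms. The flags \<open>fl\<close> mark the
  strict inequalities.\<close>

definition pivot :: "(nat \<Rightarrow> nat \<Rightarrow> int) \<Rightarrow> nat \<Rightarrow> nat \<Rightarrow> (nat \<Rightarrow> 'r::comm_ring_1) \<Rightarrow> nat \<Rightarrow> 'r" where
  "pivot a e j g c = of_int (a j e) * (of_int (a j e) * g c - g e * of_int (a j c))"

text \<open>The tie-breaking rule of \<open>fiber_integral\<close> as a flag: a row that competes
  with \<open>j\<close> for the same endpoint and has a smaller index must lose strictly. Rows of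
  opposite sign only express that the fiber is nonempty and become weak. Rows free of coordinate
  \<open>e\<close> keep their flag; the flags of the others affect only endpoints of fibers.\<close>

definition tie :: "(nat \<Rightarrow> nat \<Rightarrow> int) \<Rightarrow> nat \<Rightarrow> nat \<Rightarrow> (nat \<Rightarrow> bool) \<Rightarrow> nat \<Rightarrow> bool" where
  "tie a e j fl i \<longleftrightarrow> (if a i e = 0 then fl i else a i e * a j e > 0 \<and> i < j)"

text \<open>\<open>pivot\<close> multiplies a form by the square of the pivot, so its power with
  exponent \<open>Suc M\<close> carries the pivot to the power \<open>2 * Suc M\<close>; the
  antiderivative divides by \<open>l (Suc e)\<close>, and its factor \<open>Suc M\<close> is left to
  the factorials. All rows are included, whatever their contribution, so that no flags enter. The
  ring is left open because the recursion is read over the reals, the integers and the integer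
  polynomials in \<open>Z\<close>.\<close>

fun den :: "nat \<Rightarrow> nat \<Rightarrow> (nat \<Rightarrow> nat \<Rightarrow> int) \<Rightarrow> (nat \<Rightarrow> 'r::comm_ring_1) \<Rightarrow> nat \<Rightarrow> 'r" where
  "den K 0 a l M = 1"
| "den K (Suc e) a l M = (\<Prod>j<K. if a j (Suc e) = 0 then 1 else
     l (Suc e) * of_int (a j (Suc e)) ^ (2 * Suc M) *
     den K e (\<lambda>i. pivot a (Suc e) j (a i)) (pivot a (Suc e) j l) (Suc M))"

definition den_factor ::
    "nat \<Rightarrow> nat \<Rightarrow> (nat \<Rightarrow> nat \<Rightarrow> int) \<Rightarrow> (nat \<Rightarrow> 'r::comm_ring_1) \<Rightarrow> nat \<Rightarrow> nat \<Rightarrow> 'r" where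
  "den_factor K e a l M j = (if a j (Suc e) = 0 then 1 else
     l (Suc e) * of_int (a j (Suc e)) ^ (2 * Suc M) *
     den K e (\<lambda>i. pivot a (Suc e) j (a i)) (pivot a (Suc e) j l) (Suc M))"

lemma den_Suc: "den K (Suc e) a l M = (\<Prod>j<K. den_factor K e a l M j)"
  by (simp add: den_factor_def)

declare den.simps(2) [simp del]

text \<open>The numerators over the common denominator \<open>den\<close>. Once all coordinates are
  eliminated the rows are integer constants, and for integers \<open>a < 0\<close> is the same as
  \<open>a + 1 \<le> 0\<close>.\<close>

fun num :: "nat \<Rightarrow> nat \<Rightarrow> (nat \<Rightarrow> nat \<Rightarrow> int) \<Rightarrow> (nat \<Rightarrow> bool) \<Rightarrow> (nat \<Rightarrow> 'r::comm_ring_1) \<Rightarrow> nat \<Rightarrow> 'r" where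
  "num K 0 a fl l M = (if \<forall>i<K. a i 0 + of_bool (fl i) \<le> 0 then l 0 ^ M else 0)"
| "num K (Suc e) a fl l M = (\<Sum>j<K. of_int (sgn (a j (Suc e))) *
     num K e (\<lambda>i. pivot a (Suc e) j (a i)) (tie a (Suc e) j fl) (pivot a (Suc e) j l) (Suc M) *
     (\<Prod>i\<in>{..<K} - {j}. den_factor K e a l M i))"

section \<open>Affine forms, partly open regions and elimination of a coordinate\<close>

definition aff :: "(nat \<Rightarrow> 'i) \<Rightarrow> nat \<Rightarrow> (nat \<Rightarrow> real) \<Rightarrow> ('i \<Rightarrow> real) \<Rightarrow> real" where
  "aff b e g x = g 0 + (\<Sum>c=1..e. g c * x (b c))"

definition region ::
    "(nat \<Rightarrow> 'i) \<Rightarrow> nat \<Rightarrow> nat \<Rightarrow> (nat \<Rightarrow> nat \<Rightarrow> int) \<Rightarrow> (nat \<Rightarrow> bool) \<Rightarrow> ('i \<Rightarrow> real) set" where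
  "region b K e a fl = {x. \<forall>i<K. if fl i then aff b e (\<lambda>c. of_int (a i c)) x < 0
     else aff b e (\<lambda>c. of_int (a i c)) x \<le> 0}"

definition bdd_region :: "(nat \<Rightarrow> 'i) \<Rightarrow> nat \<Rightarrow> nat \<Rightarrow> (nat \<Rightarrow> nat \<Rightarrow> int) \<Rightarrow> bool" where
  "bdd_region b K e a \<longleftrightarrow>
     (\<exists>X. \<forall>x\<in>region b K e a (\<lambda>_. False). \<forall>c\<in>{1..e}. \<bar>x (b c)\<bar> \<le> X)"

lemma of_int_pivot: "of_int (pivot a e j g c) = pivot a e j (\<lambda>c. of_int (g c)) c"
  by (simp add: pivot_def)

lemma aff_upd:
  assumes "inj_on b {1..Suc e}"
  shows "aff b (Suc e) g (x(b (Suc e) := t)) = aff b e g x + g (Suc e) * t"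
proof -
  have "b c \<noteq> b (Suc e)" if "c \<in> {1..e}" for c
    using inj_onD[OF assms, of c "Suc e"] that by auto
  then have "(\<Sum>c=1..e. g c * (x(b (Suc e) := t)) (b c)) = (\<Sum>c=1..e. g c * x (b c))"
    by (intro sum.cong) auto
  then show ?thesis by (simp add: aff_def)
qed

lemma aff_pivot:
  "aff b e (pivot a e' j g) x = of_int (a j e') *
     (of_int (a j e') * aff b e g x - g e' * aff b e (\<lambda>c. of_int (a j c)) x)"
  by (simp add: aff_def pivot_def algebra_simps sum.distrib sum_distrib_left sum_subtractf)

lemma aff_of_int_pivot:
  "aff b e (\<lambda>c. of_int (pivot a e' j g c)) x = of_int (a j e') *
     (of_int (a j e') * aff b e (\<lambda>c. of_int (g c)) x - of_int (g e') * aff b e (\<lambda>c. of_int (a j c)) x)"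
  using aff_pivot[of b e a e' j "\<lambda>c. of_int (g c)" x] by (simp add: of_int_pivot)

text \<open>Solving row \<open>j\<close> for the last coordinate lifts a solution of the eliminated
  system to a point of the original polyhedron with the same other coordinates.\<close>

lemma bdd_region_pivot:
  assumes inj: "inj_on b {1..Suc e}" and bdd: "bdd_region b K (Suc e) a"
    and j: "j < K" "a j (Suc e) \<noteq> 0"
  shows "bdd_region b K e (\<lambda>i. pivot a (Suc e) j (a i))"
proof -
  obtain X where X: "\<And>x c. x \<in> region b K (Suc e) a (\<lambda>_. False) \<Longrightarrow> c \<in> {1..Suc e} \<Longrightarrow> \<bar>x (b c)\<bar> \<le> X"
    using bdd unfolding bdd_region_def by blast
  have "\<bar>x (b c)\<bar> \<le> X" if x: "x \<in> region b K e (\<lambda>i. pivot a (Suc e) j (a i)) (\<lambda>_. False)"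
    and c: "c \<in> {1..e}" for x c
  proof -
    let ?g = "\<lambda>i. aff b e (\<lambda>c. of_int (a i c)) x" and ?p = "\<lambda>i. real_of_int (a i (Suc e))"
    let ?x = "x(b (Suc e) := - ?g j / ?p j)"
    have "aff b (Suc e) (\<lambda>c. of_int (a i c)) ?x \<le> 0" if "i < K" for i
    proof -
      have "?p j * (?p j * ?g i - ?p i * ?g j) \<le> 0"
        using x that unfolding region_def by (simp add: aff_of_int_pivot)
      moreover have "?p j * (?p j * ?g i - ?p i * ?g j) = (?p j * ?p j) * (?g i + ?p i * (- ?g j / ?p j))"
        using j(2) by (simp add: field_simps)
      moreover have "?p j * ?p j > 0" using j(2) not_real_square_gt_zero[of "?p j"] by (metis of_int_eq_0_iff)
      ultimately have "?g i + ?p i * (- ?g j / ?p j) \<le> 0"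
        by (metis mult_le_cancel_left_pos mult_zero_right)
      then show ?thesis using aff_upd[OF inj] by simp
    qed
    then have "?x \<in> region b K (Suc e) a (\<lambda>_. False)" unfolding region_def by simp
    then have "\<bar>?x (b c)\<bar> \<le> X" using X[of ?x c] c by simp
    moreover have "b c \<noteq> b (Suc e)" using inj_onD[OF inj, of c "Suc e"] c by auto
    ultimately show ?thesis by simp
  qed
  then show ?thesis unfolding bdd_region_def by blast
qed

text \<open>If one of the two signs did not occur among the coefficients of the last coordinate, the
  fiber over \<open>x\<close> would contain a ray.\<close>

lemma bdd_region_fiber:
  assumes inj: "inj_on b {1..Suc e}" and bdd: "bdd_region b K (Suc e) a"
    and N: "\<And>i. i < K \<Longrightarrow> a i (Suc e) = 0 \<Longrightarrow> aff b e (\<lambda>c. of_int (a i c)) x \<le> 0"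
  shows "(\<exists>i<K. a i (Suc e) > 0) \<and> (\<exists>i<K. a i (Suc e) < 0)"
proof -
  let ?g = "\<lambda>i. aff b e (\<lambda>c. of_int (a i c)) x" and ?p = "\<lambda>i. real_of_int (a i (Suc e))"
  obtain X where X: "\<And>x c. x \<in> region b K (Suc e) a (\<lambda>_. False) \<Longrightarrow> c \<in> {1..Suc e} \<Longrightarrow> \<bar>x (b c)\<bar> \<le> X"
    using bdd unfolding bdd_region_def by blast
  \<comment> \<open>\<open>T\<close> exceeds the supposed bound \<open>X\<close> and the size of all
    candidate endpoints. With last coordinate \<open>s * T\<close>, every row whose coefficient has
    the sign opposite to \<open>s\<close> is satisfied.\<close>
  define T where "T = 1 + \<bar>X\<bar> + (\<Sum>i<K. \<bar>?g i / ?p i\<bar>)"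
  have T: "\<bar>?g i / ?p i\<bar> \<le> T" if "i < K" for i
  proof -
    have "\<bar>?g i / ?p i\<bar> \<le> (\<Sum>i<K. \<bar>?g i / ?p i\<bar>)"
      using that by (intro member_le_sum) auto
    then show ?thesis unfolding T_def by linarith
  qed
  have "0 \<le> (\<Sum>i<K. \<bar>?g i / ?p i\<bar>)" by (intro sum_nonneg) simp
  then have TX: "T > X" "T > 0" unfolding T_def by linarith+
  have "\<exists>i<K. s * ?p i > 0" if s: "s = 1 \<or> s = -1" for s
  proof (rule ccontr)
    assume no: "\<not> (\<exists>i<K. s * ?p i > 0)"
    let ?x = "x(b (Suc e) := s * T)"
    have "?g i + ?p i * (s * T) \<le> 0" if "i < K" for i
    proof (cases "a i (Suc e) = 0")
      case True
      then show ?thesis using N that by simp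
    next
      case False
      have "\<not> s * ?p i > 0" using no that by blast
      moreover have "s * ?p i \<noteq> 0" using False s by auto
      ultimately have sp: "s * ?p i < 0" by linarith
      have "\<bar>?g i\<bar> \<le> T * \<bar>?p i\<bar>" using T[OF that] False by (simp add: abs_divide field_simps)
      moreover have "\<bar>?p i\<bar> = - (s * ?p i)" using sp s by auto
      ultimately have "\<bar>?g i\<bar> \<le> - (?p i * (s * T))" by (simp add: algebra_simps)
      then show ?thesis by linarith
    qed
    then have "?x \<in> region b K (Suc e) a (\<lambda>_. False)" unfolding region_def by (simp add: aff_upd[OF inj])
    then have "\<bar>s * T\<bar> \<le> X" using X[of ?x "Suc e"] by simp
    then show False using TX s by auto
  qed
  from this[of 1] this[of "-1"] show ?thesis by auto
qed

lemma region_upd_iff: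
  assumes inj: "inj_on b {1..Suc e}"
  shows "x(b (Suc e) := t) \<in> region b K (Suc e) a fl \<longleftrightarrow>
    (\<forall>i<K. if fl i then of_int (a i (Suc e)) * t + aff b e (\<lambda>c. of_int (a i c)) x < 0
       else of_int (a i (Suc e)) * t + aff b e (\<lambda>c. of_int (a i c)) x \<le> 0)"
  unfolding region_def by (simp add: aff_upd[OF inj] add.commute)

lemma fiber_integral_pivot:
  assumes inj: "inj_on b {1..Suc e}" and bdd: "bdd_region b K (Suc e) a"
    and l: "\<And>j. j < K \<Longrightarrow> a j (Suc e) \<noteq> 0 \<Longrightarrow> l (Suc e) \<noteq> 0"
  shows "(\<integral>t. indicator (region b K (Suc e) a fl) (x(b (Suc e) := t)) *
       aff b (Suc e) l (x(b (Suc e) := t)) ^ M \<partial>lborel) =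
    (\<Sum>j<K. of_int (sgn (a j (Suc e))) / (real (Suc M) * l (Suc e) * of_int (a j (Suc e)) ^ (2 * Suc M)) *
       (indicator (region b K e (\<lambda>i. pivot a (Suc e) j (a i)) (tie a (Suc e) j fl)) x *
        aff b e (pivot a (Suc e) j l) x ^ Suc M))"
proof -
  let ?g = "\<lambda>i. aff b e (\<lambda>c. of_int (a i c)) x" and ?p = "\<lambda>i. real_of_int (a i (Suc e))"
  let ?u = "aff b e l x" and ?v = "l (Suc e)"
  have "(\<integral>t. indicator (region b K (Suc e) a fl) (x(b (Suc e) := t)) *
       aff b (Suc e) l (x(b (Suc e) := t)) ^ M \<partial>lborel) =
    (\<integral>t. indicator {t. \<forall>i<K. if fl i then ?p i * t + ?g i < 0 else ?p i * t + ?g i \<le> 0} t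
      * (?u + ?v * t) ^ M \<partial>lborel)"
    by (rule Bochner_Integration.integral_cong[OF refl])
      (simp only: indicator_def region_upd_iff[OF inj] aff_upd[OF inj] mem_Collect_eq)
  also have "\<dots> = (\<Sum>j<K. if ?p j = 0 then 0 else
      sgn (?p j) * (if \<forall>i<K. if (if ?p i = 0 then fl i else ?p i * ?p j > 0 \<and> i < j)
          then ?p j * (?p j * ?g i - ?p i * ?g j) < 0 else ?p j * (?p j * ?g i - ?p i * ?g j) \<le> 0
        then (?u - ?v * ?g j / ?p j) ^ Suc M else 0) / (real (Suc M) * ?v))"
  proof (rule fiber_integral)
    assume "\<And>i. i < K \<Longrightarrow> ?p i = 0 \<Longrightarrow> ?g i \<le> 0"
    then show "(\<exists>i<K. ?p i > 0) \<and> (\<exists>i<K. ?p i < 0)"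
      using bdd_region_fiber[OF inj bdd, of x] by simp
  qed (use l in simp)
  also have "\<dots> = (\<Sum>j<K. of_int (sgn (a j (Suc e))) / (real (Suc M) * l (Suc e) * of_int (a j (Suc e)) ^ (2 * Suc M)) *
       (indicator (region b K e (\<lambda>i. pivot a (Suc e) j (a i)) (tie a (Suc e) j fl)) x *
        aff b e (pivot a (Suc e) j l) x ^ Suc M))"
  proof (rule sum.cong[OF refl])
    fix j assume "j \<in> {..<K}"
    let ?A = "\<forall>i<K. if (if ?p i = 0 then fl i else ?p i * ?p j > 0 \<and> i < j)
          then ?p j * (?p j * ?g i - ?p i * ?g j) < 0 else ?p j * (?p j * ?g i - ?p i * ?g j) \<le> 0"
    have tie: "tie a (Suc e) j fl i \<longleftrightarrow> (if ?p i = 0 then fl i else ?p i * ?p j > 0 \<and> i < j)" for i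
      unfolding tie_def by (simp flip: of_int_mult)
    have A: "x \<in> region b K e (\<lambda>i. pivot a (Suc e) j (a i)) (tie a (Suc e) j fl) \<longleftrightarrow> ?A"
      unfolding region_def mem_Collect_eq aff_of_int_pivot tie ..
    show "(if ?p j = 0 then 0 else
      sgn (?p j) * (if ?A then (?u - ?v * ?g j / ?p j) ^ Suc M else 0) / (real (Suc M) * ?v)) =
      of_int (sgn (a j (Suc e))) / (real (Suc M) * l (Suc e) * of_int (a j (Suc e)) ^ (2 * Suc M)) *
       (indicator (region b K e (\<lambda>i. pivot a (Suc e) j (a i)) (tie a (Suc e) j fl)) x *
        aff b e (pivot a (Suc e) j l) x ^ Suc M)"
    proof (cases "?p j = 0")
      case False
      have "aff b e (pivot a (Suc e) j l) x = ?p j ^ 2 * (?u - ?v * ?g j / ?p j)"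
        unfolding aff_pivot using False by (simp add: field_simps power2_eq_square)
      then have "aff b e (pivot a (Suc e) j l) x ^ Suc M
          = ?p j ^ (2 * Suc M) * (?u - ?v * ?g j / ?p j) ^ Suc M"
        by (simp only: power_mult_distrib power_mult)
      moreover have "?p j ^ (2 * Suc M) \<noteq> 0" using False by simp
      moreover have "of_int (sgn (a j (Suc e))) = sgn (?p j)" by (simp add: sgn_if)
      moreover have "indicator (region b K e (\<lambda>i. pivot a (Suc e) j (a i)) (tie a (Suc e) j fl)) x
          = (if ?A then 1 else 0 :: real)"
        unfolding indicator_def A by simp
      moreover have "\<sigma> * (if B then y else 0) / (m * v) = \<sigma> / (m * v * q) * ((if B then 1 else 0) * (q * y))"
        if "q \<noteq> 0" for \<sigma> y m v q :: real and B
        using that by simp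
      ultimately show ?thesis using False by (simp only: if_False)
    qed simp
  qed
  finally show ?thesis .
qed


section \<open>Measurability and integrability over bounded regions\<close>

lemma measurable_aff:
  "aff b e g \<in> borel_measurable (Pi\<^sub>M (b ` {1..e}) (\<lambda>_. lborel))"
proof -
  have "(\<lambda>x. x (b c)) \<in> borel_measurable (Pi\<^sub>M (b ` {1..e}) (\<lambda>_. lborel))" if "c \<in> {1..e}" for c
    using measurable_component_singleton[of "b c" "b ` {1..e}" "\<lambda>_. lborel"] that by simp
  then show ?thesis unfolding aff_def[abs_def]
    by (intro borel_measurable_add borel_measurable_sum borel_measurable_times) auto
qed

lemma measurable_indicator_region:
  "(indicator (region b K e a fl) :: _ \<Rightarrow> real) \<in> borel_measurable (Pi\<^sub>M (b ` {1..e}) (\<lambda>_. lborel))"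
proof -
  note [measurable] = measurable_aff
  have A: "(\<lambda>x. if \<forall>i<K. if fl i then aff b e (\<lambda>c. of_int (a i c)) x < 0
     else aff b e (\<lambda>c. of_int (a i c)) x \<le> 0 then 1 else 0 :: real)
       \<in> borel_measurable (Pi\<^sub>M (b ` {1..e}) (\<lambda>_. lborel))"
    by measurable
  have B: "(indicator (region b K e a fl) :: _ \<Rightarrow> real) =
    (\<lambda>x. if \<forall>i<K. if fl i then aff b e (\<lambda>c. of_int (a i c)) x < 0
     else aff b e (\<lambda>c. of_int (a i c)) x \<le> 0 then 1 else 0)"
    unfolding region_def indicator_def of_bool_def mem_Collect_eq ..
  show ?thesis unfolding B by (rule A)
qed

lemma region_mono: "region b K e a fl \<subseteq> region b K e a (\<lambda>_. False)"
proof
  fix x assume x: "x \<in> region b K e a fl"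
  have "aff b e (\<lambda>c. of_int (a i c)) x \<le> 0" if "i < K" for i
    using x that unfolding region_def by (cases "fl i") (auto dest!: spec[of _ i])
  then show "x \<in> region b K e a (\<lambda>_. False)" by (simp add: region_def)
qed

lemma abs_aff_le:
  assumes "\<And>c. c \<in> {1..e} \<Longrightarrow> \<bar>x (b c)\<bar> \<le> X"
  shows "\<bar>aff b e l x\<bar> \<le> \<bar>l 0\<bar> + (\<Sum>c=1..e. \<bar>l c\<bar> * X)"
proof -
  have "\<bar>\<Sum>c=1..e. l c * x (b c)\<bar> \<le> (\<Sum>c=1..e. \<bar>l c\<bar> * X)"
    using assms by (intro order_trans[OF sum_abs] sum_mono) (auto simp: abs_mult mult_left_mono)
  then show ?thesis unfolding aff_def by linarith
qed

definition cube :: "(nat \<Rightarrow> 'i) \<Rightarrow> nat \<Rightarrow> real \<Rightarrow> ('i \<Rightarrow> real) set" where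
  "cube b e X = Pi\<^sub>E (b ` {1..e}) (\<lambda>_. {-X..X})"

lemma cube_measure:
  assumes "inj_on b {1..e}" "0 \<le> X"
  shows "cube b e X \<in> sets (Pi\<^sub>M (b ` {1..e}) (\<lambda>_. lborel))"
    and "emeasure (Pi\<^sub>M (b ` {1..e}) (\<lambda>_. lborel)) (cube b e X) = ennreal ((2 * X) ^ e)"
proof -
  interpret product_sigma_finite "\<lambda>_ :: 'a. lborel :: real measure"
    by (simp add: product_sigma_finite_def sigma_finite_lborel)
  show "cube b e X \<in> sets (Pi\<^sub>M (b ` {1..e}) (\<lambda>_. lborel))"
    unfolding cube_def by (intro sets_PiM_I_finite) auto
  have "emeasure (Pi\<^sub>M (b ` {1..e}) (\<lambda>_. lborel)) (cube b e X) =
      (\<Prod>i\<in>b ` {1..e}. emeasure lborel {-X..X})"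
    unfolding cube_def by (intro emeasure_PiM) auto
  also have "\<dots> = ennreal (2 * X) ^ card (b ` {1..e})"
    using assms(2) by simp
  also have "\<dots> = ennreal ((2 * X) ^ e)"
    using assms by (simp add: card_image ennreal_power)
  finally show "emeasure (Pi\<^sub>M (b ` {1..e}) (\<lambda>_. lborel)) (cube b e X) = ennreal ((2 * X) ^ e)" .
qed

text \<open>The integrand is dominated by a constant on the cube of half-width \<open>X\<close>. The
  explicit estimate is later needed to bound the coefficients of the polynomial in
  \<open>Z\<close>.\<close>

lemma integrable_bdd_region:
  fixes f :: "('i \<Rightarrow> real) \<Rightarrow> real"
  assumes inj: "inj_on b {1..e}" and "0 \<le> X"
    and X: "\<And>x c. x \<in> region b K e a fl \<Longrightarrow> c \<in> {1..e} \<Longrightarrow> \<bar>x (b c)\<bar> \<le> X"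
    and f: "f \<in> borel_measurable (Pi\<^sub>M (b ` {1..e}) (\<lambda>_. lborel))"
    and C: "\<And>x. x \<in> region b K e a fl \<Longrightarrow> \<bar>f x\<bar> \<le> C"
  shows "integrable (Pi\<^sub>M (b ` {1..e}) (\<lambda>_. lborel)) (\<lambda>x. indicator (region b K e a fl) x * f x)"
    and "0 \<le> C \<Longrightarrow> \<bar>\<integral>x. indicator (region b K e a fl) x * f x \<partial>(Pi\<^sub>M (b ` {1..e}) (\<lambda>_. lborel))\<bar>
          \<le> C * (2 * X) ^ e"
proof -
  let ?M = "Pi\<^sub>M (b ` {1..e}) (\<lambda>_. lborel :: real measure)" and ?R = "region b K e a fl"
  note bm = cube_measure[OF inj \<open>0 \<le> X\<close>]
  have int: "integrable ?M (\<lambda>x. \<bar>C\<bar> * indicator (cube b e X) x)"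
    using bm by (intro integrable_mult_right integrable_real_indicator) auto
  have le: "\<bar>indicator ?R x * f x\<bar> \<le> \<bar>C\<bar> * indicator (cube b e X) x" if "x \<in> space ?M" for x
  proof (cases "x \<in> ?R")
    case True
    have "x \<in> cube b e X"
    proof -
      have "x \<in> extensional (b ` {1..e})" using that by (simp add: space_PiM PiE_def)
      moreover have "x i \<in> {-X..X}" if i: "i \<in> b ` {1..e}" for i
      proof -
        from i obtain c where "i = b c" "c \<in> {1..e}" by blast
        then show ?thesis using X[OF True, of c] by (simp add: abs_le_iff)
      qed
      ultimately show ?thesis by (simp add: cube_def PiE_iff)
    qed
    then show ?thesis using True C[OF True] by simp
  qed simp
  show i: "integrable ?M (\<lambda>x. indicator ?R x * f x)"
    by (rule Bochner_Integration.integrable_bound[OF int])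
      (use le f measurable_indicator_region in \<open>auto intro!: borel_measurable_times\<close>)
  assume "0 \<le> C"
  have "\<bar>\<integral>x. indicator ?R x * f x \<partial>?M\<bar> \<le> (\<integral>x. \<bar>indicator ?R x * f x\<bar> \<partial>?M)"
    by (rule integral_abs_bound)
  also have "\<dots> \<le> (\<integral>x. \<bar>C\<bar> * indicator (cube b e X) x \<partial>?M)"
    using i int le by (intro integral_mono) auto
  also have "\<dots> = C * (2 * X) ^ e"
    using bm \<open>0 \<le> C\<close> \<open>0 \<le> X\<close> by (simp add: measure_def)
  finally show "\<bar>\<integral>x. indicator ?R x * f x \<partial>?M\<bar> \<le> C * (2 * X) ^ e" .
qed

lemma integrable_region_aff_power:
  assumes inj: "inj_on b {1..e}" and bdd: "bdd_region b K e a"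
  shows "integrable (Pi\<^sub>M (b ` {1..e}) (\<lambda>_. lborel))
     (\<lambda>x. indicator (region b K e a fl) x * aff b e l x ^ M)"
proof -
  obtain X0 where X0: "\<forall>x\<in>region b K e a (\<lambda>_. False). \<forall>c\<in>{1..e}. \<bar>x (b c)\<bar> \<le> X0"
    using bdd unfolding bdd_region_def by blast
  let ?X = "max 0 X0"
  have X: "\<bar>x (b c)\<bar> \<le> ?X" if "x \<in> region b K e a fl" "c \<in> {1..e}" for x c
    using X0 that region_mono[of b K e a fl] by fastforce
  show ?thesis
  proof (rule integrable_bdd_region(1)[where X = ?X and C = "(\<bar>l 0\<bar> + (\<Sum>c=1..e. \<bar>l c\<bar> * ?X)) ^ M"])
    show "inj_on b {1..e}" by fact
    show "(\<lambda>x. aff b e l x ^ M) \<in> borel_measurable (Pi\<^sub>M (b ` {1..e}) (\<lambda>_. lborel))"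
      by (intro borel_measurable_power measurable_aff)
    fix x assume x: "x \<in> region b K e a fl"
    then show "\<bar>x (b c)\<bar> \<le> ?X" if "c \<in> {1..e}" for c using X that by blast
    then have "\<bar>aff b e l x\<bar> \<le> \<bar>l 0\<bar> + (\<Sum>c=1..e. \<bar>l c\<bar> * ?X)"
      by (rule abs_aff_le)
    then show "\<bar>aff b e l x ^ M\<bar> \<le> (\<bar>l 0\<bar> + (\<Sum>c=1..e. \<bar>l c\<bar> * ?X)) ^ M"
      unfolding power_abs by (intro power_mono) auto
  qed simp
qed

section \<open>The integral as an iterated sum over facets\<close>

text \<open>Splitting off the last coordinate leaves, for each facet, an integral of the same kind
  with exponent \<open>M + 1\<close>; therefore the induction generalizes over the system, the form
  and the exponent. The factorials telescope: \<open>1 / (M + 1)\<close> times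
  \<open>fact (M + 1) / fact (M + 1 + e)\<close> is \<open>fact M / fact (M + 1 + e)\<close>. Every
  branch with nonzero pivot inherits a nonzero denominator, since \<open>den\<close> is a product
  over these branches.\<close>

theorem integral_aff_power:
  fixes b :: "nat \<Rightarrow> 'i"
  assumes "inj_on b {1..e}" "bdd_region b K e a" "den K e a l M \<noteq> 0"
  shows "(\<integral>x. indicator (region b K e a fl) x * aff b e l x ^ M \<partial>(Pi\<^sub>M (b ` {1..e}) (\<lambda>_. lborel)))
    = fact M / fact (M + e) * (num K e a fl l M / den K e a l M)"
  using assms
proof (induction e arbitrary: a fl l M)
  case 0
  have r: "indicator (region b K 0 a fl) x = (if \<forall>i<K. a i 0 + of_bool (fl i) \<le> 0 then 1 else 0 :: real)" for x
  proof -
    have "(\<forall>i<K. if fl i then real_of_int (a i 0) < 0 else real_of_int (a i 0) \<le> 0)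
       \<longleftrightarrow> (\<forall>i<K. a i 0 + of_bool (fl i) \<le> 0)"
      by (intro all_cong) auto
    moreover have "aff b 0 g x = g 0" for g by (simp add: aff_def)
    ultimately have "x \<in> region b K 0 a fl \<longleftrightarrow> (\<forall>i<K. a i 0 + of_bool (fl i) \<le> 0)"
      unfolding region_def mem_Collect_eq by (simp only:)
    then show ?thesis by (auto simp: indicator_def)
  qed
  show ?case
  proof (cases "\<forall>i<K. a i 0 + of_bool (fl i) \<le> 0")
    case True
    show ?thesis unfolding r num.simps if_P[OF True]
      by (simp add: aff_def PiM_empty lebesgue_integral_count_space_finite)
  next
    case False
    show ?thesis unfolding r num.simps if_not_P[OF False] by simp
  qed
next
  case (Suc e)
  interpret product_sigma_finite "\<lambda>_ :: 'i. lborel :: real measure"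
    by (simp add: product_sigma_finite_def sigma_finite_lborel)
  have inj: "inj_on b {1..e}" using Suc.prems(1) by (rule inj_on_subset) auto
  let ?M = "Pi\<^sub>M (b ` {1..e}) (\<lambda>_. lborel :: real measure)"
  have ins: "b ` {1..Suc e} = insert (b (Suc e)) (b ` {1..e})" by (auto simp: atLeastAtMostSuc_conv)
  have notin: "b (Suc e) \<notin> b ` {1..e}"
    using inj_onD[OF Suc.prems(1), of "Suc e"] by fastforce
  let ?d = "den_factor K e a l M"
  let ?n = "\<lambda>j. num K e (\<lambda>i. pivot a (Suc e) j (a i)) (tie a (Suc e) j fl) (pivot a (Suc e) j l) (Suc M)"
  have d: "?d j \<noteq> 0" if "j < K" for j
    using Suc.prems(3) that by (simp add: den_Suc)
  have dval: "?d j = l (Suc e) * of_int (a j (Suc e)) ^ (2 * Suc M) *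
     den K e (\<lambda>i. pivot a (Suc e) j (a i)) (pivot a (Suc e) j l) (Suc M)" if "a j (Suc e) \<noteq> 0" for j
    using that by (simp add: den_factor_def)
  have l: "l (Suc e) \<noteq> 0" if "j < K" "a j (Suc e) \<noteq> 0" for j
    using d[OF that(1)] dval[OF that(2)] by auto
  let ?k = "\<lambda>j. of_int (sgn (a j (Suc e))) / (real (Suc M) * l (Suc e) * of_int (a j (Suc e)) ^ (2 * Suc M))"
  let ?f = "\<lambda>j x. indicator (region b K e (\<lambda>i. pivot a (Suc e) j (a i)) (tie a (Suc e) j fl)) x *
        aff b e (pivot a (Suc e) j l) x ^ Suc M"
  have int: "integrable ?M (\<lambda>x. ?k j * ?f j x)" if "j < K" for j
  proof (cases "a j (Suc e) = 0")
    case False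
    show ?thesis
      by (intro integrable_mult_right integrable_region_aff_power inj
          bdd_region_pivot[OF Suc.prems(1,2) that False])
  qed simp
  have "(\<integral>x. indicator (region b K (Suc e) a fl) x * aff b (Suc e) l x ^ M \<partial>(Pi\<^sub>M (b ` {1..Suc e}) (\<lambda>_. lborel)))
    = (\<integral>x. (\<integral>t. indicator (region b K (Suc e) a fl) (x(b (Suc e) := t)) *
       aff b (Suc e) l (x(b (Suc e) := t)) ^ M \<partial>lborel) \<partial>?M)"
    using integrable_region_aff_power[OF Suc.prems(1,2), of fl l M] notin unfolding ins
    by (intro product_integral_insert) auto
  also have "\<dots> = (\<integral>x. (\<Sum>j<K. ?k j * ?f j x) \<partial>?M)"
    by (intro Bochner_Integration.integral_cong refl fiber_integral_pivot[OF Suc.prems(1,2)] l)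
  also have "\<dots> = (\<Sum>j<K. (\<integral>x. ?k j * ?f j x \<partial>?M))"
    using int by (intro Bochner_Integration.integral_sum) auto
  also have "\<dots> = (\<Sum>j<K. fact M / fact (M + Suc e) * (of_int (sgn (a j (Suc e))) * ?n j / ?d j))"
  proof (rule sum.cong[OF refl])
    fix j assume "j \<in> {..<K}"
    then have j: "j < K" by simp
    show "(\<integral>x. ?k j * ?f j x \<partial>?M) = fact M / fact (M + Suc e) * (of_int (sgn (a j (Suc e))) * ?n j / ?d j)"
    proof (cases "a j (Suc e) = 0")
      case False
      let ?D = "den K e (\<lambda>i. pivot a (Suc e) j (a i)) (pivot a (Suc e) j l) (Suc M)"
      have D: "?D \<noteq> 0" using d[OF j] dval[OF False] by auto
      have "(\<integral>x. ?f j x \<partial>?M) = fact (Suc M) / fact (Suc M + e) * (?n j / ?D)"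
        by (rule Suc.IH[OF inj bdd_region_pivot[OF Suc.prems(1,2) j False] D])
      then have "(\<integral>x. ?k j * ?f j x \<partial>?M) = ?k j * (fact (Suc M) / fact (Suc M + e) * (?n j / ?D))"
        by (simp only: integral_mult_right_zero)
      also have "\<dots> = fact M / fact (M + Suc e) * (of_int (sgn (a j (Suc e))) * ?n j / ?d j)"
      proof -
        have "\<sigma> / (m * v * q) * (m * f / g * (n / D)) = f / g * (\<sigma> * n / (v * q * D))"
          if "m \<noteq> 0" for \<sigma> m v q f g n D :: real
          using that by (simp add: field_simps)
        from this[of "real (Suc M)"] show ?thesis
          unfolding dval[OF False] fact_Suc add_Suc add_Suc_right by (simp only: of_nat_eq_0_iff)
      qed
      finally show ?thesis .
    qed simp
  qed
  also have "\<dots> = fact M / fact (M + Suc e) * (num K (Suc e) a fl l M / den K (Suc e) a l M)"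
  proof -
    have "(\<Sum>j<K. of_int (sgn (a j (Suc e))) * ?n j / ?d j)
       = (\<Sum>j<K. of_int (sgn (a j (Suc e))) * ?n j * (\<Prod>i\<in>{..<K} - {j}. ?d i) / (\<Prod>i<K. ?d i))"
    proof (rule sum.cong[OF refl])
      fix j assume j: "j \<in> {..<K}"
      have "(\<Prod>i<K. ?d i) = ?d j * (\<Prod>i\<in>{..<K} - {j}. ?d i)"
        by (rule prod.remove) (use j in auto)
      moreover have "(\<Prod>i\<in>{..<K} - {j}. ?d i) \<noteq> 0" using d by simp
      ultimately show "of_int (sgn (a j (Suc e))) * ?n j / ?d j
         = of_int (sgn (a j (Suc e))) * ?n j * (\<Prod>i\<in>{..<K} - {j}. ?d i) / (\<Prod>i<K. ?d i)"
        by simp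
    qed
    then show ?thesis
      by (simp only: den_Suc num.simps sum_divide_distrib[symmetric] sum_distrib_left[symmetric])
  qed
  finally show ?case .
qed

section \<open>Explicit bounds for the coordinates\<close>

lemma int_cube_bound: "2 * H ^ 3 \<ge> (H :: int)" if "1 \<le> H"
proof -
  have "H * 1 \<le> H * H\<^sup>2" using that by (intro mult_left_mono) auto
  then show ?thesis using that by (simp add: power3_eq_cube power2_eq_square algebra_simps)
qed

lemma abs_pivot_le:
  fixes H :: int
  assumes "\<bar>p\<bar> \<le> H" "\<bar>x\<bar> \<le> H" "\<bar>y\<bar> \<le> H" "\<bar>z\<bar> \<le> H"
  shows "\<bar>p * (p * x - y * z)\<bar> \<le> 2 * H ^ 3"
proof -
  have "\<bar>p * x - y * z\<bar> \<le> \<bar>p * x\<bar> + \<bar>y * z\<bar>" by (rule abs_triangle_ineq4)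
  also have "\<dots> \<le> H * H + H * H"
    unfolding abs_mult using assms by (intro add_mono mult_mono) auto
  finally have "\<bar>p * (p * x - y * z)\<bar> \<le> H * (H * H + H * H)"
    unfolding abs_mult using assms by (intro mult_mono) auto
  then show ?thesis by (simp add: power3_eq_cube)
qed

text \<open>The last coordinate lies between endpoints \<open>- g i / p i\<close> with
  \<open>\<bar>p i\<bar> \<ge> 1\<close>. Here \<open>g i\<close> has coefficients up to
  \<open>H\<close> and is evaluated at the other \<open>e\<close> coordinates, which satisfy an
  eliminated system with entries up to \<open>2 * H ^ 3\<close>.\<close>

fun coord_bound :: "nat \<Rightarrow> int \<Rightarrow> int" where
  "coord_bound 0 H = 0"
| "coord_bound (Suc e) H = H * (1 + int e * coord_bound e (2 * H ^ 3))"

lemma coord_bound_nonneg: "1 \<le> H \<Longrightarrow> 0 \<le> coord_bound e H"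
proof (induction e arbitrary: H)
  case (Suc e)
  have "0 \<le> coord_bound e (2 * H ^ 3)"
    using Suc.IH[of "2 * H ^ 3"] int_cube_bound[of H] Suc.prems by linarith
  then show ?case using Suc.prems by simp
qed simp

lemma coord_bound_step: "1 \<le> H \<Longrightarrow> 0 < e \<Longrightarrow> coord_bound e (2 * H ^ 3) \<le> coord_bound (Suc e) H"
proof -
  assume H: "1 \<le> H" and e: "0 < e"
  let ?c = "coord_bound e (2 * H ^ 3)"
  have c: "0 \<le> ?c" using coord_bound_nonneg[of "2 * H ^ 3" e] int_cube_bound[of H] H by linarith
  have "1 * ?c \<le> int e * ?c" using e c by (intro mult_right_mono) auto
  then have "?c \<le> 1 * (1 + int e * ?c)" by simp
  also have "\<dots> \<le> H * (1 + int e * ?c)" using H c by (intro mult_right_mono) auto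
  finally show ?thesis by simp
qed

text \<open>Moving \<open>x\<close> along the last axis until it leaves the polyhedron leads to a point on a facet, whose
  projection satisfies the eliminated system.\<close>

theorem abs_coord_le:
  fixes b :: "nat \<Rightarrow> 'i"
  assumes "inj_on b {1..e}" "bdd_region b K e a" "1 \<le> H"
    and "\<And>i c. i < K \<Longrightarrow> c \<le> e \<Longrightarrow> \<bar>a i c\<bar> \<le> H"
    and "x \<in> region b K e a (\<lambda>_. False)" "c \<in> {1..e}"
  shows "\<bar>x (b c)\<bar> \<le> coord_bound e H"
  using assms
proof (induction e arbitrary: a H c)
  case (Suc e)
  have inj: "inj_on b {1..e}" using Suc.prems(1) by (rule inj_on_subset) auto
  let ?g = "\<lambda>i. aff b e (\<lambda>c. of_int (a i c)) x" and ?p = "\<lambda>i. real_of_int (a i (Suc e))"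
  define t where "t = x (b (Suc e))"
  define \<tau> where "\<tau> i = - ?g i / ?p i" for i
  have x: "?p i * t + ?g i \<le> 0" if "i < K" for i
    using Suc.prems(5) region_upd_iff[OF Suc.prems(1), of x "x (b (Suc e))" K a "\<lambda>_. False"] that
    by (simp add: t_def)
  have g: "?g i = - ?p i * \<tau> i" if "a i (Suc e) \<noteq> 0" for i
    using that by (simp add: \<tau>_def)
  let ?H = "2 * H ^ 3"
  have H1: "1 \<le> ?H" using int_cube_bound[OF Suc.prems(3)] Suc.prems(3) by linarith
  have ex: "(\<exists>i<K. a i (Suc e) > 0) \<and> (\<exists>i<K. a i (Suc e) < 0)"
  proof (rule bdd_region_fiber[OF Suc.prems(1,2)])
    fix i assume "i < K" "a i (Suc e) = 0"
    then show "?g i \<le> 0" using x[of i] by simp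
  qed
  define U where "U = {i. i < K \<and> a i (Suc e) > 0}"
  define L where "L = {i. i < K \<and> a i (Suc e) < 0}"
  have fin: "finite U" "finite L" and ne: "U \<noteq> {}" "L \<noteq> {}" using ex by (auto simp: U_def L_def)
  obtain j where j: "j \<in> U" "\<And>i. i \<in> U \<Longrightarrow> \<tau> j \<le> \<tau> i"
    using arg_min_if_finite[OF fin(1) ne(1), of \<tau>] by (meson not_le)
  obtain m where m: "m \<in> L" using ne by blast
  have j': "j < K" "a j (Suc e) > 0" and m': "m < K" "a m (Suc e) < 0"
    using j m by (auto simp: U_def L_def)
  have tU: "t \<le> \<tau> i" if "i \<in> U" for i
  proof -
    have "?p i * (t - \<tau> i) \<le> 0" using x[of i] g[of i] that by (auto simp: U_def algebra_simps)
    then show ?thesis using that by (auto simp: U_def mult_le_0_iff)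
  qed
  have tL: "\<tau> i \<le> t" if "i \<in> L" for i
  proof -
    have "?p i * (t - \<tau> i) \<le> 0" using x[of i] g[of i] that by (auto simp: L_def algebra_simps)
    then show ?thesis using that by (auto simp: L_def mult_le_0_iff)
  qed
  have xj: "x \<in> region b K e (\<lambda>i. pivot a (Suc e) j (a i)) (\<lambda>_. False)"
  proof -
    have "?p j * (?p j * ?g i - ?p i * ?g j) \<le> 0" if i: "i < K" for i
    proof -
      \<comment> \<open>When the last coordinate is raised from \<open>t\<close> to
        \<open>\<tau> j\<close>, rows with nonpositive coefficient stay satisfied, and rows with
        positive coefficient are satisfied because \<open>\<tau> j\<close> is the least upper
        endpoint.\<close>
      have "?p i * (\<tau> j - t) \<le> 0 \<or> ?p i * (\<tau> j - \<tau> i) \<le> 0 \<and> a i (Suc e) \<noteq> 0"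
      proof (cases "a i (Suc e) > 0")
        case True
        then have "\<tau> j \<le> \<tau> i" using j(2)[of i] i by (simp add: U_def)
        then show ?thesis using True by (simp add: mult_le_0_iff)
      next
        case False
        then show ?thesis using tU[OF j(1)] by (simp add: mult_le_0_iff)
      qed
      then have "?g i + ?p i * \<tau> j \<le> 0"
      proof
        assume "?p i * (\<tau> j - t) \<le> 0"
        then show ?thesis using x[OF i] by (simp add: algebra_simps)
      next
        assume "?p i * (\<tau> j - \<tau> i) \<le> 0 \<and> a i (Suc e) \<noteq> 0"
        then show ?thesis using g[of i] by (simp add: algebra_simps)
      qed
      then have "(?p j * ?p j) * (?g i + ?p i * \<tau> j) \<le> 0"
        using zero_le_square[of "?p j"] by (rule mult_nonneg_nonpos[rotated])
      moreover have "?p j * (?p j * ?g i - ?p i * ?g j) = (?p j * ?p j) * (?g i + ?p i * \<tau> j)"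
        using j'(2) by (simp add: \<tau>_def field_simps)
      ultimately show ?thesis by (simp only:)
    qed
    then show ?thesis unfolding region_def by (simp add: aff_of_int_pivot)
  qed
  have IH: "\<bar>x (b c)\<bar> \<le> coord_bound e ?H" if "c \<in> {1..e}" for c
  proof (rule Suc.IH[OF inj bdd_region_pivot[OF Suc.prems(1,2) j'(1)] H1 _ xj that])
    show "a j (Suc e) \<noteq> 0" using j'(2) by simp
    fix i c assume "i < K" "c \<le> e"
    then show "\<bar>pivot a (Suc e) j (a i) c\<bar> \<le> ?H"
      unfolding pivot_def using j'(1) Suc.prems(4) by (auto intro!: abs_pivot_le)
  qed
  let ?B = "H * (1 + int e * coord_bound e ?H)"
  have gB: "\<bar>?g i\<bar> \<le> ?B" if "i < K" for i
  proof -
    have "\<bar>?g i\<bar> \<le> \<bar>real_of_int (a i 0)\<bar> + (\<Sum>c=1..e. \<bar>real_of_int (a i c)\<bar> * coord_bound e ?H)"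
      by (rule abs_aff_le) (rule IH)
    also have "\<dots> \<le> of_int H + (\<Sum>c=1..e. of_int H * of_int (coord_bound e ?H))"
    proof (intro add_mono sum_mono mult_right_mono)
      show "\<bar>real_of_int (a i 0)\<bar> \<le> of_int H" using Suc.prems(4)[OF that, of 0] by linarith
      show "\<bar>real_of_int (a i c)\<bar> \<le> of_int H" if "c \<in> {1..e}" for c
        using Suc.prems(4)[OF \<open>i < K\<close>, of c] that by simp
      show "0 \<le> real_of_int (coord_bound e ?H)" using coord_bound_nonneg[OF H1] by simp
    qed
    also have "\<dots> = ?B" by (simp add: algebra_simps)
    finally show ?thesis .
  qed
  have \<tau>B: "\<bar>\<tau> i\<bar> \<le> ?B" if "i < K" "a i (Suc e) \<noteq> 0" for i
  proof -
    have "1 \<le> \<bar>a i (Suc e)\<bar>" using that(2) by linarith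
    then have "1 \<le> \<bar>?p i\<bar>" by linarith
    then have "\<bar>?g i\<bar> / \<bar>?p i\<bar> \<le> \<bar>?g i\<bar> / 1" by (intro divide_left_mono) auto
    then show ?thesis using gB[OF that(1)] by (simp add: \<tau>_def abs_divide)
  qed
  have "\<bar>t\<bar> \<le> ?B"
    using tU[OF j(1)] tL[OF m] \<tau>B[of j] \<tau>B[of m] j' m' by linarith
  then show ?case
  proof (cases "c = Suc e")
    case False
    then have c: "c \<in> {1..e}" using Suc.prems(6) by auto
    then have "0 < e" by simp
    then have "real_of_int (coord_bound e ?H) \<le> real_of_int (coord_bound (Suc e) H)"
      unfolding of_int_le_iff by (rule coord_bound_step[OF Suc.prems(3)])
    then show ?thesis using IH[OF c] by linarith
  qed (simp add: t_def)
qed simp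

section \<open>The common denominator as a polynomial\<close>

text \<open>The leading coefficient of \<open>den\<close> as a polynomial in \<open>Z\<close>, if
  all coordinate coefficients of the form have leading coefficient \<open>w\<close>; a pivot step
  multiplies it by the square of the pivot. The recursion uses integers only, so the program can
  evaluate it without polynomial arithmetic.\<close>

fun lead :: "nat \<Rightarrow> nat \<Rightarrow> (nat \<Rightarrow> nat \<Rightarrow> int) \<Rightarrow> int \<Rightarrow> nat \<Rightarrow> int" where
  "lead K 0 a w M = 1"
| "lead K (Suc e) a w M = (\<Prod>j<K. if a j (Suc e) = 0 then 1 else
     w * a j (Suc e) ^ (2 * Suc M) * lead K e (\<lambda>i. pivot a (Suc e) j (a i)) ((a j (Suc e))\<^sup>2 * w) (Suc M))"

text \<open>All pivots occur in even powers.\<close>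

lemma lead_pos: "0 < w \<Longrightarrow> 0 < lead K e a w M"
proof (induction e arbitrary: a w M)
  case (Suc e)
  have "0 < (if a j (Suc e) = 0 then 1 else w * a j (Suc e) ^ (2 * Suc M) *
      lead K e (\<lambda>i. pivot a (Suc e) j (a i)) ((a j (Suc e))\<^sup>2 * w) (Suc M))" for j
  proof (cases "a j (Suc e) = 0")
    case False
    then have "0 < (a j (Suc e))\<^sup>2" by simp
    then have "0 < (a j (Suc e))\<^sup>2 ^ Suc M" by (rule zero_less_power)
    then have "0 < a j (Suc e) ^ (2 * Suc M)" by (simp only: power_mult)
    moreover have "0 < (a j (Suc e))\<^sup>2 * w" using False Suc.prems by simp
    ultimately show ?thesis using False Suc.IH Suc.prems by simp
  qed simp
  then show ?case by (simp only: lead.simps) (rule prod_pos, blast)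
qed simp

text \<open>The subtracted multiple of \<open>L e\<close> has smaller degree, so the leading term
  only picks up the square of the pivot. Coordinates must therefore be eliminated in the order of
  increasing degree.\<close>

lemma lead_coeff_pivot:
  fixes L :: "nat \<Rightarrow> int poly"
  assumes "degree (L e) < degree (L c)" "a j e \<noteq> 0"
  shows "degree (pivot a e j L c) = degree (L c)"
    and "lead_coeff (pivot a e j L c) = (a j e)\<^sup>2 * lead_coeff (L c)"
proof -
  have eq: "pivot a e j L c = smult ((a j e)\<^sup>2) (L c) + smult (- (a j e * a j c)) (L e)"
    by (simp add: pivot_def of_int_poly algebra_simps power2_eq_square)
  have d: "degree (smult (- (a j e * a j c)) (L e)) < degree (smult ((a j e)\<^sup>2) (L c))"
    using assms degree_smult_le[of "- (a j e * a j c)" "L e"] by simp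
  show "degree (pivot a e j L c) = degree (L c)"
    unfolding eq degree_add_eq_left[OF d] using assms(2) by simp
  have "lead_coeff (pivot a e j L c) = lead_coeff (smult ((a j e)\<^sup>2) (L c))"
    unfolding eq using lead_coeff_add_le[OF d] by (simp only: add.commute)
  then show "lead_coeff (pivot a e j L c) = (a j e)\<^sup>2 * lead_coeff (L c)" by (simp only: lead_coeff_smult)
qed

lemma lead_coeff_den:
  fixes L :: "nat \<Rightarrow> int poly"
  assumes "\<And>c. c \<in> {1..e} \<Longrightarrow> degree (L c) = \<delta> c" "\<And>c. c \<in> {1..e} \<Longrightarrow> lead_coeff (L c) = w"
    and "\<And>c c'. 1 \<le> c \<Longrightarrow> c < c' \<Longrightarrow> c' \<le> e \<Longrightarrow> \<delta> c' < \<delta> c"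
  shows "lead_coeff (den K e a L M) = lead K e a w M"
  using assms
proof (induction e arbitrary: a L w M)
  case (Suc e)
  have "lead_coeff (den_factor K e a L M j) = (if a j (Suc e) = 0 then 1 else
     w * a j (Suc e) ^ (2 * Suc M) * lead K e (\<lambda>i. pivot a (Suc e) j (a i)) ((a j (Suc e))\<^sup>2 * w) (Suc M))" for j
  proof (cases "a j (Suc e) = 0")
    case False
    have dl: "degree (L (Suc e)) < degree (L c)" if "c \<in> {1..e}" for c
      using Suc.prems(1)[of "Suc e"] Suc.prems(1)[of c] Suc.prems(3)[of c "Suc e"] that by simp
    have "lead_coeff (den K e (\<lambda>i. pivot a (Suc e) j (a i)) (pivot a (Suc e) j L) (Suc M)) =
       lead K e (\<lambda>i. pivot a (Suc e) j (a i)) ((a j (Suc e))\<^sup>2 * w) (Suc M)"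
    proof (rule Suc.IH)
      fix c assume c: "c \<in> {1..e}"
      show "degree (pivot a (Suc e) j L c) = \<delta> c"
        using lead_coeff_pivot(1)[where L = L and c = c and e = "Suc e" and a = a and j = j, OF dl[OF c] False] Suc.prems(1)[of c] c by simp
      show "lead_coeff (pivot a (Suc e) j L c) = (a j (Suc e))\<^sup>2 * w"
        using lead_coeff_pivot(2)[where L = L and c = c and e = "Suc e" and a = a and j = j, OF dl[OF c] False] Suc.prems(2)[of c] c by simp
    next
      fix c c' assume "1 \<le> c" "c < c'" "c' \<le> e"
      then show "\<delta> c' < \<delta> c" using Suc.prems(3) by simp
    qed
    moreover have "lead_coeff (L (Suc e)) = w" using Suc.prems(2) by simp
    moreover have "lead_coeff ((of_int (a j (Suc e)) :: int poly) ^ n) = a j (Suc e) ^ n" for n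
      by (simp only: lead_coeff_power lead_coeff_of_int of_int_eq_id id_apply)
    ultimately show ?thesis
      using False unfolding den_factor_def by (simp only: lead_coeff_mult if_False)
  qed (simp add: den_factor_def)
  then show ?case by (simp only: den_Suc lead_coeff_prod lead.simps)
qed simp

section \<open>Positivity of the denominator at large integers\<close>

text \<open>By \<open>abs_pivot_le\<close>, one elimination turns a bound \<open>H\<close> into
  \<open>2 * H ^ 3\<close>.\<close>

fun entry_bound :: "nat \<Rightarrow> int \<Rightarrow> int" where
  "entry_bound 0 H = H"
| "entry_bound (Suc e) H = entry_bound e (2 * H ^ 3)"

lemma entry_bound_ge: "1 \<le> H \<Longrightarrow> H \<le> entry_bound e H"
proof (induction e arbitrary: H)
  case (Suc e)
  have "1 \<le> 2 * H ^ 3" using int_cube_bound[OF Suc.prems] Suc.prems by linarith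
  from Suc.IH[OF this] show ?case using int_cube_bound[OF Suc.prems] by simp
qed simp

text \<open>Cauchy's root bound: the leading coefficient is at least \<open>1\<close>, and the lower
  terms amount to at most \<open>H * (Z ^ n - 1) / (Z - 1)\<close>, which is less than
  \<open>Z ^ n\<close> for the degree \<open>n\<close>.\<close>

lemma poly_pos_of_coeff_bound:
  fixes p :: "int poly"
  assumes "lead_coeff p > 0" "\<And>i. \<bar>coeff p i\<bar> \<le> H" "H + 1 \<le> Z"
  shows "poly p Z > 0"
proof -
  let ?n = "degree p"
  have H: "0 \<le> H" using assms(2)[of 0] by linarith
  have geo: "(Z - 1) * (\<Sum>i<?n. Z ^ i) = Z ^ ?n - 1"
    by (rule power_diff_1_eq[symmetric])
  have "- (\<Sum>i<?n. coeff p i * Z ^ i) \<le> (\<Sum>i<?n. H * Z ^ i)"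
    unfolding sum_negf[symmetric]
  proof (rule sum_mono)
    fix i
    have "- coeff p i * Z ^ i \<le> H * Z ^ i"
      using assms(2)[of i] assms(3) H by (intro mult_right_mono) auto
    then show "- (coeff p i * Z ^ i) \<le> H * Z ^ i" by simp
  qed
  also have "\<dots> \<le> (Z - 1) * (\<Sum>i<?n. Z ^ i)"
    unfolding sum_distrib_left[symmetric] using assms(3) H by (intro mult_right_mono sum_nonneg) auto
  also have "\<dots> < 1 * Z ^ ?n" unfolding geo by simp
  also have "\<dots> \<le> lead_coeff p * Z ^ ?n"
    using assms H by (intro mult_right_mono) auto
  finally have "0 < (\<Sum>i<?n. coeff p i * Z ^ i) + lead_coeff p * Z ^ ?n" by linarith
  also have "\<dots> = poly p Z" unfolding poly_altdef by (simp flip: lessThan_Suc_atMost)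
  finally show ?thesis .
qed

lemma poly_pivot: "poly (pivot a e j L c) z = pivot a e j (\<lambda>c. poly (L c) z) c"
  by (simp add: pivot_def)

text \<open>\<open>den\<close> is built from the form by ring operations alone, so it commutes with
  evaluation. The same reason covers \<open>num\<close> and the embedding of the integers.\<close>

lemma poly_den: "poly (den K e a L M) z = den K e a (\<lambda>c. poly (L c) z) M"
proof (induction e arbitrary: a L M)
  case (Suc e)
  have "poly (den_factor K e a L M j) z = den_factor K e a (\<lambda>c. poly (L c) z) M j" for j
    by (simp add: den_factor_def Suc.IH poly_pivot[abs_def])
  then show ?case by (simp add: den_Suc poly_prod)
qed simp

lemma poly_den_factor: "poly (den_factor K e a L M j) z = den_factor K e a (\<lambda>c. poly (L c) z) M j"
  by (simp add: den_factor_def poly_den poly_pivot[abs_def])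

lemma poly_num: "poly (num K e a fl L M) z = num K e a fl (\<lambda>c. poly (L c) z) M"
proof (induction e arbitrary: a fl L M)
  case (Suc e)
  then show ?case by (simp add: poly_sum poly_prod poly_den_factor poly_pivot[abs_def])
next
  case 0
  show ?case
    by (cases "\<forall>i<K. a i 0 + of_bool (fl i) \<le> 0") (simp_all only: num.simps if_P if_not_P if_False if_True poly_power poly_0)
qed

lemma of_int_den: "(of_int (den K e a l M) :: 'r::comm_ring_1) = den K e a (\<lambda>c. of_int (l c)) M"
proof (induction e arbitrary: a l M)
  case (Suc e)
  have "(of_int (den_factor K e a l M j) :: 'r) = den_factor K e a (\<lambda>c. of_int (l c)) M j" for j
    by (simp add: den_factor_def Suc.IH of_int_pivot[abs_def])
  then show ?case by (simp add: den_Suc)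
qed simp

lemma of_int_den_factor: "of_int (den_factor K e a l M j) = den_factor K e a (\<lambda>c. of_int (l c)) M j"
  by (simp add: den_factor_def of_int_den of_int_pivot[abs_def])

lemma of_int_num: "of_int (num K e a fl l M) = num K e a fl (\<lambda>c. of_int (l c)) M"
proof (induction e arbitrary: a fl l M)
  case (Suc e)
  then show ?case by (simp add: of_int_den_factor of_int_pivot[abs_def])
next
  case 0
  show ?case
    by (cases "\<forall>i<K. a i 0 + of_bool (fl i) \<le> 0") (simp_all only: num.simps if_P if_not_P if_False if_True of_int_power of_int_0)
qed

text \<open>Throughout the eliminations the coordinate coefficients remain polynomials with positive
  leading coefficient and with coefficients within \<open>entry_bound\<close>, so Cauchy's bound
  makes them positive at \<open>Z\<close>. The remaining factors are even powers of nonzero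
  pivots.\<close>

lemma den_factor_pos:
  fixes L :: "nat \<Rightarrow> int poly"
  assumes "\<And>c. c \<in> {1..Suc e} \<Longrightarrow> degree (L c) = \<delta> c" "\<And>c. c \<in> {1..Suc e} \<Longrightarrow> lead_coeff (L c) = w"
    and "\<And>c c'. 1 \<le> c \<Longrightarrow> c < c' \<Longrightarrow> c' \<le> Suc e \<Longrightarrow> \<delta> c' < \<delta> c"
    and "\<And>i c. i < K \<Longrightarrow> c \<le> Suc e \<Longrightarrow> \<bar>a i c\<bar> \<le> H"
    and "\<And>c i. c \<in> {1..Suc e} \<Longrightarrow> \<bar>coeff (L c) i\<bar> \<le> H"
    and "0 < w" "1 \<le> H" "entry_bound (Suc e) H + 1 \<le> Z" "j < K"
  shows "0 < den_factor K e a (\<lambda>c. poly (L c) Z) M j"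
  using assms
proof (induction e arbitrary: a L w M H j)
  have base: "0 < poly (L (Suc e)) Z"
    if "lead_coeff (L (Suc e)) = w" "0 < w" "\<And>i. \<bar>coeff (L (Suc e)) i\<bar> \<le> H"
      "1 \<le> H" "entry_bound (Suc e) H + 1 \<le> Z" for L :: "nat \<Rightarrow> int poly" and e w H
    using poly_pos_of_coeff_bound[of "L (Suc e)" H Z] entry_bound_ge[of H "Suc e"] that by auto
  have pw: "0 < (x :: int) ^ (2 * Suc M)" if "x \<noteq> 0" for x M
  proof -
    have "0 < x\<^sup>2" using that by simp
    then have "0 < (x\<^sup>2) ^ Suc M" by (rule zero_less_power)
    then show ?thesis by (simp only: power_mult)
  qed
  {
    case 0
    have "0 < poly (L (Suc 0)) Z" by (rule base[OF 0(2) 0(6) 0(5) 0(7,8)]) auto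
    then show ?case using pw[of "a j (Suc 0)" M] by (simp add: den_factor_def)
  next
    case (Suc e)
    have pos: "0 < poly (L (Suc (Suc e))) Z"
      by (rule base[OF Suc.prems(2) Suc.prems(6) Suc.prems(5) Suc.prems(7,8)]) auto
    show ?case
    proof (cases "a j (Suc (Suc e)) = 0")
      case False
      let ?a = "\<lambda>i. pivot a (Suc (Suc e)) j (a i)" and ?L = "pivot a (Suc (Suc e)) j L"
      have dl: "degree (L (Suc (Suc e))) < degree (L c)" if "c \<in> {1..Suc e}" for c
        using Suc.prems(1)[of "Suc (Suc e)"] Suc.prems(1)[of c] Suc.prems(3)[of c "Suc (Suc e)"] that by simp
      have H1: "1 \<le> 2 * H ^ 3" using int_cube_bound[OF Suc.prems(7)] Suc.prems(7) by linarith
      have "0 < den_factor K e ?a (\<lambda>c. poly (?L c) Z) (Suc M) i" if "i < K" for i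
      proof (rule Suc.IH[where w = "(a j (Suc (Suc e)))\<^sup>2 * w" and H = "2 * H ^ 3"])
        fix c assume c: "c \<in> {1..Suc e}"
        show "degree (?L c) = \<delta> c"
          using lead_coeff_pivot(1)[where L = L and c = c and e = "Suc (Suc e)" and a = a and j = j, OF dl[OF c] False] Suc.prems(1)[of c] c by simp
        show "lead_coeff (?L c) = (a j (Suc (Suc e)))\<^sup>2 * w"
          using lead_coeff_pivot(2)[where L = L and c = c and e = "Suc (Suc e)" and a = a and j = j, OF dl[OF c] False] Suc.prems(2)[of c] c by simp
        fix i
        have "coeff (?L c) i = a j (Suc (Suc e)) *
            (a j (Suc (Suc e)) * coeff (L c) i - coeff (L (Suc (Suc e))) i * a j c)"
          by (simp add: pivot_def of_int_poly algebra_simps)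
        then show "\<bar>coeff (?L c) i\<bar> \<le> 2 * H ^ 3"
          using abs_pivot_le[of "a j (Suc (Suc e))" H "coeff (L c) i" "coeff (L (Suc (Suc e))) i" "a j c"]
            Suc.prems(4,5) \<open>j < K\<close> c by simp
      next
        fix c c' assume "1 \<le> c" "c < c'" "c' \<le> Suc e"
        then show "\<delta> c' < \<delta> c" using Suc.prems(3) by simp
      next
        fix i c assume "i < K" "c \<le> Suc e"
        then show "\<bar>?a i c\<bar> \<le> 2 * H ^ 3"
          unfolding pivot_def using \<open>j < K\<close> Suc.prems(4) by (auto intro!: abs_pivot_le)
      next
        show "0 < (a j (Suc (Suc e)))\<^sup>2 * w" using False Suc.prems(6) by simp
        show "entry_bound (Suc e) (2 * H ^ 3) + 1 \<le> Z" using Suc.prems(8) by simp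
      qed (use H1 that in auto)
      then have "0 < den K (Suc e) ?a (\<lambda>c. poly (?L c) Z) (Suc M)"
        unfolding den_Suc by (intro prod_pos) auto
      moreover have "(\<lambda>c. poly (?L c) Z) = pivot a (Suc (Suc e)) j (\<lambda>c. poly (L c) Z)"
        by (rule ext) (rule poly_pivot)
      ultimately show ?thesis
        using pos pw[OF False, of M] False unfolding den_factor_def by simp
    qed (simp add: den_factor_def)
  }
qed

section \<open>Kronecker substitution\<close>

definition kron :: "nat \<Rightarrow> nat \<Rightarrow> (nat \<Rightarrow> 'r::comm_semiring_1) \<Rightarrow> 'r poly" where
  "kron K n f = (\<Sum>i<n. monom (f i) (K ^ i))"

text \<open>Fewer than \<open>K\<close> copies of the highest exponent \<open>K ^ (n - 1)\<close>
  cannot carry into digit \<open>n\<close>.\<close>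

lemma degree_kron_power:
  assumes "M < K"
  shows "degree (kron K n f ^ M) < K ^ n"
proof (cases n)
  case 0
  then show ?thesis by (cases M) (auto simp: kron_def)
next
  case (Suc n')
  have "degree (kron K n f) \<le> K ^ n'"
    unfolding kron_def
  proof (rule degree_sum_le)
    fix i assume "i \<in> {..<n}"
    then have "K ^ i \<le> K ^ n'" using assms Suc by (intro power_increasing) auto
    then show "degree (monom (f i) (K ^ i)) \<le> K ^ n'" using degree_monom_le order_trans by blast
  qed simp
  then have "degree (kron K n f ^ M) \<le> K ^ n' * M"
    by (meson degree_power_le mult_le_mono1 order_trans)
  also have "\<dots> < K ^ n' * K" using assms by simp
  finally show ?thesis using Suc by (simp add: mult.commute)
qed

lemma sum_digits_less:
  assumes "\<And>i. i < n \<Longrightarrow> m i < (K :: nat)"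
  shows "(\<Sum>i<n. m i * K ^ i) < K ^ n"
  using assms
proof (induction n)
  case (Suc n)
  have "(\<Sum>i<n. m i * K ^ i) + m n * K ^ n < K ^ n + m n * K ^ n" using Suc by simp
  also have "\<dots> = Suc (m n) * K ^ n" by simp
  also have "\<dots> \<le> K * K ^ n" using Suc.prems[of n] by (intro mult_right_mono) auto
  finally show ?case by simp
qed simp

text \<open>The digits of the exponent in base \<open>K\<close> determine the multinomial term, because \<open>M < K\<close>.\<close>

lemma coeff_kron_power:
  fixes f :: "nat \<Rightarrow> real"
  assumes "(\<Sum>i<n. m i) < K"
  shows "coeff (kron K n f ^ (\<Sum>i<n. m i)) (\<Sum>i<n. m i * K ^ i) * (\<Prod>i<n. fact (m i))
    = fact (\<Sum>i<n. m i) * (\<Prod>i<n. f i ^ m i)"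
  using assms
proof (induction n)
  case (Suc n)
  let ?M = "\<Sum>i<Suc n. m i" and ?M' = "\<Sum>i<n. m i"
  let ?k = "\<Sum>i<Suc n. m i * K ^ i" and ?k' = "\<Sum>i<n. m i * K ^ i"
  have mK: "m i < K" if "i < Suc n" for i
  proof -
    have "m i \<le> ?M" using that by (intro member_le_sum) auto
    then show ?thesis using Suc.prems by linarith
  qed
  have k': "?k' < K ^ n" by (rule sum_digits_less) (use mK in auto)
  have M': "?M' < K" using Suc.prems by simp
  have "kron K (Suc n) f ^ ?M = (monom (f n) (K ^ n) + kron K n f) ^ ?M"
    by (simp add: kron_def add.commute)
  also have "\<dots> = (\<Sum>j\<le>?M. of_nat (?M choose j) * monom (f n) (K ^ n) ^ j * kron K n f ^ (?M - j))"
    by (rule binomial_ring)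
  also have "\<dots> = (\<Sum>j\<le>?M. monom (of_nat (?M choose j) * f n ^ j) (K ^ n * j) * kron K n f ^ (?M - j))"
    by (intro sum.cong) (auto simp: monom_power of_nat_poly smult_monom[symmetric] mult.assoc)
  finally have "coeff (kron K (Suc n) f ^ ?M) ?k =
     (\<Sum>j\<le>?M. if ?k < K ^ n * j then 0 else of_nat (?M choose j) * f n ^ j *
        coeff (kron K n f ^ (?M - j)) (?k - K ^ n * j))"
    by (simp only: coeff_sum coeff_monom_mult)
  also have "\<dots> = (\<Sum>j\<le>?M. if j = m n then of_nat (?M choose j) * f n ^ j * coeff (kron K n f ^ ?M') ?k' else 0)"
  proof (rule sum.cong[OF refl])
    fix j assume "j \<in> {..?M}"
    then have j: "j \<le> ?M" by simp
    \<comment> \<open>\<open>j\<close> counts the factors that contribute form \<open>n\<close>. Too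
      many overshoot the exponent; too few leave a remainder beyond the degree of the other
      forms.\<close>
    consider "j = m n" | "m n < j" | "j < m n" by linarith
    then show "(if ?k < K ^ n * j then 0 else of_nat (?M choose j) * f n ^ j *
        coeff (kron K n f ^ (?M - j)) (?k - K ^ n * j)) =
        (if j = m n then of_nat (?M choose j) * f n ^ j * coeff (kron K n f ^ ?M') ?k' else 0)"
    proof cases
      case 1
      then show ?thesis by (simp add: mult.commute)
    next
      case 2
      then have "K ^ n * Suc (m n) \<le> K ^ n * j" by (intro mult_le_mono2) simp
      then have "?k < K ^ n * j" using k' by (simp add: algebra_simps)
      then show ?thesis using 2 by simp
    next
      case 3
      then have "K ^ n * Suc j \<le> K ^ n * m n" by (intro mult_le_mono2) simp
      then have "K ^ n \<le> ?k - K ^ n * j" by (simp add: algebra_simps)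
      moreover have "degree (kron K n f ^ (?M - j)) < K ^ n"
        by (rule degree_kron_power) (use Suc.prems in linarith)
      ultimately have "coeff (kron K n f ^ (?M - j)) (?k - K ^ n * j) = 0"
        by (intro coeff_eq_0) linarith
      then show ?thesis using 3 by simp
    qed
  qed
  also have "\<dots> = of_nat (?M choose m n) * f n ^ m n * coeff (kron K n f ^ ?M') ?k'"
    by simp
  finally have "coeff (kron K (Suc n) f ^ ?M) ?k * (\<Prod>i<Suc n. fact (m i)) =
     of_nat (?M choose m n) * fact (m n) * f n ^ m n * (coeff (kron K n f ^ ?M') ?k' * (\<Prod>i<n. fact (m i)))"
    by simp
  also have "\<dots> = (fact (m n) * fact ?M' * of_nat (?M choose m n)) * (f n ^ m n * (\<Prod>i<n. f i ^ m i))"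
    unfolding Suc.IH[OF M'] by simp
  also have "fact (m n) * fact ?M' * of_nat (?M choose m n) = (fact ?M :: real)"
  proof -
    have "fact (m n) * fact (?M - m n) * (?M choose m n) = fact ?M"
      by (rule binomial_fact_lemma) simp
    then have "real (fact (m n) * fact ?M' * (?M choose m n)) = real (fact ?M)" by simp
    then show ?thesis by (simp only: of_nat_mult of_nat_fact)
  qed
  finally show ?case by simp
qed (simp add: kron_def)

section \<open>Size and measurability of the Kronecker coefficients\<close>

lemma coeff_kron_mult:
  "coeff (kron K n f * p) j = (\<Sum>i<n. if j < K ^ i then 0 else f i * coeff p (j - K ^ i))"
  by (simp add: kron_def sum_distrib_right coeff_sum coeff_monom_mult)

lemma abs_coeff_kron_power_le:
  fixes f :: "nat \<Rightarrow> real"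
  shows "\<bar>coeff (kron K n f ^ M) j\<bar> \<le> (\<Sum>i<n. \<bar>f i\<bar>) ^ M"
proof (induction M arbitrary: j)
  case 0
  then show ?case by (simp add: coeff_1)
next
  case (Suc M)
  have "\<bar>coeff (kron K n f ^ Suc M) j\<bar> \<le>
      (\<Sum>i<n. \<bar>if j < K ^ i then 0 else f i * coeff (kron K n f ^ M) (j - K ^ i)\<bar>)"
    unfolding power_Suc coeff_kron_mult by (rule sum_abs)
  also have "\<dots> \<le> (\<Sum>i<n. \<bar>f i\<bar> * (\<Sum>i<n. \<bar>f i\<bar>) ^ M)"
    using Suc by (intro sum_mono) (auto simp: abs_mult sum_nonneg intro: mult_left_mono)
  finally show ?case by (simp add: sum_distrib_right)
qed

lemma measurable_coeff_kron_power:
  fixes f :: "nat \<Rightarrow> 'x \<Rightarrow> real"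
  assumes "\<And>i. i < n \<Longrightarrow> f i \<in> borel_measurable N"
  shows "(\<lambda>x. coeff (kron K n (\<lambda>i. f i x) ^ M) j) \<in> borel_measurable N"
proof (induction M arbitrary: j)
  case 0
  show ?case by simp
next
  case (Suc M)
  show ?case unfolding power_Suc coeff_kron_mult
  proof (rule borel_measurable_sum)
    fix i assume "i \<in> {..<n}"
    then have "(\<lambda>x. f i x * coeff (kron K n (\<lambda>i. f i x) ^ M) (j - K ^ i)) \<in> borel_measurable N"
      using assms Suc by (intro borel_measurable_times) auto
    then show "(\<lambda>x. if j < K ^ i then 0 else f i x * coeff (kron K n (\<lambda>i. f i x) ^ M) (j - K ^ i))
        \<in> borel_measurable N"
      by simp
  qed
qed

section \<open>Integrality and extraction of a coefficient\<close>

text \<open>By pseudo-division the quotient has rational coefficients, and by Gauss's lemma its denominators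
  divide the content of the divisor.\<close>

lemma quotient_int_poly:
  fixes Q :: "real poly" and S T :: "int poly"
  assumes "Q * map_poly of_int S = map_poly of_int T" "S \<noteq> 0"
  shows "\<exists>C. map_poly of_int C = smult (of_int (lead_coeff S)) Q \<and> C * S = smult (lead_coeff S) T"
proof -
  let ?h = "map_poly real_of_int"
  have h_mult: "?h (p * q) = ?h p * ?h q" for p q
    by (rule poly_eqI) (simp add: coeff_map_poly coeff_mult)
  have h_add: "?h (p + q) = ?h p + ?h q" for p q
    by (rule poly_eqI) (simp add: coeff_map_poly)
  have h_smult: "?h (smult k p) = smult (of_int k) (?h p)" for k p
    by (rule poly_eqI) (simp add: coeff_map_poly)
  have h_deg: "degree (?h p) = degree p" for p
    by (rule degree_map_poly) simp
  have h_inj: "p = q" if "?h p = ?h q" for p q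
  proof (rule poly_eqI)
    fix n show "coeff p n = coeff q n"
      using arg_cong[OF that, of "\<lambda>p. coeff p n"] by (simp add: coeff_map_poly)
  qed
  have S: "?h S \<noteq> 0" using h_inj[of S 0] assms(2) by auto
  obtain A R where AR: "pseudo_divmod T S = (A, R)" by fastforce
  \<comment> \<open>The power of the leading coefficient by which pseudo-division scales
    \<open>T\<close> so that no fractions arise.\<close>
  define E where "E = coeff S (degree S) ^ (Suc (degree T) - degree S)"
  have E: "E \<noteq> 0" using assms(2) by (simp add: E_def)
  have pd: "smult E T = S * A + R" "R = 0 \<or> degree R < degree S"
    using pseudo_divmod[OF assms(2) AR] by (auto simp: E_def)
  let ?q = "smult (of_int E) Q - ?h A"
  have "smult (of_int E) (Q * ?h S) = ?h S * ?h A + ?h R"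
    unfolding assms(1) using arg_cong[OF pd(1), of ?h] by (simp only: h_smult h_mult h_add)
  then have eq: "?q * ?h S = ?h R" by (simp add: algebra_simps)
  \<comment> \<open>A nonzero \<open>?q\<close> would give the remainder at least the degree of
    \<open>S\<close>.\<close>
  have "?q = 0"
  proof (rule ccontr)
    assume q: "?q \<noteq> 0"
    then have "?h R \<noteq> 0" using eq S by (metis mult_eq_0_iff)
    then have "R \<noteq> 0" by auto
    moreover have "degree R = degree ?q + degree S"
      using arg_cong[OF eq, of degree] degree_mult_eq[OF q S] by (simp add: h_deg)
    ultimately show False using pd(2) by simp
  qed
  then have QA: "smult (of_int E) Q = ?h A" by simp
  have "?h (A * S) = ?h (smult E T)" unfolding h_mult h_smult QA[symmetric] assms(1)[symmetric] by simp
  then have AS: "A * S = smult E T" by (rule h_inj)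
  \<comment> \<open>Gauss's lemma: the content is multiplicative. As the content of \<open>S\<close>
    divides its leading coefficient, \<open>E\<close> divides every coefficient of
    \<open>smult (lead_coeff S) A\<close>.\<close>
  have "content A * content S = \<bar>E\<bar> * content T"
    using arg_cong[OF AS, of content] by (simp add: content_mult)
  then have "E dvd content A * content S" by simp
  also have "\<dots> dvd content A * lead_coeff S" by (intro mult_dvd_mono) auto
  also have "\<dots> dvd content (smult (lead_coeff S) A)" by (simp add: mult.commute)
  finally have "[:E:] dvd smult (lead_coeff S) A" by (simp add: const_poly_dvd_iff_dvd_content)
  then obtain C where C: "smult (lead_coeff S) A = smult E C" by (auto simp: dvd_def)
  have "smult (of_int E) (?h C) = smult (of_int E) (smult (of_int (lead_coeff S)) Q)"
    using arg_cong[OF C, of ?h] by (simp add: h_smult QA[symmetric] mult.commute)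
  then have "?h C = smult (of_int (lead_coeff S)) Q"
    using E by (simp add: poly_eq_iff)
  moreover have "smult E (C * S) = smult E (smult (lead_coeff S) T)"
    using arg_cong[OF C, of "\<lambda>p. p * S"] AS by (simp add: mult.commute)
  then have "C * S = smult (lead_coeff S) T"
    using E by (simp add: poly_eq_iff)
  ultimately show ?thesis by blast
qed

section \<open>Reading off a digit by rounding\<close>

lemma poly_low_part_bound:
  fixes C :: "nat \<Rightarrow> int"
  assumes "\<And>j. \<bar>C j\<bar> \<le> B" "2 * B + 2 \<le> Z"
  shows "2 * \<bar>\<Sum>j<k. C j * Z ^ j\<bar> < Z ^ k"
proof -
  have B: "0 \<le> B" using assms(1)[of 0] by linarith
  have "\<bar>\<Sum>j<k. C j * Z ^ j\<bar> \<le> (\<Sum>j<k. B * Z ^ j)"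
    using assms B by (intro order_trans[OF sum_abs] sum_mono) (auto simp: abs_mult intro: mult_right_mono)
  then have "2 * \<bar>\<Sum>j<k. C j * Z ^ j\<bar> \<le> (2 * B) * (\<Sum>j<k. Z ^ j)"
    unfolding sum_distrib_left[symmetric] by linarith
  also have "\<dots> \<le> (Z - 1) * (\<Sum>j<k. Z ^ j)"
    using assms B by (intro mult_right_mono sum_nonneg) auto
  also have "\<dots> = Z ^ k - 1" by (rule power_diff_1_eq[symmetric])
  finally show ?thesis by simp
qed

text \<open>Coefficients may be negative, so plain division would borrow from the higher digits.
  Adding half the divisor first rounds to the nearest integer, which is exact because the lower part
  is less than half of \<open>Z ^ k\<close> in absolute value.\<close>

lemma round_poly:
  fixes C :: "nat \<Rightarrow> int"
  assumes "\<And>j. \<bar>C j\<bar> \<le> B" "2 * B + 2 \<le> Z"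
  shows "(2 * (\<Sum>j<k + n. C j * Z ^ j) + Z ^ k) div (2 * Z ^ k) = (\<Sum>j<n. C (k + j) * Z ^ j)"
proof -
  have "0 \<le> B" using assms(1)[of 0] by linarith
  then have Z: "0 < Z ^ k" using assms(2) by simp
  have "(\<Sum>j<k + n. C j * Z ^ j) = (\<Sum>j<k. C j * Z ^ j) + (\<Sum>j=k..<k + n. C j * Z ^ j)"
    by (simp add: lessThan_atLeast0 sum.atLeastLessThan_concat)
  also have "(\<Sum>j=k..<k + n. C j * Z ^ j) = (\<Sum>j<n. C (k + j) * Z ^ (k + j))"
    by (rule sum.reindex_bij_witness[of _ "\<lambda>j. k + j" "\<lambda>j. j - k"]) auto
  also have "\<dots> = (\<Sum>j<n. C (k + j) * Z ^ j) * Z ^ k"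
    unfolding sum_distrib_right power_add by (simp only: ac_simps)
  finally have eq: "2 * (\<Sum>j<k + n. C j * Z ^ j) + Z ^ k =
     (2 * (\<Sum>j<k. C j * Z ^ j) + Z ^ k) + (\<Sum>j<n. C (k + j) * Z ^ j) * (2 * Z ^ k)"
    by simp
  have "(2 * (\<Sum>j<k. C j * Z ^ j) + Z ^ k) div (2 * Z ^ k) = 0"
    using poly_low_part_bound[where C = C and k = k, OF assms] Z by (intro div_pos_pos_trivial) auto
  moreover have "2 * Z ^ k \<noteq> 0" using Z by linarith
  then have "(x + y * (2 * Z ^ k)) div (2 * Z ^ k) = y + x div (2 * Z ^ k)" for x y
    by (rule div_mult_self1)
  ultimately show ?thesis unfolding eq by (simp only: add_0_right)
qed

text \<open>Rounding away \<open>k\<close> and \<open>Suc k\<close> digits leaves numbers that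
  differ, after the second is shifted back by one digit, exactly in digit \<open>k\<close>.\<close>

lemma coeff_extract:
  fixes C :: "int poly"
  assumes "\<And>j. \<bar>coeff C j\<bar> \<le> B" "2 * B + 2 \<le> Z"
  shows "coeff C k = (2 * poly C Z + Z ^ k) div (2 * Z ^ k)
     - Z * ((2 * poly C Z + Z ^ Suc k) div (2 * Z ^ Suc k))"
proof -
  define n where "n = Suc (degree C)"
  have pC: "poly C Z = (\<Sum>j<m. coeff C j * Z ^ j)" if "n \<le> m" for m
  proof -
    have "poly C Z = (\<Sum>j<n. coeff C j * Z ^ j)" by (simp add: poly_altdef n_def lessThan_Suc_atMost)
    also have "\<dots> = (\<Sum>j<m. coeff C j * Z ^ j)"
      using that by (intro sum.mono_neutral_left) (auto simp: n_def intro!: coeff_eq_0)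
    finally show ?thesis .
  qed
  have "(2 * poly C Z + Z ^ k) div (2 * Z ^ k) = (\<Sum>j<Suc n. coeff C (k + j) * Z ^ j)"
    using round_poly[where C = "coeff C" and k = k and n = "Suc n", OF assms] pC[of "k + Suc n"] by simp
  moreover have "(2 * poly C Z + Z ^ Suc k) div (2 * Z ^ Suc k) = (\<Sum>j<n. coeff C (Suc k + j) * Z ^ j)"
    using round_poly[where C = "coeff C" and k = "Suc k" and n = n, OF assms] pC[of "Suc k + n"] by simp
  moreover have "(\<Sum>j<Suc n. coeff C (k + j) * Z ^ j) = coeff C k + Z * (\<Sum>j<n. coeff C (Suc k + j) * Z ^ j)"
    unfolding sum.lessThan_Suc_shift by (simp add: sum_distrib_left algebra_simps)
  ultimately show ?thesis by simp
qed

section \<open>Kronecker substitution of the generic forms\<close>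

lemma poly_kron: "poly (kron K n f) z = (\<Sum>i<n. f i * z ^ (K ^ i))"
  by (simp add: kron_def poly_sum poly_monom)

lemma coeff_kron:
  assumes "2 \<le> K"
  shows "i < n \<Longrightarrow> coeff (kron K n f) (K ^ i) = f i"
    and "(\<And>i. i < n \<Longrightarrow> t \<noteq> K ^ i) \<Longrightarrow> coeff (kron K n f) t = 0"
proof -
  assume i: "i < n"
  have "coeff (kron K n f) (K ^ i) = (\<Sum>i'<n. if i' = i then f i' else 0)"
    using assms by (simp add: kron_def coeff_sum)
  then show "coeff (kron K n f) (K ^ i) = f i" using i by simp
next
  assume "\<And>i. i < n \<Longrightarrow> t \<noteq> K ^ i"
  then have "(if K ^ i = t then f i else 0) = 0" if "i < n" for i using that by metis
  then show "coeff (kron K n f) t = 0" by (simp add: kron_def coeff_sum)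
qed

lemma poly_map_poly_of_int: "poly (map_poly real_of_int p) (of_int z) = of_int (poly p z)"
  by (induction p) (simp_all add: map_poly_pCons)

lemma poly_eqI_of_int:
  fixes p q :: "real poly"
  assumes "\<And>z :: int. z0 \<le> z \<Longrightarrow> poly p (of_int z) = poly q (of_int z)"
  shows "p = q"
proof (rule ccontr)
  assume "p \<noteq> q"
  then have "finite {x. poly (p - q) x = 0}" by (intro poly_roots_finite) simp
  moreover have "real_of_int ` {z0..} \<subseteq> {x. poly (p - q) x = 0}" using assms by auto
  ultimately have "finite (real_of_int ` {z0..})" by (rule rev_finite_subset)
  then have "finite {z0..}" by (rule finite_imageD) (simp add: inj_on_def)
  then show False by (simp add: infinite_Ici)
qed

lemma aff_sum: "aff b e (\<lambda>c. \<Sum>i<n. g i c * w i) x = (\<Sum>i<n. aff b e (g i) x * w i)"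
proof -
  have "(\<Sum>c=1..e. (\<Sum>i<n. g i c * w i) * x (b c)) = (\<Sum>i<n. (\<Sum>c=1..e. g i c * x (b c)) * w i)"
    unfolding sum_distrib_right by (subst sum.swap) (simp add: algebra_simps)
  then show ?thesis by (simp add: aff_def sum.distrib distrib_right)
qed

lemma poly_eq_sum_coeff:
  fixes p :: "'r::comm_semiring_1 poly"
  assumes "degree p < n"
  shows "poly p z = (\<Sum>j<n. coeff p j * z ^ j)"
  unfolding poly_altdef
  by (rule sum.mono_neutral_left) (use assms in auto, metis le_degree mult_zero_left)

text \<open>Row \<open>i\<close> with \<open>n \<le> i\<close> is the coordinate
  \<open>n + d - i\<close>, and its weight \<open>Z ^ (K ^ i)\<close> outranks the weights of all
  original forms. No other extra row contains this coordinate, so this row alone decides degree and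
  leading coefficient.\<close>

lemma
  fixes l :: "nat \<Rightarrow> nat \<Rightarrow> int"
  assumes K: "2 \<le> K" and H: "1 \<le> H" "\<And>i c. i < n + d \<Longrightarrow> c \<le> d \<Longrightarrow> \<bar>l i c\<bar> \<le> H"
    and extra: "\<And>i c. n \<le> i \<Longrightarrow> l i c = (if i + c = n + d then 1 else 0)"
  shows abs_coeff_kron_forms: "c \<le> d \<Longrightarrow> \<bar>coeff (kron K (n + d) (\<lambda>i. l i c)) t\<bar> \<le> H"
    and degree_kron_forms: "c \<in> {1..d} \<Longrightarrow> degree (kron K (n + d) (\<lambda>i. l i c)) = K ^ (n + d - c)"
    and lead_coeff_kron_forms: "c \<in> {1..d} \<Longrightarrow> lead_coeff (kron K (n + d) (\<lambda>i. l i c)) = 1"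
proof -
  let ?L = "kron K (n + d) (\<lambda>i. l i c)"
  show "\<bar>coeff ?L t\<bar> \<le> H" if "c \<le> d"
  proof (cases "\<exists>i<n + d. t = K ^ i")
    case True
    then obtain i where i: "i < n + d" "t = K ^ i" by blast
    then show ?thesis unfolding i(2) coeff_kron(1)[OF K i(1)] using H(2) that by simp
  next
    case False
    then show ?thesis using coeff_kron(2)[OF K, of "n + d" t "\<lambda>i. l i c"] H(1) by auto
  qed
  show "degree ?L = K ^ (n + d - c)" "lead_coeff ?L = 1" if c: "c \<in> {1..d}"
  proof -
    have le: "n \<le> n + d - c" using c by auto
    have one: "coeff ?L (K ^ (n + d - c)) = 1"
      using c coeff_kron(1)[OF K, of "n + d - c" "n + d" "\<lambda>i. l i c"] extra[OF le, of c] by simp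
    have "coeff ?L t = 0" if t: "t > K ^ (n + d - c)" for t
    proof (cases "\<exists>i<n + d. t = K ^ i")
      case True
      then obtain i where i: "i < n + d" "t = K ^ i" by blast
      then have "n + d - c < i" using t K by simp
      then have "l i c = 0" using extra[of i c] c by auto
      then show ?thesis unfolding i(2) coeff_kron(1)[OF K i(1)] .
    next
      case False
      then show ?thesis using coeff_kron(2)[OF K, of "n + d" t "\<lambda>i. l i c"] by auto
    qed
    then have "degree ?L \<le> K ^ (n + d - c)" by (intro degree_le) auto
    moreover have "K ^ (n + d - c) \<le> degree ?L" by (rule le_degree) (simp add: one)
    ultimately show d: "degree ?L = K ^ (n + d - c)" by simp
    then show "lead_coeff ?L = 1" using one by simp
  qed
qed

text \<open>The exponents \<open>K ^ (n + d - c)\<close> of the extra monomials decrease in the index \<open>c\<close> of the coordinate,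
  so that the eliminations, which start with the last coordinate, never cancel a leading term.\<close>

lemma den_kron_forms_pos:
  fixes a l :: "nat \<Rightarrow> nat \<Rightarrow> int"
  assumes K: "2 \<le> K" and H: "1 \<le> H" "\<And>i c. i < n + d \<Longrightarrow> c \<le> d \<Longrightarrow> \<bar>l i c\<bar> \<le> H"
    and extra: "\<And>i c. n \<le> i \<Longrightarrow> l i c = (if i + c = n + d then 1 else 0)"
    and a: "\<And>i c. i < K \<Longrightarrow> c \<le> d \<Longrightarrow> \<bar>a i c\<bar> \<le> H" and z: "entry_bound d H + 1 \<le> z"
  shows "0 < den K d a (\<lambda>c. \<Sum>i<n + d. l i c * z ^ (K ^ i)) M"
proof (cases d)
  case (Suc e)
  have "0 < den_factor K e a (\<lambda>c. poly (kron K (n + d) (\<lambda>i. l i c)) z) M j" if "j < K" for j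
  proof (rule den_factor_pos[where \<delta> = "\<lambda>c. K ^ (n + d - c)" and w = 1 and H = H])
    fix c assume "c \<in> {1..Suc e}"
    then have c: "c \<in> {1..d}" by (simp add: Suc)
    show "degree (kron K (n + d) (\<lambda>i. l i c)) = K ^ (n + d - c)"
      by (rule degree_kron_forms[OF K H extra c]) simp_all
    show "lead_coeff (kron K (n + d) (\<lambda>i. l i c)) = 1"
      by (rule lead_coeff_kron_forms[OF K H extra c]) simp_all
    show "\<bar>coeff (kron K (n + d) (\<lambda>i. l i c)) i\<bar> \<le> H" for i
      by (rule abs_coeff_kron_forms[OF K H extra]) (use c in simp_all)
  next
    fix c c' assume "1 \<le> c" "c < c'" "c' \<le> Suc e"
    then show "K ^ (n + d - c') < K ^ (n + d - c)"
      using K Suc by (intro power_strict_increasing) auto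
  qed (use H(1) a z that Suc in auto)
  then have "0 < den K (Suc e) a (\<lambda>c. poly (kron K (n + d) (\<lambda>i. l i c)) z) M"
    unfolding den_Suc by (intro prod_pos) auto
  then show ?thesis by (simp only: poly_kron Suc)
qed simp

section \<open>From the value at one integer to the integral\<close>

text \<open>The quantities enter through defining equations, and \<open>B\<close> and
  \<open>Z\<close> through the inequalities they must satisfy, so that the numbers computed by the
  program can be plugged in directly.\<close>

theorem integral_extraction:
  fixes b :: "nat \<Rightarrow> 'i" and a l :: "nat \<Rightarrow> nat \<Rightarrow> int" and m :: "nat \<Rightarrow> nat"
  assumes inj: "inj_on b {1..d}" and bdd: "bdd_region b K d a"
    and H: "1 \<le> H" "\<And>i c. i < K \<Longrightarrow> c \<le> d \<Longrightarrow> \<bar>a i c\<bar> \<le> H"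
      "\<And>i c. i < n + d \<Longrightarrow> c \<le> d \<Longrightarrow> \<bar>l i c\<bar> \<le> H"
    and extra: "\<And>i c. n \<le> i \<Longrightarrow> l i c = (if i + c = n + d then 1 else 0)"
    and K: "(\<Sum>i<n. m i) < K" "2 \<le> K"
    and M: "M = (\<Sum>i<n. m i)" and D: "D = lead K d a 1 M"
    and X: "X = coord_bound d H" and F: "F = int (n + d) * (H * (1 + int d * X))"
    and B: "fact (M + d) * D * F ^ M * (2 * X) ^ d \<le> B"
    and Z: "2 * B + 2 \<le> Z" "entry_bound d H + 1 \<le> Z"
    and LZ: "LZ = (\<lambda>c. \<Sum>i<n + d. l i c * Z ^ (K ^ i))"
    and N: "N = D * num K d a (\<lambda>_. False) LZ M div den K d a LZ M"
    and Y: "Y = Z ^ (\<Sum>i<n. m i * K ^ i)"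
  shows "real_of_int ((2 * N + Y) div (2 * Y) - Z * ((2 * N + Z * Y) div (2 * (Z * Y)))) =
    fact (M + d) * of_int D * (\<integral>x. indicator (region b K d a (\<lambda>_. False)) x *
      (\<Prod>i<n. aff b d (\<lambda>c. of_int (l i c)) x ^ m i / fact (m i)) \<partial>(Pi\<^sub>M (b ` {1..d}) (\<lambda>_. lborel)))"
proof -
  let ?R = "region b K d a (\<lambda>_. False)" and ?M = "Pi\<^sub>M (b ` {1..d}) (\<lambda>_. lborel :: real measure)"
  let ?h = "map_poly real_of_int"
  define \<kappa> where "\<kappa> = (\<Sum>i<n. m i * K ^ i)"
  define L where "L c = kron K (n + d) (\<lambda>i. l i c)" for c
  define S where "S = den K d a L M"
  define T where "T = num K d a (\<lambda>_. False) L M"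
  define f where "f x i = aff b d (\<lambda>c. of_int (l i c)) x" for x i
  define W where "W x = kron K (n + d) (f x)" for x
  define q where "q j = (\<integral>x. indicator ?R x * coeff (W x ^ M) j \<partial>?M)" for j
  define G where "G = K ^ (n + d)"
  \<comment> \<open>The factor \<open>fact (M + d) / fact M\<close> cancels the factorials in
    \<open>integral_aff_power\<close>, which makes \<open>Q\<close> exactly the quotient of
    \<open>T\<close> by \<open>S\<close>.\<close>
  define Q where "Q = (\<Sum>j<G. monom (fact (M + d) / fact M * q j) j)"
  have MK: "M < K" using K M by simp
  have X0: "0 \<le> X" unfolding X using coord_bound_nonneg[OF H(1)] .
  have LZ': "LZ = (\<lambda>c. poly (L c) Z)" unfolding LZ L_def poly_kron ..

  have degL: "degree (L c) = K ^ (n + d - c)" and leadL: "lead_coeff (L c) = 1" if "c \<in> {1..d}" for c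
    unfolding L_def by (rule degree_kron_forms[OF K(2) H(1,3) extra that]
        lead_coeff_kron_forms[OF K(2) H(1,3) extra that]; simp)+
  have decr: "K ^ (n + d - c') < K ^ (n + d - c)" if "1 \<le> c" "c < c'" "c' \<le> d" for c c'
    using that K(2) by (intro power_strict_increasing) auto
  have leadS: "lead_coeff S = D" unfolding S_def D
    by (rule lead_coeff_den[where \<delta> = "\<lambda>c. K ^ (n + d - c)"]) (use degL leadL decr in auto)
  have D0: "0 < D" unfolding D by (rule lead_pos) simp
  have S0: "S \<noteq> 0" using leadS D0 by auto
  have Spos: "0 < poly S z" if "entry_bound d H + 1 \<le> z" for z
    unfolding S_def poly_den L_def poly_kron
    by (rule den_kron_forms_pos[OF K(2) H(1,3) extra H(2) that])

  have xX: "\<bar>x (b c)\<bar> \<le> of_int X" if "x \<in> ?R" "c \<in> {1..d}" for x c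
    unfolding X by (rule abs_coord_le[OF inj bdd H(1,2) that])
  have fF: "(\<Sum>i<n + d. \<bar>f x i\<bar>) \<le> of_int F" if "x \<in> ?R" for x
  proof -
    have "\<bar>f x i\<bar> \<le> of_int (H * (1 + int d * X))" if i: "i < n + d" for i
    proof -
      have "\<bar>f x i\<bar> \<le> \<bar>real_of_int (l i 0)\<bar> + (\<Sum>c=1..d. \<bar>real_of_int (l i c)\<bar> * of_int X)"
        unfolding f_def by (rule abs_aff_le) (rule xX[OF \<open>x \<in> ?R\<close>])
      also have "\<dots> \<le> of_int H + (\<Sum>c=1..d. of_int H * of_int X)"
      proof (intro add_mono sum_mono mult_right_mono)
        have "\<bar>l i 0\<bar> \<le> H" using H(3)[OF i] by simp
        then show "\<bar>real_of_int (l i 0)\<bar> \<le> of_int H" by linarith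
        fix c assume "c \<in> {1..d}"
        then have "\<bar>l i c\<bar> \<le> H" using H(3)[OF i] by simp
        then show "\<bar>real_of_int (l i c)\<bar> \<le> of_int H" by linarith
      qed (use X0 in simp)
      also have "\<dots> = of_int (H * (1 + int d * X))" by (simp add: algebra_simps)
      finally show ?thesis .
    qed
    then have "(\<Sum>i<n + d. \<bar>f x i\<bar>) \<le> (\<Sum>i<n + d. of_int (H * (1 + int d * X)))"
      by (intro sum_mono) auto
    then show ?thesis by (simp add: F)
  qed
  have coeffW: "\<bar>coeff (W x ^ M) j\<bar> \<le> of_int F ^ M" if "x \<in> ?R" for x j
    using abs_coeff_kron_power_le[of K "n + d" "f x" M j] power_mono[OF fF[OF that], of M]
    unfolding W_def by (simp add: sum_nonneg)
  have F0: "0 \<le> F" using H(1) X0 by (simp add: F)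
  have measW: "(\<lambda>x. coeff (W x ^ M) j) \<in> borel_measurable ?M" for j
    unfolding W_def using measurable_coeff_kron_power[where f = "\<lambda>i x. f x i" and N = ?M] measurable_aff
    unfolding f_def by blast
  have intW: "integrable ?M (\<lambda>x. indicator ?R x * coeff (W x ^ M) j)" for j
    by (rule integrable_bdd_region(1)[where X = "of_int X" and C = "of_int F ^ M"])
      (use inj X0 xX measW coeffW in auto)
  have qb: "\<bar>q j\<bar> \<le> of_int F ^ M * (2 * of_int X) ^ d" for j
    unfolding q_def by (rule integrable_bdd_region(2)[where X = "of_int X" and C = "of_int F ^ M"])
      (use inj X0 xX measW coeffW F0 in auto)

  \<comment> \<open>The formula for the integral applies where the denominator is nonzero, thus at
    all large integers; these suffice for an identity of polynomials.\<close>
  have "poly (Q * ?h S) (of_int z) = poly (?h T) (of_int z)" if z: "entry_bound d H + 1 \<le> z" for z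
  proof -
    let ?l = "\<lambda>c. real_of_int (poly (L c) z)"
    have affW: "aff b d ?l x = poly (W x) (of_int z)" for x
      unfolding L_def W_def poly_kron f_def of_int_sum of_int_mult of_int_power by (rule aff_sum)
    have Sz: "den K d a ?l M = of_int (poly S z)"
      by (simp add: S_def poly_den of_int_den)
    have Tz: "num K d a (\<lambda>_. False) ?l M = of_int (poly T z)"
      by (simp add: T_def poly_num of_int_num)
    have nz: "real_of_int (poly S z) \<noteq> 0" using Spos[OF z] by simp
    have "(\<integral>x. indicator ?R x * aff b d ?l x ^ M \<partial>?M) = (\<integral>x. (\<Sum>j<G. (indicator ?R x * coeff (W x ^ M) j) * of_int z ^ j) \<partial>?M)"
    proof (rule Bochner_Integration.integral_cong[OF refl])
      fix x
      have "aff b d ?l x ^ M = (\<Sum>j<G. coeff (W x ^ M) j * of_int z ^ j)"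
        unfolding affW poly_power[symmetric] G_def W_def
        by (rule poly_eq_sum_coeff) (rule degree_kron_power[OF MK])
      then show "indicator ?R x * aff b d ?l x ^ M = (\<Sum>j<G. (indicator ?R x * coeff (W x ^ M) j) * of_int z ^ j)"
        by (simp add: sum_distrib_left mult.assoc)
    qed
    also have "\<dots> = (\<Sum>j<G. q j * of_int z ^ j)"
      using intW unfolding q_def by (subst Bochner_Integration.integral_sum) auto
    finally have "(\<Sum>j<G. q j * of_int z ^ j) =
        fact M / fact (M + d) * (of_int (poly T z) / of_int (poly S z))"
      using integral_aff_power[OF inj bdd, of ?l M "\<lambda>_. False"] nz unfolding Sz Tz by simp
    moreover have "poly Q (of_int z) = fact (M + d) / fact M * (\<Sum>j<G. q j * of_int z ^ j)"
      unfolding Q_def poly_sum poly_monom sum_distrib_left by (simp only: mult.assoc)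
    ultimately show ?thesis using nz by (simp add: poly_map_poly_of_int)
  qed
  then have "Q * ?h S = ?h T" by (rule poly_eqI_of_int)
  then obtain C where C: "?h C = smult (of_int D) Q" "C * S = smult D T"
    using quotient_int_poly[of Q S T] S0 leadS by auto
  have coeffQ: "coeff Q j = (if j < G then fact (M + d) / fact M * q j else 0)" for j
    unfolding Q_def coeff_sum coeff_monom by simp
  have coeffC: "of_int (coeff C j) = of_int D * coeff Q j" for j
    using arg_cong[OF C(1), of "\<lambda>p. coeff p j"] by (simp add: coeff_map_poly)
  have CB: "\<bar>coeff C j\<bar> \<le> B" for j
  proof -
    have "\<bar>coeff Q j\<bar> \<le> fact (M + d) * (of_int F ^ M * (2 * of_int X) ^ d)"
    proof -
      have "\<bar>coeff Q j\<bar> \<le> fact (M + d) / fact M * \<bar>q j\<bar>" by (simp add: coeffQ abs_mult)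
      also have "\<dots> \<le> fact (M + d) / 1 * (of_int F ^ M * (2 * of_int X) ^ d)"
        using fact_ge_1[of M, where 'a = real]
        by (intro mult_mono divide_left_mono qb) auto
      finally show ?thesis by simp
    qed
    then have "\<bar>real_of_int (coeff C j)\<bar> \<le> of_int D * (fact (M + d) * (of_int F ^ M * (2 * of_int X) ^ d))"
      unfolding coeffC abs_mult using D0 by (intro mult_mono) auto
    also have "\<dots> = of_int (fact (M + d) * D * F ^ M * (2 * X) ^ d)" by (simp add: algebra_simps)
    also have "\<dots> \<le> of_int B" using B by (simp only: of_int_le_iff)
    finally show ?thesis by linarith
  qed
  \<comment> \<open>The integer division in \<open>N\<close> is exact by
    \<open>C * S = smult D T\<close> and the positivity of \<open>S\<close> at
    \<open>Z\<close>.\<close>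
  have "N = poly C Z"
  proof -
    have "poly C Z * poly S Z = D * poly T Z" using arg_cong[OF C(2), of "\<lambda>p. poly p Z"] by simp
    moreover have "N = D * poly T Z div poly S Z"
      unfolding N LZ' by (simp add: S_def T_def poly_den poly_num)
    ultimately show ?thesis using Spos[OF Z(2)] by (metis less_irrefl nonzero_mult_div_cancel_right)
  qed
  then have "(2 * N + Y) div (2 * Y) - Z * ((2 * N + Z * Y) div (2 * (Z * Y))) = coeff C \<kappa>"
    using coeff_extract[OF CB Z(1), of \<kappa>] by (simp add: Y \<kappa>_def)
  moreover have "of_int (coeff C \<kappa>) = fact (M + d) * of_int D * (\<integral>x. indicator ?R x *
      (\<Prod>i<n. f x i ^ m i / fact (m i)) \<partial>?M)"
  proof -
    \<comment> \<open>The added coordinate forms get exponent \<open>0\<close>, so they alter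
      neither the sum of the exponents nor the product of the powers.\<close>
    define m' where "m' i = (if i < n then m i else 0)" for i
    have sums: "(\<Sum>i<n + d. m' i) = M" "(\<Sum>i<n + d. m' i * K ^ i) = \<kappa>"
      unfolding M \<kappa>_def m'_def by (rule sum.mono_neutral_cong_right; auto)+
    have prods: "(\<Prod>i<n + d. fact (m' i)) = (\<Prod>i<n. fact (m i) :: real)"
      "(\<Prod>i<n + d. f x i ^ m' i) = (\<Prod>i<n. f x i ^ m i)" for x
      unfolding m'_def by (rule prod.mono_neutral_cong_right; auto)+
    have "coeff (W x ^ M) \<kappa> = fact M * (\<Prod>i<n. f x i ^ m i / fact (m i))" for x
      using coeff_kron_power[of m' "n + d" K "f x"] MK unfolding sums prods W_def
      by (simp add: prod_dividef field_simps)
    then have "q \<kappa> = fact M * (\<integral>x. indicator ?R x * (\<Prod>i<n. f x i ^ m i / fact (m i)) \<partial>?M)"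
      unfolding q_def by (simp add: mult.left_commute)
    moreover have "\<kappa> < G"
    proof -
      have "(\<Sum>i<n + d. m' i * K ^ i) < K ^ (n + d)"
      proof (rule sum_digits_less)
        fix i assume "i < n + d"
        then have "m' i \<le> (\<Sum>i<n + d. m' i)" by (intro member_le_sum) auto
        then show "m' i < K" using sums MK by simp
      qed
      then show ?thesis by (simp add: sums G_def)
    qed
    ultimately show ?thesis unfolding coeffC coeffQ by simp
  qed
  ultimately show ?thesis by (simp add: f_def)
qed

section \<open>Terms for the integral\<close>

abbreviation tm_add (infixl "\<oplus>" 65) where "t \<oplus> u \<equiv> Bin Add t u"
abbreviation tm_sub (infixl "\<ominus>" 65) where "t \<ominus> u \<equiv> Bin Sub t u"
abbreviation tm_mul (infixl "\<otimes>" 70) where "t \<otimes> u \<equiv> Bin Mul t u"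
abbreviation tm_div (infixl "\<oslash>" 70) where "t \<oslash> u \<equiv> Bin Div t u"

definition tm_prod :: "tm list \<Rightarrow> tm" where "tm_prod ts = foldr (\<otimes>) ts (Lit 1)"
definition tm_sum :: "tm list \<Rightarrow> tm" where "tm_sum ts = foldr (\<oplus>) ts (Lit 0)"
text \<open>Every loop runs \<open>K\<close> times, so the rounds beyond the exponent multiply by
  \<open>1\<close>. The value is the power only for exponents up to \<open>K\<close>.\<close>

definition tm_pow :: "tm \<Rightarrow> tm \<Rightarrow> tm" where
  "tm_pow t E = Loop Mul 1 0 (Cond (E \<ominus> Var 0) t (Lit 1))"
definition tm_fact :: "tm \<Rightarrow> tm" where
  "tm_fact E = Loop Mul 1 0 (Cond (E \<ominus> Var 0) (Var 0 \<oplus> Lit 1) (Lit 1))"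
definition tm_sgn :: "tm \<Rightarrow> tm" where
  "tm_sgn t = Cond t (Lit 1) (Cond (Lit 0 \<ominus> t) (Lit (- 1)) (Lit 0))"

definition tm_pivot :: "(tm \<Rightarrow> nat \<Rightarrow> tm) \<Rightarrow> nat \<Rightarrow> tm \<Rightarrow> (nat \<Rightarrow> tm) \<Rightarrow> nat \<Rightarrow> tm" where
  "tm_pivot a e j g c = a j e \<otimes> (a j e \<otimes> g c \<ominus> g e \<otimes> a j c)"
definition tm_tie :: "(tm \<Rightarrow> nat \<Rightarrow> tm) \<Rightarrow> nat \<Rightarrow> tm \<Rightarrow> (tm \<Rightarrow> tm) \<Rightarrow> tm \<Rightarrow> tm" where
  "tm_tie a e j fl i = Cond (a i e \<otimes> a i e)
     (Cond (a i e \<otimes> a j e) (Cond (j \<ominus> i) (Lit 1) (Lit 0)) (Lit 0)) (fl i)"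

text \<open>The pivot row of the elimination of coordinate \<open>e\<close> is stored in variable \<open>e\<close>; variable \<open>0\<close> is
  the index of all other loops.\<close>

fun tm_lead :: "nat \<Rightarrow> (tm \<Rightarrow> nat \<Rightarrow> tm) \<Rightarrow> tm \<Rightarrow> tm \<Rightarrow> tm" where
  "tm_lead 0 a w M = Lit 1"
| "tm_lead (Suc e) a w M = (let j = Var (Suc e); p = a j (Suc e) in
     Loop Mul 1 (Suc e) (Cond (p \<otimes> p)
       (w \<otimes> tm_pow (p \<otimes> p) (M \<oplus> Lit 1) \<otimes>
        tm_lead e (\<lambda>i. tm_pivot a (Suc e) j (a i)) (p \<otimes> p \<otimes> w) (M \<oplus> Lit 1)) (Lit 1)))"

text \<open>The loop of \<open>tm_den\<close> is written out in the body so that there is a single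
  recursion on \<open>e\<close>; \<open>tm_den_factor_eq\<close> folds it back.\<close>

fun tm_den_factor :: "nat \<Rightarrow> (tm \<Rightarrow> nat \<Rightarrow> tm) \<Rightarrow> (nat \<Rightarrow> tm) \<Rightarrow> tm \<Rightarrow> tm" where
  "tm_den_factor e a l M = (let j = Var (Suc e); p = a j (Suc e) in
     Cond (p \<otimes> p)
       (l (Suc e) \<otimes> tm_pow (p \<otimes> p) (M \<oplus> Lit 1) \<otimes>
        (case e of 0 \<Rightarrow> Lit 1 | Suc e' \<Rightarrow> Loop Mul 1 e (tm_den_factor e'
           (\<lambda>i. tm_pivot a (Suc e) j (a i)) (tm_pivot a (Suc e) j l) (M \<oplus> Lit 1)))) (Lit 1))"

declare tm_den_factor.simps [simp del]

definition tm_den :: "nat \<Rightarrow> (tm \<Rightarrow> nat \<Rightarrow> tm) \<Rightarrow> (nat \<Rightarrow> tm) \<Rightarrow> tm \<Rightarrow> tm" where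
  "tm_den e a l M = (case e of 0 \<Rightarrow> Lit 1 | Suc e' \<Rightarrow> Loop Mul 1 e (tm_den_factor e' a l M))"

lemma tm_den_factor_eq: "tm_den_factor e a l M = (let j = Var (Suc e); p = a j (Suc e) in
     Cond (p \<otimes> p)
       (l (Suc e) \<otimes> tm_pow (p \<otimes> p) (M \<oplus> Lit 1) \<otimes>
        tm_den e (\<lambda>i. tm_pivot a (Suc e) j (a i)) (tm_pivot a (Suc e) j l) (M \<oplus> Lit 1)) (Lit 1))"
  by (subst tm_den_factor.simps) (simp add: tm_den_def)

text \<open>The product over the other rows is the exact quotient of the whole denominator by one
  factor. In the base case the loop counts the violated rows.\<close>

fun tm_num :: "nat \<Rightarrow> (tm \<Rightarrow> nat \<Rightarrow> tm) \<Rightarrow> (tm \<Rightarrow> tm) \<Rightarrow> (nat \<Rightarrow> tm) \<Rightarrow> tm \<Rightarrow> tm" where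
  "tm_num 0 a fl l M = Cond (Loop Add 0 0 (Cond (a (Var 0) 0 \<oplus> fl (Var 0)) (Lit 1) (Lit 0)))
     (Lit 0) (tm_pow (l 0) M)"
| "tm_num (Suc e) a fl l M = (let j = Var (Suc e); p = a j (Suc e) in
     Loop Add 0 (Suc e) (tm_sgn p \<otimes>
       tm_num e (\<lambda>i. tm_pivot a (Suc e) j (a i)) (tm_tie a (Suc e) j fl) (tm_pivot a (Suc e) j l) (M \<oplus> Lit 1) \<otimes>
       (tm_den (Suc e) a l M \<oslash> tm_den_factor e a l M)))"

section \<open>Values of terms under nested loops\<close>

definition agree :: "nat \<Rightarrow> (nat \<Rightarrow> int) \<Rightarrow> (nat \<Rightarrow> int) \<Rightarrow> bool" where
  "agree e env' env \<longleftrightarrow> (\<forall>x>e. env' x = env x)"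

lemma agree_refl: "agree e env env"
  by (simp add: agree_def)

lemma agree_upd: "x \<le> e \<Longrightarrow> agree e s t \<Longrightarrow> agree e (s(x := v)) t"
  by (auto simp: agree_def)

lemma agree_upd_Suc: "agree (Suc e) s t \<Longrightarrow> agree e (s(Suc e := v)) (t(Suc e := v))"
  by (auto simp: agree_def)

context
  fixes inp :: mem and K :: nat
begin

text \<open>\<open>has_val e t env v\<close>: only the variables above \<open>e\<close> matter for the value \<open>v\<close> of \<open>t\<close>.\<close>

definition has_val :: "nat \<Rightarrow> tm \<Rightarrow> (nat \<Rightarrow> int) \<Rightarrow> int \<Rightarrow> bool" where
  "has_val e t env v \<longleftrightarrow> (\<forall>env'. agree e env' env \<longrightarrow> tval inp K t env' = v)"

text \<open>The system is a function from index terms to entry terms. Elimination composes such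
  functions symbolically, so no matrix is ever stored. The index is an arbitrary term because it may
  be a pivot variable or the index of an inner loop.\<close>

definition has_rows :: "nat \<Rightarrow> (tm \<Rightarrow> nat \<Rightarrow> tm) \<Rightarrow> (nat \<Rightarrow> int) \<Rightarrow> (nat \<Rightarrow> nat \<Rightarrow> int) \<Rightarrow> bool" where
  "has_rows e a env A \<longleftrightarrow> (\<forall>env' t i c. agree e env' env \<longrightarrow> tval inp K t env' = int i \<longrightarrow>
     tval inp K (a t c) env' = A i c)"

definition has_flags :: "nat \<Rightarrow> (tm \<Rightarrow> tm) \<Rightarrow> (nat \<Rightarrow> int) \<Rightarrow> (nat \<Rightarrow> bool) \<Rightarrow> bool" where
  "has_flags e fl env F \<longleftrightarrow> (\<forall>env' t i. agree e env' env \<longrightarrow> tval inp K t env' = int i \<longrightarrow>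
     tval inp K (fl t) env' = of_bool (F i))"

lemma has_valD: "has_val e t env v \<Longrightarrow> agree e env' env \<Longrightarrow> tval inp K t env' = v"
  by (simp add: has_val_def)

lemma has_val_Lit: "has_val e (Lit z) env z"
  by (simp add: has_val_def)

lemma has_val_add: "has_val e t env v \<Longrightarrow> has_val e u env w \<Longrightarrow> has_val e (t \<oplus> u) env (v + w)"
  by (simp add: has_val_def)

lemma has_val_sub: "has_val e t env v \<Longrightarrow> has_val e u env w \<Longrightarrow> has_val e (t \<ominus> u) env (v - w)"
  by (simp add: has_val_def)

lemma has_val_mul: "has_val e t env v \<Longrightarrow> has_val e u env w \<Longrightarrow> has_val e (t \<otimes> u) env (v * w)"
  by (simp add: has_val_def)

lemma has_val_div: "has_val e t env v \<Longrightarrow> has_val e u env w \<Longrightarrow> has_val e (t \<oslash> u) env (v div w)"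
  by (simp add: has_val_def)

lemma has_val_Cond: "has_val e c env z \<Longrightarrow> (z > 0 \<Longrightarrow> has_val e t env v) \<Longrightarrow> (\<not> z > 0 \<Longrightarrow> has_val e u env w)
    \<Longrightarrow> has_val e (Cond c t u) env (if z > 0 then v else w)"
  by (simp add: has_val_def)

lemma has_val_Suc_exponent: "has_val e M env (int m) \<Longrightarrow> has_val e (M \<oplus> Lit 1) env (int (Suc m))"
  by (simp add: has_val_def)

lemma iter_val_cong: "(\<And>i. i < n \<Longrightarrow> g i = h i) \<Longrightarrow> iter_val f z g n = iter_val f z h n"
  by (induction n) auto

lemma has_val_Loop0:
  assumes "\<And>env' i. agree e env' env \<Longrightarrow> i < K \<Longrightarrow> env' 0 = int i \<Longrightarrow> tval inp K t env' = g i"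
  shows "has_val e (Loop f z 0 t) env (iter_val f z g K)"
proof -
  have "iter_val f z (\<lambda>i. tval inp K t (env'(0 := int i))) K = iter_val f z g K"
    if "agree e env' env" for env'
    by (intro iter_val_cong assms agree_upd that) auto
  then show ?thesis unfolding has_val_def by auto
qed

lemma has_val_Loop:
  assumes "\<And>i. i < K \<Longrightarrow> has_val e t (env(Suc e := int i)) (g i)"
  shows "has_val (Suc e) (Loop f z (Suc e) t) env (iter_val f z g K)"
proof -
  have "iter_val f z (\<lambda>i. tval inp K t (env'(Suc e := int i))) K = iter_val f z g K"
    if "agree (Suc e) env' env" for env'
    by (intro iter_val_cong has_valD[OF assms agree_upd_Suc[OF that]])
  then show ?thesis unfolding has_val_def by auto
qed

lemma has_val_pow:
  assumes "has_val e t env v" "has_val e E env (int k)" "k \<le> K"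
  shows "has_val e (tm_pow t E) env (v ^ k)"
proof -
  have "has_val e (tm_pow t E) env (iter_val Mul 1 (\<lambda>i. if i < k then v else 1) K)"
    unfolding tm_pow_def
    by (rule has_val_Loop0) (use has_valD[OF assms(1)] has_valD[OF assms(2)] in auto)
  moreover have "(\<Prod>i<K. if i < k then v else 1) = (\<Prod>i<k. v)"
    using assms(3) by (intro prod.mono_neutral_cong_right) auto
  ultimately show ?thesis by (simp add: iter_val_Mul)
qed

lemma has_val_fact:
  assumes "has_val e E env (int k)" "k \<le> K"
  shows "has_val e (tm_fact E) env (fact k)"
proof -
  have "has_val e (tm_fact E) env (iter_val Mul 1 (\<lambda>i. if i < k then int (Suc i) else 1) K)"
    unfolding tm_fact_def
    by (rule has_val_Loop0) (use has_valD[OF assms(1)] in auto)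
  moreover have "(\<Prod>i<K. if i < k then int (Suc i) else 1) = (\<Prod>i<k. int (Suc i))"
    using assms(2) by (intro prod.mono_neutral_cong_right) auto
  moreover have "(\<Prod>i<k. int (Suc i)) = fact k"
    unfolding fact_prod_Suc by (simp add: lessThan_atLeast0)
  ultimately show ?thesis by (simp add: iter_val_Mul)
qed

lemma tval_prod: "tval inp K (tm_prod (map t [0..<k])) env = (\<Prod>i<k. tval inp K (t i) env)"
proof -
  have "tval inp K (foldr (\<otimes>) (map t is) (Lit 1)) env = prod_list (map (\<lambda>i. tval inp K (t i) env) is)" for "is"
    by (induction "is") auto
  then show ?thesis
    by (simp add: tm_prod_def lessThan_atLeast0 prod.distinct_set_conv_list[symmetric])
qed

lemma tval_sum: "tval inp K (tm_sum (map t [0..<k])) env = (\<Sum>i<k. tval inp K (t i) env)"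
proof -
  have "tval inp K (foldr (\<oplus>) (map t is) (Lit 0)) env = sum_list (map (\<lambda>i. tval inp K (t i) env) is)" for "is"
    by (induction "is") auto
  then show ?thesis
    by (simp add: tm_sum_def lessThan_atLeast0 sum.distinct_set_conv_list[symmetric])
qed

lemma has_val_prod:
  assumes "\<And>i. i < k \<Longrightarrow> has_val e (t i) env (v i)"
  shows "has_val e (tm_prod (map t [0..<k])) env (\<Prod>i<k. v i)"
  using assms by (auto simp: has_val_def tval_prod)

lemma has_val_sum:
  assumes "\<And>i. i < k \<Longrightarrow> has_val e (t i) env (v i)"
  shows "has_val e (tm_sum (map t [0..<k])) env (\<Sum>i<k. v i)"
  using assms by (auto simp: has_val_def tval_sum)

lemma has_val_sgn: "has_val e t env v \<Longrightarrow> has_val e (tm_sgn t) env (sgn v)"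
  by (auto simp: has_val_def tm_sgn_def sgn_if)

lemma has_rows_val: "has_rows e a env A \<Longrightarrow> has_val e t env (int i) \<Longrightarrow> has_val e (a t c) env (A i c)"
  unfolding has_rows_def has_val_def by blast

lemma has_val_step:
  assumes "has_val (Suc e) t env v"
  shows "has_val e t (env(Suc e := w)) v"
  unfolding has_val_def
proof (intro allI impI)
  fix env' assume "agree e env' (env(Suc e := w))"
  then have "agree (Suc e) env' env" by (auto simp: agree_def)
  then show "tval inp K t env' = v" by (rule has_valD[OF assms])
qed

lemma has_rows_step:
  assumes "has_rows (Suc e) a env A"
  shows "has_rows e a (env(Suc e := w)) A"
  unfolding has_rows_def
proof (intro allI impI)
  fix env' t i c assume "agree e env' (env(Suc e := w))" "tval inp K t env' = int i"
  then have "agree (Suc e) env' env" by (auto simp: agree_def)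
  then show "tval inp K (a t c) env' = A i c"
    using assms \<open>tval inp K t env' = int i\<close> unfolding has_rows_def by blast
qed

lemma has_flags_step:
  assumes "has_flags (Suc e) fl env F"
  shows "has_flags e fl (env(Suc e := w)) F"
  unfolding has_flags_def
proof (intro allI impI)
  fix env' t i assume "agree e env' (env(Suc e := w))" "tval inp K t env' = int i"
  then have "agree (Suc e) env' env" by (auto simp: agree_def)
  then show "tval inp K (fl t) env' = of_bool (F i)"
    using assms \<open>tval inp K t env' = int i\<close> unfolding has_flags_def by blast
qed

lemma has_val_pivot_var: "has_val e (Var (Suc e)) (env(Suc e := int j)) (int j)"
  by (auto simp: has_val_def agree_def)

lemma has_val_pivot:
  assumes "has_rows e a env A" "has_val e j env (int j')" "\<And>c. has_val e (l c) env (L c)"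
  shows "has_val e (tm_pivot a e' j l c) env (pivot A e' j' L c)"
  unfolding tm_pivot_def pivot_def of_int_eq_id id_apply
  by (intro has_val_mul has_val_sub has_rows_val[OF assms(1,2)] assms(3))

lemma has_rows_pivot:
  assumes "has_rows e a env A" "has_val e j env (int j')"
  shows "has_rows e (\<lambda>i. tm_pivot a e' j (a i)) env (\<lambda>i. pivot A e' j' (A i))"
  unfolding has_rows_def
proof (intro allI impI)
  fix env' t i c assume *: "agree e env' env" "tval inp K t env' = int i"
  have "tval inp K (a j c) env' = A j' c" "tval inp K (a t c) env' = A i c" for c
    using assms * has_valD[OF assms(2) *(1)] unfolding has_rows_def by blast+
  then show "tval inp K (tm_pivot a e' j (a t) c) env' = pivot A e' j' (A i) c"
    by (simp add: tm_pivot_def pivot_def)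
qed

lemma has_flags_tie:
  assumes "has_rows e a env A" "has_val e j env (int j')" "has_flags e fl env F"
  shows "has_flags e (tm_tie a e' j fl) env (tie A e' j' F)"
  unfolding has_flags_def
proof (intro allI impI)
  fix env' t i assume *: "agree e env' env" "tval inp K t env' = int i"
  have j: "tval inp K j env' = int j'" using has_valD[OF assms(2) *(1)] .
  have a: "tval inp K (a j c) env' = A j' c" "tval inp K (a t c) env' = A i c" for c
    using assms(1) * j unfolding has_rows_def by blast+
  have f: "tval inp K (fl t) env' = of_bool (F i)" using assms(3) * unfolding has_flags_def by blast
  have sq: "0 < x * x \<longleftrightarrow> x \<noteq> 0" for x :: int by (auto simp: zero_less_mult_iff)
  show "tval inp K (tm_tie a e' j fl t) env' = of_bool (tie A e' j' F i)"
    unfolding tm_tie_def tie_def by (simp add: a f j * sq)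
qed

text \<open>The exponent grows by one with each elimination and must stay within the reach of
  \<open>tm_pow\<close>; hence \<open>M' + e \<le> K\<close>.\<close>

lemma has_val_lead:
  assumes "has_rows e a env A" "has_val e w env w'" "has_val e M env (int M')" "M' + e \<le> K"
  shows "has_val e (tm_lead e a w M) env (lead K e A w' M')"
  using assms
proof (induction e arbitrary: a env A w w' M M')
  case 0
  then show ?case by (simp add: has_val_Lit)
next
  case (Suc e)
  let ?j = "Var (Suc e)"
  let ?p = "a ?j (Suc e)"
  let ?g = "\<lambda>j. if A j (Suc e) * A j (Suc e) > 0 then
     w' * (A j (Suc e) * A j (Suc e)) ^ Suc M' *
       lead K e (\<lambda>i. pivot A (Suc e) j (A i)) (A j (Suc e) * A j (Suc e) * w') (Suc M') else 1"
  have "has_val (Suc e) (tm_lead (Suc e) a w M) env (iter_val Mul 1 ?g K)"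
    unfolding tm_lead.simps Let_def
  proof (rule has_val_Loop)
    fix j assume "j < K"
    let ?env = "env(Suc e := int j)"
    note rows = has_rows_step[OF Suc.prems(1), of "int j"]
    note jv = has_val_pivot_var[of e env j]
    have p: "has_val e (?p \<otimes> ?p) ?env (A j (Suc e) * A j (Suc e))"
      by (intro has_val_mul has_rows_val[OF rows jv])
    have M1: "has_val e (M \<oplus> Lit 1) ?env (int (Suc M'))"
      by (intro has_val_Suc_exponent has_val_step Suc.prems(3))
    have w: "has_val e w ?env w'" by (intro has_val_step Suc.prems(2))
    show "has_val e (Cond (?p \<otimes> ?p)
       (w \<otimes> tm_pow (?p \<otimes> ?p) (M \<oplus> Lit 1) \<otimes>
        tm_lead e (\<lambda>i. tm_pivot a (Suc e) ?j (a i)) (?p \<otimes> ?p \<otimes> w) (M \<oplus> Lit 1)) (Lit 1)) ?env (?g j)"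
      by (intro has_val_Cond has_val_mul[OF has_val_mul] p w has_val_Lit has_val_pow[OF p M1]
          Suc.IH[OF has_rows_pivot[OF rows jv] has_val_mul[OF p w] M1])
        (use Suc.prems(4) in auto)
  qed
  moreover have "?g j = (if A j (Suc e) = 0 then 1 else
     w' * A j (Suc e) ^ (2 * Suc M') * lead K e (\<lambda>i. pivot A (Suc e) j (A i)) ((A j (Suc e))\<^sup>2 * w') (Suc M'))" for j
    using not_square_less_zero[of "A j (Suc e)"]
    by (auto simp: power_mult power2_eq_square zero_less_mult_iff not_less)
  ultimately show ?case unfolding lead.simps by (simp only: iter_val_Mul mult_1)
qed

text \<open>The claim about \<open>tm_den\<close> is an assumption, so that the lemma serves inside
  the induction for \<open>has_val_den\<close> and, instantiated with its result,
  afterwards.\<close>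

lemma has_val_den_aux:
  assumes "\<And>a env A l L M M'. has_rows e a env A \<Longrightarrow> (\<And>c. has_val e (l c) env (L c)) \<Longrightarrow>
      has_val e M env (int M') \<Longrightarrow> M' + e \<le> K \<Longrightarrow> has_val e (tm_den e a l M) env (den K e A L M')"
    and "has_rows (Suc e) a env A" "\<And>c. has_val (Suc e) (l c) env (L c)"
    and "has_val (Suc e) M env (int M')" "M' + Suc e \<le> K"
  shows "has_val e (tm_den_factor e a l M) (env(Suc e := int j)) (den_factor K e A L M' j)"
proof -
  let ?j = "Var (Suc e)" and ?env = "env(Suc e := int j)"
  let ?p = "a ?j (Suc e)"
  note rows = has_rows_step[OF assms(2), of "int j"]
  note jv = has_val_pivot_var[of e env j]
  have p: "has_val e (?p \<otimes> ?p) ?env (A j (Suc e) * A j (Suc e))"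
    by (intro has_val_mul has_rows_val[OF rows jv])
  have M1: "has_val e (M \<oplus> Lit 1) ?env (int (Suc M'))"
    by (intro has_val_Suc_exponent has_val_step assms(4))
  have l: "has_val e (l c) ?env (L c)" for c by (intro has_val_step assms(3))
  have "has_val e (tm_den_factor e a l M) ?env (if A j (Suc e) * A j (Suc e) > 0 then
     L (Suc e) * (A j (Suc e) * A j (Suc e)) ^ Suc M' *
       den K e (\<lambda>i. pivot A (Suc e) j (A i)) (pivot A (Suc e) j L) (Suc M') else 1)"
    unfolding tm_den_factor_eq Let_def
    by (intro has_val_Cond has_val_mul[OF has_val_mul] p l has_val_Lit has_val_pow[OF p M1]
          assms(1)[OF has_rows_pivot[OF rows jv] has_val_pivot[OF rows jv l] M1])
        (use assms(5) in auto)
  moreover have "(if A j (Suc e) * A j (Suc e) > 0 then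
     L (Suc e) * (A j (Suc e) * A j (Suc e)) ^ Suc M' *
       den K e (\<lambda>i. pivot A (Suc e) j (A i)) (pivot A (Suc e) j L) (Suc M') else 1)
     = den_factor K e A L M' j"
    using not_square_less_zero[of "A j (Suc e)"]
    by (auto simp: den_factor_def power_mult power2_eq_square zero_less_mult_iff not_less)
  ultimately show ?thesis by simp
qed

lemma has_val_den:
  assumes "has_rows e a env A" "\<And>c. has_val e (l c) env (L c)" "has_val e M env (int M')" "M' + e \<le> K"
  shows "has_val e (tm_den e a l M) env (den K e A L M')"
  using assms
proof (induction e arbitrary: a env A l L M M')
  case 0
  then show ?case by (simp add: tm_den_def has_val_Lit)
next
  case (Suc e)
  have "has_val (Suc e) (tm_den (Suc e) a l M) env (iter_val Mul 1 (den_factor K e A L M') K)"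
    unfolding tm_den_def nat.case
    by (rule has_val_Loop, rule has_val_den_aux) (use Suc in auto)
  then show ?case by (simp add: iter_val_Mul den_Suc)
qed

lemmas has_val_den_factor = has_val_den_aux[OF has_val_den]

lemma has_val_num:
  assumes "has_rows e a env A" "has_flags e fl env F" "\<And>c. has_val e (l c) env (L c)"
    and "has_val e M env (int M')" "M' + e \<le> K" "den K e A L M' \<noteq> 0"
  shows "has_val e (tm_num e a fl l M) env (num K e A F L M')"
  using assms
proof (induction e arbitrary: a env A fl F l L M M')
  case 0
  let ?v = "\<lambda>i. if A i 0 + of_bool (F i) > 0 then 1 else 0 :: int"
  have "has_val 0 (Loop Add 0 0 (Cond (a (Var 0) 0 \<oplus> fl (Var 0)) (Lit 1) (Lit 0))) env (iter_val Add 0 ?v K)"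
  proof (rule has_val_Loop0)
    fix env' i assume *: "agree 0 env' env" "env' 0 = int i"
    then have "tval inp K (Var 0) env' = int i" by simp
    then have "tval inp K (a (Var 0) 0) env' = A i 0" "tval inp K (fl (Var 0)) env' = of_bool (F i)"
      using 0(1,2) * unfolding has_rows_def has_flags_def by blast+
    then show "tval inp K (Cond (a (Var 0) 0 \<oplus> fl (Var 0)) (Lit 1) (Lit 0)) env' = ?v i" by simp
  qed
  moreover have "has_val 0 (tm_pow (l 0) M) env (L 0 ^ M')"
    by (rule has_val_pow) (use 0 in auto)
  ultimately have "has_val 0 (tm_num 0 a fl l M) env (if (\<Sum>i<K. ?v i) > 0 then 0 else L 0 ^ M')"
    unfolding tm_num.simps by (intro has_val_Cond has_val_Lit) (simp_all add: iter_val_Add)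
  moreover have "(\<Sum>i<K. ?v i) > 0 \<longleftrightarrow> \<not> (\<forall>i<K. A i 0 + of_bool (F i) \<le> 0)"
  proof -
    have "(\<Sum>i<K. ?v i) = 0 \<longleftrightarrow> (\<forall>i\<in>{..<K}. ?v i = 0)"
      by (intro sum_nonneg_eq_0_iff) auto
    also have "\<dots> \<longleftrightarrow> (\<forall>i<K. A i 0 + of_bool (F i) \<le> 0)"
      unfolding lessThan_iff Ball_def by (intro all_cong) (simp add: not_less)
    finally have "(\<Sum>i<K. ?v i) = 0 \<longleftrightarrow> (\<forall>i<K. A i 0 + of_bool (F i) \<le> 0)" .
    moreover have "(\<Sum>i<K. ?v i) \<ge> 0" by (intro sum_nonneg) auto
    moreover have "0 < s \<longleftrightarrow> \<not> P" if "s = 0 \<longleftrightarrow> P" "0 \<le> s" for s :: int and P using that by auto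
    ultimately show ?thesis by blast
  qed
  ultimately show ?case
    unfolding num.simps by (cases "\<forall>i<K. A i 0 + of_bool (F i) \<le> 0") (simp_all only: if_P if_not_P simp_thms if_True if_False)
next
  case (Suc e)
  let ?j = "Var (Suc e)"
  let ?p = "a ?j (Suc e)"
  let ?n = "\<lambda>j. num K e (\<lambda>i. pivot A (Suc e) j (A i)) (tie A (Suc e) j F) (pivot A (Suc e) j L) (Suc M')"
  let ?d = "den_factor K e A L M'"
  have d: "?d j \<noteq> 0" if "j < K" for j using Suc.prems(6) that by (simp add: den_Suc)
  have "has_val (Suc e) (tm_num (Suc e) a fl l M) env
      (iter_val Add 0 (\<lambda>j. sgn (A j (Suc e)) * ?n j * (den K (Suc e) A L M' div ?d j)) K)"
    unfolding tm_num.simps Let_def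
  proof (rule has_val_Loop)
    fix j assume j: "j < K"
    let ?env = "env(Suc e := int j)"
    note rows = has_rows_step[OF Suc.prems(1), of "int j"]
    note jv = has_val_pivot_var[of e env j]
    have l: "has_val e (l c) ?env (L c)" for c by (intro has_val_step Suc.prems(3))
    have M1: "has_val e (M \<oplus> Lit 1) ?env (int (Suc M'))"
      by (intro has_val_Suc_exponent has_val_step Suc.prems(4))
    have p: "has_val e (tm_sgn ?p) ?env (sgn (A j (Suc e)))"
      by (intro has_val_sgn has_rows_val[OF rows jv])
    have q: "has_val e (tm_den (Suc e) a l M \<oslash> tm_den_factor e a l M) ?env (den K (Suc e) A L M' div ?d j)"
      by (intro has_val_div has_val_step has_val_den has_val_den_factor Suc.prems)
    let ?N = "tm_num e (\<lambda>i. tm_pivot a (Suc e) ?j (a i)) (tm_tie a (Suc e) ?j fl) (tm_pivot a (Suc e) ?j l) (M \<oplus> Lit 1)"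
    have n: "has_val e (tm_sgn ?p \<otimes> ?N) ?env (sgn (A j (Suc e)) * ?n j)"
    \<comment> \<open>For a zero pivot nothing is known about the denominator of the branch, so the
      induction hypothesis cannot be applied; the zero sign annihilates whatever value the branch
      has.\<close>
    proof (cases "A j (Suc e) = 0")
      case True
      then show ?thesis using p unfolding has_val_def by simp
    next
      case False
      have "den K e (\<lambda>i. pivot A (Suc e) j (A i)) (pivot A (Suc e) j L) (Suc M') \<noteq> 0"
        using d[OF j] False by (auto simp: den_factor_def)
      then have "has_val e ?N ?env (?n j)"
        by (intro Suc.IH has_rows_pivot[OF rows jv] has_flags_tie[OF rows jv] has_flags_step
            has_val_pivot[OF rows jv l] M1 Suc.prems(2)) (use Suc.prems(5) in auto)
      then show ?thesis by (intro has_val_mul p)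
    qed
    show "has_val e (tm_sgn ?p \<otimes> ?N \<otimes> (tm_den (Suc e) a l M \<oslash> tm_den_factor e a l M)) ?env
      (sgn (A j (Suc e)) * ?n j * (den K (Suc e) A L M' div ?d j))"
      by (intro has_val_mul[OF n q])
  qed
  moreover have "den K (Suc e) A L M' div ?d j = (\<Prod>i\<in>{..<K} - {j}. ?d i)" if "j < K" for j
  proof -
    have "(\<Prod>i<K. ?d i) = ?d j * (\<Prod>i\<in>{..<K} - {j}. ?d i)"
      by (rule prod.remove) (use that in auto)
    then show ?thesis using d[OF that] by (simp add: den_Suc)
  qed
  ultimately show ?case by (simp add: iter_val_Add)
qed

end

section \<open>The program\<close>

text \<open>The constant term is column \<open>0\<close> but comes last in an encoded row. Each
  rational takes two cells.\<close>

definition col_pos :: "nat \<Rightarrow> nat \<Rightarrow> nat" where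
  "col_pos d c = (if c = 0 then 2 * d else 2 * (c - 1))"
text \<open>The additional \<open>1\<close> skips the cell with the number of rows. Inequalities and
  forms are encoded with the same width, so form \<open>i\<close> is addressed as row
  \<open>k + i\<close>.\<close>

definition tm_numer :: "nat \<Rightarrow> tm \<Rightarrow> nat \<Rightarrow> tm" where
  "tm_numer d i c = Input (i \<otimes> Lit (int (2 * d + 2)) \<oplus> Lit (int (1 + col_pos d c)))"
definition tm_denom :: "nat \<Rightarrow> tm \<Rightarrow> nat \<Rightarrow> tm" where
  "tm_denom d i c = Input (i \<otimes> Lit (int (2 * d + 2)) \<oplus> Lit (int (2 + col_pos d c)))"
definition tm_scale :: "nat \<Rightarrow> tm \<Rightarrow> tm" where
  "tm_scale d i = tm_prod (map (tm_denom d i) [0..<Suc d])"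
definition tm_entry :: "nat \<Rightarrow> tm \<Rightarrow> nat \<Rightarrow> tm" where
  "tm_entry d i c = tm_numer d i c \<otimes> tm_scale d i \<oslash> tm_denom d i c"
definition tm_k :: tm where "tm_k = Input (Lit 0)"
text \<open>The constant is negated because \<open>A x \<le> b\<close> is brought to the form
  \<open>A x - b \<le> 0\<close>. Loops always run over \<open>K\<close> rows, so the rows from
  \<open>k\<close> on are padded with the trivial inequality \<open>0 \<le> 0\<close>.\<close>

definition tm_row :: "nat \<Rightarrow> tm \<Rightarrow> nat \<Rightarrow> tm" where
  "tm_row d i c = Cond (tm_k \<ominus> i) (if c = 0 then Lit 0 \<ominus> tm_entry d i c else tm_entry d i c) (Lit 0)"
definition tm_form :: "nat \<Rightarrow> nat \<Rightarrow> nat \<Rightarrow> nat \<Rightarrow> tm" where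
  "tm_form d n i c = (if i < n then tm_entry d (tm_k \<oplus> Lit (int i)) c
     else Lit (if i + c = n + d then 1 else 0))"
definition tm_exponent :: "nat \<Rightarrow> nat \<Rightarrow> nat \<Rightarrow> tm" where
  "tm_exponent d n i = Input ((tm_k \<oplus> Lit (int n)) \<otimes> Lit (int (2 * d + 2)) \<oplus> Lit (int (1 + i)))"
definition tm_M :: "nat \<Rightarrow> nat \<Rightarrow> tm" where
  "tm_M d n = tm_sum (map (tm_exponent d n) [0..<n])"
text \<open>Loop free, since it is evaluated before the bound is known. The summands make
  \<open>K\<close> at least \<open>2\<close>, larger than \<open>M\<close>, and at least the input
  length and \<open>M + d\<close>, the largest exponent that occurs in the eliminations.\<close>

definition tm_K :: "nat \<Rightarrow> nat \<Rightarrow> tm" where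
  "tm_K d n = (tm_k \<oplus> Lit (int n)) \<otimes> Lit (int (2 * d + 2)) \<oplus> tm_M d n \<oplus> Lit (int (n + d + 3))"
text \<open>The sum of squares dominates the absolute value of every input cell without a maximum or
  a case distinction.\<close>

definition tm_W :: tm where "tm_W = Loop Add 1 0 (Input (Var 0) \<otimes> Input (Var 0))"
text \<open>An entry is a numerator times \<open>d + 1\<close> denominators, divided by one of them,
  hence at most a product of \<open>d + 2\<close> bounds for cells.\<close>

definition tm_H :: "nat \<Rightarrow> tm" where "tm_H d = tm_prod (map (\<lambda>_. tm_W) [0..<d + 2])"
definition tm_cube :: "tm \<Rightarrow> tm" where "tm_cube t = Lit 2 \<otimes> (t \<otimes> t \<otimes> t)"
fun tm_coord_bound :: "nat \<Rightarrow> tm \<Rightarrow> tm" where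
  "tm_coord_bound 0 H = Lit 0"
| "tm_coord_bound (Suc e) H = H \<otimes> (Lit 1 \<oplus> Lit (int e) \<otimes> tm_coord_bound e (tm_cube H))"
fun tm_entry_bound :: "nat \<Rightarrow> tm \<Rightarrow> tm" where
  "tm_entry_bound 0 H = H"
| "tm_entry_bound (Suc e) H = tm_entry_bound e (tm_cube H)"
definition tm_D :: "nat \<Rightarrow> nat \<Rightarrow> tm" where
  "tm_D d n = tm_lead d (tm_row d) (Lit 1) (tm_M d n)"
definition tm_X :: "nat \<Rightarrow> tm" where "tm_X d = tm_coord_bound d (tm_H d)"
definition tm_F :: "nat \<Rightarrow> nat \<Rightarrow> tm" where
  "tm_F d n = Lit (int (n + d)) \<otimes> (tm_H d \<otimes> (Lit 1 \<oplus> Lit (int d) \<otimes> tm_X d))"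
definition tm_B :: "nat \<Rightarrow> nat \<Rightarrow> tm" where
  "tm_B d n = tm_fact (tm_M d n \<oplus> Lit (int d)) \<otimes> tm_D d n \<otimes> tm_pow (tm_F d n) (tm_M d n) \<otimes>
     tm_prod (map (\<lambda>_. Lit 2 \<otimes> tm_X d) [0..<d])"
definition tm_Z :: "nat \<Rightarrow> nat \<Rightarrow> tm" where
  "tm_Z d n = Lit 2 \<otimes> tm_B d n \<oplus> Lit 2 \<oplus> tm_entry_bound d (tm_H d)"
text \<open>The exponent \<open>K ^ i\<close> is out of reach of \<open>tm_pow\<close>, but
  \<open>i\<close> nested loops of length \<open>K\<close> produce it.\<close>

fun tm_tower :: "tm \<Rightarrow> nat \<Rightarrow> tm" where
  "tm_tower Z 0 = Z"
| "tm_tower Z (Suc i) = Loop Mul 1 0 (tm_tower Z i)"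
definition tm_L :: "nat \<Rightarrow> nat \<Rightarrow> nat \<Rightarrow> tm" where
  "tm_L d n c = tm_sum (map (\<lambda>i. tm_form d n i c \<otimes> tm_tower (tm_Z d n) i) [0..<n + d])"
definition tm_N :: "nat \<Rightarrow> nat \<Rightarrow> tm" where
  "tm_N d n = tm_D d n \<otimes> tm_num d (tm_row d) (\<lambda>_. Lit 0) (tm_L d n) (tm_M d n) \<oslash>
     tm_den d (tm_row d) (tm_L d n) (tm_M d n)"
definition tm_Y :: "nat \<Rightarrow> nat \<Rightarrow> tm" where
  "tm_Y d n = tm_prod (map (\<lambda>i. tm_pow (tm_tower (tm_Z d n) i) (tm_exponent d n i)) [0..<n])"
definition tm_numerator :: "nat \<Rightarrow> nat \<Rightarrow> tm" where
  "tm_numerator d n = (let N = tm_N d n; Y = tm_Y d n; Z = tm_Z d n in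
     (Lit 2 \<otimes> N \<oplus> Y) \<oslash> (Lit 2 \<otimes> Y) \<ominus>
     Z \<otimes> ((Lit 2 \<otimes> N \<oplus> Z \<otimes> Y) \<oslash> (Lit 2 \<otimes> (Z \<otimes> Y))))"
text \<open>The last product undoes the scaling that made the forms integral.\<close>

definition tm_denominator :: "nat \<Rightarrow> nat \<Rightarrow> tm" where
  "tm_denominator d n = tm_fact (tm_M d n \<oplus> Lit (int d)) \<otimes> tm_D d n \<otimes>
     tm_prod (map (\<lambda>i. tm_pow (tm_scale d (tm_k \<oplus> Lit (int i))) (tm_exponent d n i)) [0..<n])"

section \<open>Layout of the input\<close>

lemma length_concat_map:
  assumes "\<And>i. i < k \<Longrightarrow> length (f i) = w"
  shows "length (concat (map f [0..<k])) = k * w"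
  using assms by (induction k) auto

lemma nth_concat_map:
  assumes "\<And>i. i < k \<Longrightarrow> length (f i) = w" "i < k" "t < w"
  shows "concat (map f [0..<k]) ! (i * w + t) = f i ! t"
  using assms
proof (induction k)
  case (Suc k)
  have len: "length (concat (map f [0..<k])) = k * w"
    by (rule length_concat_map) (use Suc.prems in auto)
  show ?case
  proof (cases "i = k")
    case True
    then show ?thesis by (simp add: nth_append len)
  next
    case False
    then have "i * w + t < k * w"
      using Suc.prems(2,3) mult_le_mono1[of "Suc i" k w] by simp
    then show ?thesis using Suc False by (simp add: nth_append len)
  qed
qed simp

lemma length_le_enc_size: "length xs \<le> enc_size xs"
proof (induction xs)
  case (Cons x xs)
  then show ?case using int_size_pos[of x] by (simp add: enc_size_def)
qed (simp add: enc_size_def)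

lemma int_size_le_enc_size: "x \<in> set xs \<Longrightarrow> int_size x \<le> enc_size xs"
  unfolding enc_size_def by (intro member_le_sum_list) auto

section \<open>An instance and its integer data\<close>

locale integral_input =
  fixes js :: "'d::finite list" and n k :: nat and A l :: "nat \<Rightarrow> rat ^ 'd"
    and b r :: "nat \<Rightarrow> rat" and m :: "nat \<Rightarrow> nat"
  assumes distinct: "distinct js" and js: "set js = UNIV"
begin

definition d where "d = length js"
definition M where "M = (\<Sum>i<n. m i)"
definition K where "K = (k + n) * (2 * d + 2) + M + (n + d + 3)"

definition "input = enc_polyhedron js k A b @ enc_affine_list js n l r @ enc_exponents n m"
abbreviation "inp \<equiv> initial_mem input"

definition coeffs :: "nat \<Rightarrow> nat \<Rightarrow> rat" where
  "coeffs i c = (if c = 0 then if i < k then b i else r (i - k)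
     else (if i < k then A i else l (i - k)) $ (js ! (c - 1)))"

definition row_enc :: "nat \<Rightarrow> int list" where
  "row_enc i = (if i < k then enc_vec js (A i) @ enc_rat (b i) else enc_vec js (l (i - k)) @ enc_rat (r (i - k)))"

lemma input_eq: "input = int k # concat (map row_enc [0..<k + n]) @ enc_exponents n m"
proof -
  have "concat (map row_enc [0..<k + n]) =
      concat (map row_enc [0..<k]) @ concat (map (\<lambda>i. row_enc (k + i)) [0..<n])"
  proof -
    have "[0..<k + n] = [0..<k] @ map (\<lambda>i. k + i) [0..<n]"
      by (simp add: upt_add_eq_append[of 0] map_add_upt add.commute)
    then show ?thesis by (simp add: comp_def)
  qed
  moreover have "map row_enc [0..<k] = map (\<lambda>i. enc_vec js (A i) @ enc_rat (b i)) [0..<k]"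
    by (simp add: row_enc_def)
  moreover have "row_enc (k + i) = enc_vec js (l i) @ enc_rat (r i)" for i
    by (simp add: row_enc_def)
  ultimately show ?thesis
    by (simp add: input_def enc_polyhedron_def enc_affine_list_def)
qed

lemma enc_vec_eq: "enc_vec js v = concat (map (\<lambda>c. enc_rat (v $ (js ! c))) [0..<d])"
proof -
  have "map (\<lambda>j. enc_rat (v $ j)) js = map (\<lambda>c. enc_rat (v $ (js ! c))) [0..<d]"
    unfolding d_def by (subst map_nth[symmetric]) (simp add: comp_def)
  then show ?thesis by (simp add: enc_vec_def)
qed

lemma length_enc_vec: "length (enc_vec js v) = 2 * d"
  unfolding enc_vec_eq by (subst length_concat_map[where w = 2]) (auto simp: enc_rat_def)

lemma nth_enc_vec: "c < d \<Longrightarrow> t < 2 \<Longrightarrow> enc_vec js v ! (2 * c + t) = enc_rat (v $ (js ! c)) ! t"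
  unfolding enc_vec_eq using nth_concat_map[of d "\<lambda>c. enc_rat (v $ (js ! c))" 2 c t]
  by (simp add: enc_rat_def mult.commute)

lemma length_row_enc: "length (row_enc i) = 2 * d + 2"
  by (simp add: row_enc_def length_enc_vec enc_rat_def)

lemma nth_row_enc:
  assumes "c \<le> d" "t < 2"
  shows "row_enc i ! (col_pos d c + t) = enc_rat (coeffs i c) ! t"
proof (cases c)
  case 0
  then show ?thesis by (simp add: row_enc_def col_pos_def nth_append length_enc_vec coeffs_def)
next
  case (Suc c')
  then have "2 * c' + t < 2 * d" using assms by simp
  then show ?thesis using Suc assms nth_enc_vec[of c' t]
    by (simp add: row_enc_def col_pos_def nth_append length_enc_vec coeffs_def)
qed

lemma length_rows: "length (concat (map row_enc [0..<k + n])) = (k + n) * (2 * d + 2)"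
  by (rule length_concat_map) (rule length_row_enc)

lemma length_input: "length input = 1 + (k + n) * (2 * d + 2) + n"
  unfolding input_eq by (simp add: length_rows enc_exponents_def del: upt_add_eq_append)

lemma inp_0: "inp 0 = int k"
  by (simp add: initial_mem_def input_eq)

lemma inp_row:
  assumes "i < k + n" "c \<le> d" "t < 2"
  shows "inp (int i * int (2 * d + 2) + int (1 + t + col_pos d c)) = enc_rat (coeffs i c) ! t"
proof -
  have pos: "col_pos d c + t < 2 * d + 2" using assms(2,3) by (auto simp: col_pos_def)
  have lt: "i * (2 * d + 2) + (col_pos d c + t) < (k + n) * (2 * d + 2)"
    using pos mult_le_mono1[of "Suc i" "k + n" "2 * d + 2"] assms(1) by simp
  have "concat (map row_enc [0..<k + n]) ! (i * (2 * d + 2) + (col_pos d c + t)) = row_enc i ! (col_pos d c + t)"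
    by (rule nth_concat_map) (use length_row_enc assms(1) pos in auto)
  also have "\<dots> = enc_rat (coeffs i c) ! t" by (rule nth_row_enc) fact+
  finally have "input ! Suc (i * (2 * d + 2) + (col_pos d c + t)) = enc_rat (coeffs i c) ! t"
    unfolding input_eq using lt by (simp only: append_Cons nth_Cons_Suc nth_append length_rows if_True)
  moreover have "int i * int (2 * d + 2) + int (1 + t + col_pos d c) = int (Suc (i * (2 * d + 2) + (col_pos d c + t)))"
    by (simp add: algebra_simps)
  moreover have "Suc (i * (2 * d + 2) + (col_pos d c + t)) < length input"
    unfolding length_input using lt by simp
  ultimately show ?thesis unfolding initial_mem_def by (simp only: nat_int of_nat_0_le_iff of_nat_less_iff if_True simp_thms)
qed

lemma inp_exponent:
  assumes "i < n"
  shows "inp ((int k + int n) * int (2 * d + 2) + int (1 + i)) = int (m i)"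
proof -
  have "input ! Suc ((k + n) * (2 * d + 2) + i) = int (m i)"
    unfolding input_eq using assms
    by (simp only: append_Cons nth_Cons_Suc nth_append length_rows) (simp add: enc_exponents_def)
  moreover have "(int k + int n) * int (2 * d + 2) + int (1 + i) = int (Suc ((k + n) * (2 * d + 2) + i))"
    by (simp add: algebra_simps)
  moreover have "Suc ((k + n) * (2 * d + 2) + i) < length input"
    unfolding length_input using assms by simp
  ultimately show ?thesis unfolding initial_mem_def by (simp only: nat_int of_nat_0_le_iff of_nat_less_iff if_True simp_thms)
qed

definition numer where "numer i c = inp (int i * int (2 * d + 2) + int (1 + col_pos d c))"
definition denom where "denom i c = inp (int i * int (2 * d + 2) + int (2 + col_pos d c))"
definition scale where "scale i = (\<Prod>c<Suc d. denom i c)"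
definition entry where "entry i c = numer i c * scale i div denom i c"
definition row where "row i c = (if i < k then if c = 0 then - entry i c else entry i c else 0)"
definition form where "form i c = (if i < n then entry (k + i) c else if i + c = n + d then 1 else 0)"

lemma numer_denom:
  assumes "i < k + n" "c \<le> d"
  shows "denom i c > 0" and "coeffs i c = of_int (numer i c) / of_int (denom i c)"
proof -
  have q: "numer i c = fst (quotient_of (coeffs i c))" "denom i c = snd (quotient_of (coeffs i c))"
    using inp_row[OF assms, of 0] inp_row[OF assms, of 1] by (simp_all add: numer_def denom_def enc_rat_def)
  show "denom i c > 0" unfolding q by (rule quotient_of_denom_pos')
  show "coeffs i c = of_int (numer i c) / of_int (denom i c)"
    unfolding q by (rule quotient_of_div) simp
qed

lemma scale_pos: "i < k + n \<Longrightarrow> scale i > 0"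
  unfolding scale_def by (intro prod_pos) (simp add: numer_denom(1))

lemma entry_eq:
  assumes "i < k + n" "c \<le> d"
  shows "real_of_int (entry i c) = of_int (scale i) * of_rat (coeffs i c)"
proof -
  have dvd: "denom i c dvd scale i"
    unfolding scale_def using assms(2) by (intro dvd_prodI) auto
  then have "denom i c dvd numer i c * scale i" by simp
  then have "real_of_int (entry i c) = of_int (numer i c * scale i) / of_int (denom i c)"
    unfolding entry_def by (rule real_of_int_div)
  moreover have "real_of_rat (coeffs i c) = of_int (numer i c) / of_int (denom i c)"
    unfolding numer_denom(2)[OF assms] by (simp add: of_rat_divide)
  ultimately show ?thesis by simp
qed


lemma tval_k: "tval inp K' tm_k env = int k"
  by (simp add: tm_k_def inp_0)

lemma tval_Input_nat: "tval inp K' t env = int v \<Longrightarrow> tval inp K' (Input t) env = inp (int v)"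
  by simp

lemma tval_denom: "tval inp K' t env = int i \<Longrightarrow> tval inp K' (tm_denom d t c) env = denom i c"
  unfolding tm_denom_def denom_def
  by (subst tval_Input_nat[where v = "i * (2 * d + 2) + (2 + col_pos d c)"]) (simp_all add: algebra_simps)

lemma tval_numer: "tval inp K' t env = int i \<Longrightarrow> tval inp K' (tm_numer d t c) env = numer i c"
  unfolding tm_numer_def numer_def
  by (subst tval_Input_nat[where v = "i * (2 * d + 2) + (1 + col_pos d c)"]) (simp_all add: algebra_simps)

lemma tval_scale: "tval inp K' t env = int i \<Longrightarrow> tval inp K' (tm_scale d t) env = scale i"
  unfolding tm_scale_def scale_def tval_prod by (intro prod.cong refl tval_denom)

lemma tval_entry: "tval inp K' t env = int i \<Longrightarrow> tval inp K' (tm_entry d t c) env = entry i c"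
  by (simp add: tm_entry_def entry_def tval_scale tval_denom tval_numer)

lemma tval_row: "tval inp K' t env = int i \<Longrightarrow> tval inp K' (tm_row d t c) env = row i c"
  by (simp add: tm_row_def row_def tval_k tval_entry)

lemma has_rows_row: "has_rows inp K' e (tm_row d) env row"
  by (simp add: has_rows_def tval_row)

lemma tval_form: "tval inp K' (tm_form d n i c) env = form i c"
  by (simp add: tm_form_def form_def tval_k tval_entry[where i = "k + i"])

lemma tval_exponent: "i < n \<Longrightarrow> tval inp K' (tm_exponent d n i) env = int (m i)"
  using inp_exponent[of i] unfolding tm_exponent_def
  by (subst tval_Input_nat[where v = "(k + n) * (2 * d + 2) + (1 + i)"]) (simp_all add: tval_k algebra_simps)

lemma tval_M: "tval inp K' (tm_M d n) env = int M"
  unfolding tm_M_def M_def tval_sum of_nat_sum by (intro sum.cong refl tval_exponent) simp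

text \<open>Valid for every iteration bound \<open>K'\<close>, in particular for the bound
  \<open>0\<close> in force when the program evaluates this term.\<close>

lemma tval_K: "tval inp K' (tm_K d n) env = int K"
  by (simp add: tm_K_def K_def tval_k tval_M algebra_simps)

definition W where "W = 1 + (\<Sum>i<K. inp (int i) * inp (int i))"
definition H where "H = W ^ (d + 2)"
definition D where "D = lead K d row 1 M"
definition X where "X = coord_bound d H"
definition F where "F = int (n + d) * (H * (1 + int d * X))"
definition B where "B = fact (M + d) * D * F ^ M * (2 * X) ^ d"
definition Z where "Z = 2 * B + 2 + entry_bound d H"
definition LZ where "LZ c = (\<Sum>i<n + d. form i c * Z ^ (K ^ i))"
definition N where "N = D * num K d row (\<lambda>_. False) LZ M div den K d row LZ M"
definition Y where "Y = Z ^ (\<Sum>i<n. m i * K ^ i)"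
definition numerator where
  "numerator = (2 * N + Y) div (2 * Y) - Z * ((2 * N + Z * Y) div (2 * (Z * Y)))"
definition denominator where
  "denominator = fact (M + d) * D * (\<Prod>i<n. scale (k + i) ^ m i)"

lemma M_d_le_K: "M + d \<le> K" and M_less_K: "M < K" and K_ge_2: "2 \<le> K"
  and k_le_K: "k \<le> K" and length_input_le_K: "length input \<le> K"
  unfolding length_input K_def by (auto intro: trans_le_add1 simp: algebra_simps)

lemma m_le_K: "i < n \<Longrightarrow> m i \<le> K"
proof -
  assume "i < n"
  then have "m i \<le> M" unfolding M_def by (intro member_le_sum) auto
  then show ?thesis using M_less_K by simp
qed

lemma W_ge: "\<bar>inp a\<bar> \<le> W" and W_ge_1: "1 \<le> W"
proof -
  have nn: "0 \<le> (\<Sum>i<K. inp (int i) * inp (int i))" by (intro sum_nonneg) simp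
  then show "1 \<le> W" by (simp add: W_def)
  show "\<bar>inp a\<bar> \<le> W"
  proof (cases "0 \<le> a \<and> a < int (length input)")
    case True
    then have "nat a < K" using length_input_le_K by linarith
    then have "inp (int (nat a)) * inp (int (nat a)) \<le> (\<Sum>i<K. inp (int i) * inp (int i))"
      by (intro member_le_sum) auto
    then have "inp a * inp a \<le> W" using True by (simp add: W_def)
    moreover have "\<bar>inp a\<bar> \<le> \<bar>inp a\<bar> * \<bar>inp a\<bar>"
    proof (cases "inp a = 0")
      case False
      then have "1 * \<bar>inp a\<bar> \<le> \<bar>inp a\<bar> * \<bar>inp a\<bar>" by (intro mult_right_mono) auto
      then show ?thesis by simp
    qed simp
    ultimately show ?thesis by simp
  next
    case False
    then show ?thesis using \<open>1 \<le> W\<close> by (auto simp: initial_mem_def)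
  qed
qed

lemma H_ge_1: "1 \<le> H"
  unfolding H_def using W_ge_1 by (rule one_le_power)

lemma abs_entry_le: "\<bar>entry i c\<bar> \<le> H"
proof -
  have "\<bar>scale i\<bar> \<le> (\<Prod>c<Suc d. W)"
    unfolding scale_def abs_prod by (intro prod_mono) (simp add: denom_def W_ge)
  then have "\<bar>numer i c * scale i\<bar> \<le> W * W ^ Suc d"
    unfolding abs_mult using W_ge_1 by (intro mult_mono) (auto simp: numer_def W_ge)
  then show ?thesis
    unfolding entry_def H_def using abs_div_le_abs[of "numer i c * scale i" "denom i c"] by simp
qed

lemma abs_row_le: "\<bar>row i c\<bar> \<le> H"
  using abs_entry_le[of i] H_ge_1 by (simp add: row_def)

lemma abs_form_le: "\<bar>form i c\<bar> \<le> H"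
  using abs_entry_le[of "k + i"] H_ge_1 by (simp add: form_def)

lemma D_pos: "0 < D"
  unfolding D_def by (rule lead_pos) simp

lemma X_nonneg: "0 \<le> X"
  unfolding X_def by (rule coord_bound_nonneg) (rule H_ge_1)

lemma Z_ge: "2 * B + 2 \<le> Z" "entry_bound d H + 1 \<le> Z"
proof -
  have "0 \<le> F" using H_ge_1 X_nonneg by (simp add: F_def)
  then have "0 \<le> B" using D_pos X_nonneg by (simp add: B_def)
  moreover have "1 \<le> entry_bound d H" using entry_bound_ge[OF H_ge_1, of d] H_ge_1 by linarith
  ultimately show "2 * B + 2 \<le> Z" "entry_bound d H + 1 \<le> Z" by (auto simp: Z_def)
qed

lemma denominator_pos: "0 < denominator"
  unfolding denominator_def using D_pos scale_pos by (intro mult_pos_pos prod_pos) auto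

section \<open>Identification with the Lebesgue integral\<close>

text \<open>Coordinates are named by the basis vectors themselves, because \<open>lborel\<close> is
  the image under \<open>point\<close> of the product measure indexed by
  \<open>Basis\<close>.\<close>

definition idx :: "nat \<Rightarrow> real ^ 'd" where "idx c = axis (js ! (c - 1)) 1"
definition point :: "(real ^ 'd \<Rightarrow> real) \<Rightarrow> real ^ 'd" where "point x = (\<Sum>u\<in>Basis. x u *\<^sub>R u)"

lemma bij_js: "bij_betw (\<lambda>c. js ! (c - 1)) {1..d} UNIV"
proof -
  have "bij_betw ((!) js) {..<d} UNIV"
    using bij_betw_nth[OF distinct refl] js by (simp add: d_def lessThan_atLeast0)
  moreover have "bij_betw (\<lambda>c. c - 1) {1..d} {..<d}"
    by (rule bij_betw_byWitness[where f' = Suc]) auto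
  ultimately show ?thesis using bij_betw_trans by (fastforce simp: comp_def)
qed

lemma idx_Basis: "idx ` {1..d} = Basis"
proof -
  have "idx ` {1..d} = (\<lambda>j. axis j 1) ` ((\<lambda>c. js ! (c - 1)) ` {1..d})"
    unfolding idx_def image_image ..
  also have "\<dots> = Basis"
    unfolding bij_betw_imp_surj_on[OF bij_js] by (auto simp: Basis_vec_def)
  finally show ?thesis .
qed

lemma inj_idx: "inj_on idx {1..d}"
proof (rule inj_onI)
  fix c c' assume c: "c \<in> {1..d}" "c' \<in> {1..d}" and "idx c = idx c'"
  then have "js ! (c - 1) = js ! (c' - 1)" by (simp add: idx_def axis_eq_axis)
  then show "c = c'" using inj_onD[OF bij_betw_imp_inj_on[OF bij_js]] c by blast
qed

lemma point_nth: "point x $ j = x (axis j 1)"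
proof -
  have "point x $ j = point x \<bullet> axis j 1" by (simp add: inner_axis)
  also have "\<dots> = x (axis j 1)" unfolding point_def by (rule inner_sum_left_Basis) simp
  finally show ?thesis .
qed

lemma point_nth_js: "c \<in> {1..d} \<Longrightarrow> point x $ (js ! (c - 1)) = x (idx c)"
  by (simp add: point_nth idx_def)

lemma inner_point:
  "real_vec v \<bullet> point x = (\<Sum>c=1..d. of_rat (v $ (js ! (c - 1))) * x (idx c))"
proof -
  have "real_vec v \<bullet> point x = (\<Sum>j\<in>UNIV. of_rat (v $ j) * point x $ j)"
    by (simp add: inner_vec_def real_vec_def)
  also have "\<dots> = (\<Sum>c=1..d. of_rat (v $ (js ! (c - 1))) * point x $ (js ! (c - 1)))"
    by (rule sum.reindex_bij_betw[OF bij_js, symmetric])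
  also have "\<dots> = (\<Sum>c=1..d. of_rat (v $ (js ! (c - 1))) * x (idx c))"
    by (intro sum.cong refl) (simp only: point_nth_js)
  finally show ?thesis .
qed

lemma aff_entry:
  assumes "i < k + n"
  shows "aff idx d (\<lambda>c. of_int (entry i c)) x = of_int (scale i) *
    (of_rat (coeffs i 0) + (\<Sum>c=1..d. of_rat (coeffs i c) * x (idx c)))"
proof -
  have "(\<Sum>c=1..d. real_of_int (entry i c) * x (idx c)) =
    (\<Sum>c=1..d. of_int (scale i) * (of_rat (coeffs i c) * x (idx c)))"
    by (intro sum.cong refl) (simp add: entry_eq[OF assms])
  then show ?thesis by (simp add: aff_def entry_eq[OF assms] distrib_left sum_distrib_left)
qed

lemma aff_form:
  assumes "i < n"
  shows "aff idx d (\<lambda>c. of_int (form i c)) x = of_int (scale (k + i)) * (real_vec (l i) \<bullet> point x + of_rat (r i))"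
proof -
  have "(\<lambda>c. real_of_int (form i c)) = (\<lambda>c. of_int (entry (k + i) c))"
    using assms by (simp add: form_def)
  then show ?thesis
    using aff_entry[of "k + i" x] assms by (simp add: inner_point coeffs_def add.commute)
qed

lemma aff_row:
  assumes "i < k"
  shows "aff idx d (\<lambda>c. of_int (row i c)) x = of_int (scale i) * (real_vec (A i) \<bullet> point x - of_rat (b i))"
proof -
  \<comment> \<open>\<open>row\<close> differs from \<open>entry\<close> only in the sign of the
    constant term, hence by twice that term.\<close>
  have "aff idx d (\<lambda>c. of_int (row i c)) x =
      aff idx d (\<lambda>c. of_int (entry i c)) x - 2 * of_int (entry i 0)"
    using assms by (simp add: aff_def row_def)
  then show ?thesis
    using aff_entry[of i x] entry_eq[of i 0] assms by (simp add: inner_point coeffs_def algebra_simps)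
qed

lemma region_iff: "x \<in> region idx K d row (\<lambda>_. False) \<longleftrightarrow> point x \<in> rational_polyhedron k A b"
proof -
  have "aff idx d (\<lambda>c. of_int (row i c)) x \<le> 0 \<longleftrightarrow> real_vec (A i) \<bullet> point x \<le> of_rat (b i)" if "i < k" for i
    using scale_pos[of i] that unfolding aff_row[OF that] by (simp add: mult_le_0_iff)
  moreover have "aff idx d (\<lambda>c. of_int (row i c)) x \<le> 0" if "\<not> i < k" for i
    using that by (simp add: aff_def row_def)
  ultimately show ?thesis
    unfolding region_def rational_polyhedron_def using k_le_K by (auto intro: less_le_trans)
qed

lemma bdd_region_row:
  assumes "polytope (rational_polyhedron k A b)"
  shows "bdd_region idx K d row"
proof -
  obtain C where C: "\<And>v. v \<in> rational_polyhedron k A b \<Longrightarrow> norm v \<le> C"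
    using polytope_imp_bounded[OF assms] unfolding bounded_iff by blast
  have "\<bar>x (idx c)\<bar> \<le> C" if "x \<in> region idx K d row (\<lambda>_. False)" "c \<in> {1..d}" for x c
    using C[of "point x"] that(1) region_iff[of x] component_le_norm_cart[of "point x" "js ! (c - 1)"]
    unfolding point_nth_js[OF that(2)] by simp
  then show ?thesis unfolding bdd_region_def by blast
qed

text \<open>Multiplication by the powers of the scales turns the rational forms into the integral
  ones of \<open>integral_extraction\<close>; dividing by these powers again yields the
  denominator.\<close>

lemma integral_eq:
  assumes "polytope (rational_polyhedron k A b)"
  shows "(LINT x : rational_polyhedron k A b | lborel.
            (\<Prod>i<n. (real_vec (l i) \<bullet> x + real_of_rat (r i)) ^ m i) / (\<Prod>i<n. fact (m i)))
    = of_int numerator / of_int denominator"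
proof -
  let ?P = "rational_polyhedron k A b"
  let ?f = "\<lambda>x. (\<Prod>i<n. (real_vec (l i) \<bullet> x + real_of_rat (r i)) ^ m i) / (\<Prod>i<n. fact (m i))"
  let ?M = "Pi\<^sub>M (idx ` {1..d}) (\<lambda>_. lborel :: real measure)"
  let ?I = "\<integral>x. indicator (region idx K d row (\<lambda>_. False)) x *
      (\<Prod>i<n. aff idx d (\<lambda>c. of_int (form i c)) x ^ m i / fact (m i)) \<partial>?M"
  let ?s = "of_int (\<Prod>i<n. scale (k + i) ^ m i) :: real"
  have P: "?P \<in> sets borel"
    using polytope_imp_closed[OF assms] by (rule borel_closed)
  have point: "point \<in> measurable (Pi\<^sub>M Basis (\<lambda>_. lborel)) borel"
    unfolding point_def[abs_def] by measurable
  have f: "?f \<in> borel_measurable borel" by measurable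
  have "(LINT x : ?P | lborel. ?f x) = (\<integral>x. indicator ?P x *\<^sub>R ?f x \<partial>distr (Pi\<^sub>M Basis (\<lambda>_. lborel)) borel point)"
    unfolding set_lebesgue_integral_def point_def[abs_def] by (subst lborel_eq) (rule refl)
  also have "\<dots> = (\<integral>x. indicator ?P (point x) *\<^sub>R ?f (point x) \<partial>Pi\<^sub>M Basis (\<lambda>_. lborel))"
    by (rule integral_distr[OF point]) (use P f in measurable)
  finally have "?s * (LINT x : ?P | lborel. ?f x) = (\<integral>x. ?s * (indicator ?P (point x) * ?f (point x)) \<partial>?M)"
    unfolding idx_Basis by simp
  also have "\<dots> = ?I"
  proof (rule Bochner_Integration.integral_cong[OF refl])
    fix x
    have "(indicator (region idx K d row (\<lambda>_. False)) x :: real) = indicator ?P (point x)"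
      by (simp only: indicator_def region_iff)
    moreover have "(\<Prod>i<n. aff idx d (\<lambda>c. of_int (form i c)) x ^ m i / fact (m i)) = ?s * ?f (point x)"
      by (simp add: aff_form power_mult_distrib prod.distrib prod_dividef)
    ultimately show "?s * (indicator ?P (point x) * ?f (point x)) =
        indicator (region idx K d row (\<lambda>_. False)) x *
        (\<Prod>i<n. aff idx d (\<lambda>c. of_int (form i c)) x ^ m i / fact (m i))"
      by simp
  qed
  finally have I: "?s * (LINT x : ?P | lborel. ?f x) = ?I" .
  have "real_of_int numerator = fact (M + d) * of_int D * ?I"
    unfolding numerator_def
  proof (rule integral_extraction[where B = B])
    show "inj_on idx {1..d}" by (rule inj_idx)
    show "bdd_region idx K d row" by (rule bdd_region_row) fact
    show "n \<le> i \<Longrightarrow> form i c = (if i + c = n + d then 1 else 0)" for i c by (simp add: form_def)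
    show "(\<Sum>i<n. m i) < K" using M_less_K by (simp add: M_def)
  qed (rule M_def D_def X_def F_def N_def Y_def H_ge_1 abs_row_le abs_form_le K_ge_2 Z_ge
      ext[of LZ, OF LZ_def] eq_refl[OF B_def[symmetric]])+
  also have "\<dots> = of_int denominator * (LINT x : ?P | lborel. ?f x)"
    unfolding I[symmetric] denominator_def by simp
  finally show ?thesis using denominator_pos by (simp add: field_simps)
qed

end

section \<open>Correctness of the terms\<close>

lemma has_valI: "(\<And>env. tval inp K t env = v) \<Longrightarrow> has_val inp K e t env v"
  by (simp add: has_val_def)

lemma has_val_cube: "has_val inp K e t env v \<Longrightarrow> has_val inp K e (tm_cube t) env (2 * v ^ 3)"
  by (simp add: has_val_def tm_cube_def power3_eq_cube mult.assoc)

lemma has_val_coord_bound: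
  "has_val inp K e t env v \<Longrightarrow> has_val inp K e (tm_coord_bound j t) env (coord_bound j v)"
proof (induction j arbitrary: t v)
  case (Suc j)
  from Suc.IH[OF has_val_cube[OF Suc.prems]] Suc.prems show ?case
    by (simp add: has_val_def)
qed (simp add: has_val_def)

lemma has_val_entry_bound:
  "has_val inp K e t env v \<Longrightarrow> has_val inp K e (tm_entry_bound j t) env (entry_bound j v)"
  by (induction j arbitrary: t v) (auto intro: has_val_cube)

lemma has_val_tower:
  "has_val inp K e t env v \<Longrightarrow> has_val inp K e (tm_tower t i) env (v ^ (K ^ i))"
proof (induction i)
  case (Suc i)
  have "has_val inp K e (tm_tower t (Suc i)) env (iter_val Mul 1 (\<lambda>_. v ^ (K ^ i)) K)"
    unfolding tm_tower.simps by (rule has_val_Loop0) (rule has_valD[OF Suc.IH[OF Suc.prems]])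
  then show ?case by (simp add: iter_val_Mul power_mult[symmetric] mult.commute)
qed simp

context integral_input
begin

lemmas has_val_M = has_valI[OF tval_M]

lemma has_val_M_d: "has_val inp K' e (tm_M d n \<oplus> Lit (int d)) env (int (M + d))"
proof -
  have "has_val inp K' e (tm_M d n \<oplus> Lit (int d)) env (int M + int d)"
    by (intro has_val_add has_val_M has_val_Lit)
  then show ?thesis by simp
qed

lemma has_val_W: "has_val inp K e tm_W env W"
proof -
  have "has_val inp K e tm_W env (iter_val Add 1 (\<lambda>i. inp (int i) * inp (int i)) K)"
    unfolding tm_W_def by (rule has_val_Loop0) simp
  then show ?thesis by (simp add: W_def iter_val_Add)
qed

lemma has_val_H: "has_val inp K e (tm_H d) env H"
  using has_val_prod[of "d + 2" inp K e "\<lambda>_. tm_W" env "\<lambda>_. W"] has_val_W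
  by (simp add: tm_H_def H_def)

lemma has_val_X: "has_val inp K e (tm_X d) env X"
  unfolding tm_X_def X_def by (intro has_val_coord_bound has_val_H)

lemma has_val_D: "has_val inp K d (tm_D d n) env D"
  unfolding tm_D_def D_def by (intro has_val_lead has_rows_row has_val_Lit has_val_M M_d_le_K)

lemma has_val_F: "has_val inp K e (tm_F d n) env F"
  unfolding tm_F_def F_def by (intro has_val_mul has_val_add has_val_Lit has_val_H has_val_X)

lemma has_val_B: "has_val inp K d (tm_B d n) env B"
proof -
  have "has_val inp K d (tm_prod (map (\<lambda>_. Lit 2 \<otimes> tm_X d) [0..<d])) env (\<Prod>i<d. 2 * X)"
    by (intro has_val_prod has_val_mul has_val_Lit has_val_X)
  then have "has_val inp K d (tm_prod (map (\<lambda>_. Lit 2 \<otimes> tm_X d) [0..<d])) env ((2 * X) ^ d)"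
    by simp
  then show ?thesis
    unfolding tm_B_def B_def
    by (intro has_val_mul has_val_fact has_val_pow has_val_M_d has_val_D has_val_F has_val_M
        M_d_le_K less_imp_le[OF M_less_K])
qed

lemma has_val_Z: "has_val inp K d (tm_Z d n) env Z"
  unfolding tm_Z_def Z_def
  by (intro has_val_mul has_val_add has_val_Lit has_val_B has_val_entry_bound has_val_H)

lemma has_val_L: "has_val inp K d (tm_L d n c) env (LZ c)"
  unfolding tm_L_def LZ_def
  by (intro has_val_sum has_val_mul has_val_tower has_val_Z has_valI tval_form)

lemma has_val_N:
  assumes "den K d row LZ M \<noteq> 0"
  shows "has_val inp K d (tm_N d n) env N"
proof -
  have "has_flags inp K d (\<lambda>_. Lit 0) env (\<lambda>_. False)" by (simp add: has_flags_def)
  then show ?thesis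
    unfolding tm_N_def N_def using assms
    by (intro has_val_mul has_val_div has_val_num has_val_den has_val_D has_rows_row has_val_L has_val_M M_d_le_K)
qed

lemma has_val_Y: "has_val inp K d (tm_Y d n) env Y"
proof -
  have "has_val inp K d (tm_Y d n) env (\<Prod>i<n. (Z ^ (K ^ i)) ^ m i)"
    unfolding tm_Y_def
    by (intro has_val_prod has_val_pow has_val_tower has_val_Z has_valI tval_exponent m_le_K)
  moreover have "(\<Prod>i<n. (Z ^ (K ^ i)) ^ m i) = Y"
    by (simp add: Y_def power_mult[symmetric] mult.commute power_sum)
  ultimately show ?thesis by simp
qed

lemma has_val_numerator:
  assumes "den K d row LZ M \<noteq> 0"
  shows "has_val inp K d (tm_numerator d n) env numerator"
  unfolding tm_numerator_def numerator_def Let_def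
  by (intro has_val_mul has_val_div has_val_add has_val_sub has_val_Lit has_val_N[OF assms] has_val_Y has_val_Z)

lemma has_val_denominator: "has_val inp K d (tm_denominator d n) env denominator"
  unfolding tm_denominator_def denominator_def
proof (intro has_val_mul has_val_fact has_val_M_d M_d_le_K has_val_D has_val_prod has_val_pow)
  fix i assume i: "i < n"
  show "has_val inp K d (tm_exponent d n i) env (int (m i))" by (intro has_valI tval_exponent i)
  show "m i \<le> K" by (rule m_le_K[OF i])
  show "has_val inp K d (tm_scale d (tm_k \<oplus> Lit (int i))) env (scale (k + i))"
    by (intro has_valI tval_scale) (simp add: tval_k)
qed


lemma den_nonzero: "den K d row LZ M \<noteq> 0"
proof -
  have "0 < den K d row (\<lambda>c. \<Sum>i<n + d. form i c * Z ^ (K ^ i)) M"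
    by (rule den_kron_forms_pos[OF K_ge_2 H_ge_1 abs_form_le _ abs_row_le Z_ge(2)]) (simp add: form_def)
  then show ?thesis by (simp add: LZ_def[abs_def])
qed

lemma tval_numerator: "tval inp K (tm_numerator d n) env = numerator"
  by (rule has_valD[OF has_val_numerator[OF den_nonzero] agree_refl])

lemma tval_denominator: "tval inp K (tm_denominator d n) env = denominator"
  by (rule has_valD[OF has_val_denominator agree_refl])

section \<open>Input size and the final estimate\<close>

definition instance_size where
  "instance_size = (\<Sum>i<n. m i) + enc_size (enc_polyhedron js k A b) + enc_size (enc_affine_list js n l r)"

text \<open>The exponents enter the instance size through their sum, a unary measure, which also
  covers their binary lengths.\<close>

lemma int_size_inp: "int_size (inp a) \<le> instance_size + 2"
proof (cases "0 \<le> a \<and> a < int (length input)")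
  case True
  then have "inp a \<in> set input" by (simp add: initial_mem_def nat_less_iff)
  then consider "inp a \<in> set (enc_polyhedron js k A b)" | "inp a \<in> set (enc_affine_list js n l r)"
    | i where "i < n" "inp a = int (m i)"
    unfolding input_def enc_exponents_def by auto
  then show ?thesis
  proof cases
    case 3
    have "m i \<le> (\<Sum>i<n. m i)" using 3(1) by (intro member_le_sum) auto
    then show ?thesis using 3(2) int_size_int_le[of "m i"] by (simp add: instance_size_def)
  qed (use int_size_le_enc_size in \<open>fastforce simp: instance_size_def\<close>)+
next
  case False
  then have "inp a = 0" by (auto simp: initial_mem_def)
  then show ?thesis using int_size_int_le[of 0] by simp
qed

text \<open>Every encoded cell has length at least \<open>1\<close>, so the number of rows is paid
  for by the encoding. What remains depends on \<open>n\<close> and \<open>d\<close> alone.\<close>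

lemma K_le: "K \<le> instance_size + (n * (2 * d + 2) + n + d + 3)"
proof -
  have "length (enc_polyhedron js k A b) = 1 + k * (2 * d + 2)"
    unfolding enc_polyhedron_def enc_affine_list_def
    by (simp only: list.size length_concat_map[where w = "2 * d + 2"] length_append length_enc_vec)
      (simp add: enc_rat_def length_concat_map[where w = "2 * d + 2"] length_enc_vec)
  then have "k * (2 * d + 2) \<le> enc_size (enc_polyhedron js k A b)"
    using length_le_enc_size[of "enc_polyhedron js k A b"] by simp
  then show ?thesis unfolding K_def instance_size_def M_def by (simp add: algebra_simps)
qed

text \<open>Division by the gcd with a positive denominator is the normal form of
  \<open>quotient_of\<close>, hence exactly what the program outputs.\<close>

lemma enc_rat_value:
  "enc_rat (of_int numerator / of_int denominator) =
    [numerator div gcd numerator denominator, denominator div gcd numerator denominator]"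
  using denominator_pos
  by (simp add: enc_rat_def Fract_of_int_quotient[symmetric] quotient_of_Fract Rat.normalize_def Let_def)

end

theorem proposition3:
  fixes js :: "'d::finite list" and n :: nat
  assumes "distinct js" and "set js = UNIV"
  shows "\<exists>(c :: com) (p :: nat poly).
    \<forall>(k :: nat) (A :: nat \<Rightarrow> rat ^ 'd) (b :: nat \<Rightarrow> rat)
      (l :: nat \<Rightarrow> rat ^ 'd) (r :: nat \<Rightarrow> rat) (m :: nat \<Rightarrow> nat).
      polytope (rational_polyhedron k A b) \<and>
      aff_dim (rational_polyhedron k A b) = int CARD('d) \<longrightarrow>
      (\<exists>q :: rat.
        real_of_rat q =
          (LINT x : rational_polyhedron k A b | lborel.
            (\<Prod>i<n. (real_vec (l i) \<bullet> x + real_of_rat (r i)) ^ m i) / (\<Prod>i<n. fact (m i))) \<and>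
        computes_within c
          (enc_polyhedron js k A b @ enc_affine_list js n l r @ enc_exponents n m)
          (enc_rat q)
          (poly p ((\<Sum>i<n. m i)
            + enc_size (enc_polyhedron js k A b) + enc_size (enc_affine_list js n l r))))"
proof -
  define d where "d = length js"
  define c0 where "c0 = n * (2 * d + 2) + n + d + 3"
  let ?c = "fraction_program (tm_K d n) (tm_numerator d n) (tm_denominator d n)"
  obtain p :: "nat poly" where p: "\<And>xs N K num den.
     (\<forall>a. int_size (initial_mem xs a) \<le> N) \<Longrightarrow> K \<le> N \<Longrightarrow>
     tval (initial_mem xs) 0 (tm_K d n) (\<lambda>_. 0) = int K \<Longrightarrow>
     tval (initial_mem xs) K (tm_numerator d n) (\<lambda>_. 0) = num \<Longrightarrow>
     tval (initial_mem xs) K (tm_denominator d n) (\<lambda>_. 0) = den \<Longrightarrow> den > 0 \<Longrightarrow>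
     computes_within ?c xs [num div gcd num den, den div gcd num den] (poly p N)"
    using fraction_program_poly_time[of "tm_K d n" "tm_numerator d n" "tm_denominator d n"] by blast
  show ?thesis
  \<comment> \<open>Program and polynomial are fixed before the instance, as the terms depend on
    \<open>d\<close> and \<open>n\<close> only. Composition with \<open>[:c0, 1:]\<close> absorbs
    the constant \<open>c0\<close> by which the machine's parameters may exceed the instance
    size.\<close>
  proof (intro exI[of _ ?c] exI[of _ "pcompose p [:c0, 1:]"] allI impI)
    fix k :: nat and A :: "nat \<Rightarrow> rat ^ 'd" and b :: "nat \<Rightarrow> rat"
      and l :: "nat \<Rightarrow> rat ^ 'd" and r :: "nat \<Rightarrow> rat" and m :: "nat \<Rightarrow> nat"
    assume poly: "polytope (rational_polyhedron k A b) \<and> aff_dim (rational_polyhedron k A b) = int CARD('d)"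
    interpret I: integral_input js n k A l b r m
      by unfold_locales (use assms in auto)
    have d: "I.d = d" by (simp add: I.d_def d_def)
    let ?q = "of_int I.numerator / of_int I.denominator :: rat"
    let ?N = "(\<Sum>i<n. m i) + enc_size (enc_polyhedron js k A b) + enc_size (enc_affine_list js n l r)"
    have "real_of_rat ?q = (LINT x : rational_polyhedron k A b | lborel.
            (\<Prod>i<n. (real_vec (l i) \<bullet> x + real_of_rat (r i)) ^ m i) / (\<Prod>i<n. fact (m i)))"
      using I.integral_eq poly by (simp add: of_rat_divide)
    moreover have "computes_within ?c I.input (enc_rat ?q) (poly p (I.instance_size + c0))"
      unfolding I.enc_rat_value
    proof (rule p)
      show "\<forall>a. int_size (initial_mem I.input a) \<le> I.instance_size + c0"
        by (intro allI order_trans[OF I.int_size_inp]) (simp add: c0_def)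
      show "I.K \<le> I.instance_size + c0" using I.K_le by (simp add: c0_def d)
    qed (use I.tval_K I.tval_numerator I.tval_denominator I.denominator_pos in \<open>auto simp: d\<close>)
    ultimately show "\<exists>q :: rat.
        real_of_rat q =
          (LINT x : rational_polyhedron k A b | lborel.
            (\<Prod>i<n. (real_vec (l i) \<bullet> x + real_of_rat (r i)) ^ m i) / (\<Prod>i<n. fact (m i))) \<and>
        computes_within ?c
          (enc_polyhedron js k A b @ enc_affine_list js n l r @ enc_exponents n m)
          (enc_rat q) (poly (pcompose p [:c0, 1:]) ?N)"
      by (intro exI[of _ ?q]) (simp add: I.input_def I.instance_size_def poly_pcompose add.commute)
  qed
qed

end
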